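(* Let $\mathcal{E}$ be a Frobenius category with triangulated quotient $\mathcal{T}$, and let $\mathcal{R}$ be a class of objects in $\mathcal{E}$ such that: (i) $\mathcal{R}$ is a precovering class in $\mathcal{E}$, and every $\mathcal{R}$-precover in $\mathcal{E}$ has a kernel in $\mathcal{E}$; (ii) $\mathcal{R}$ is closed under shifts in $\mathcal{T}$; (iii) for all $R$ in $\mathcal{R}$ the injective hull $I(R)$ is in $\mathcal{R}$. Let $\mathcal{S}$ be the smallest localizing subcategory of $\mathcal{T}$ containing $\mathcal{R}$. If the inclusion $i:\mathcal{S}\to\mathcal{T}$ has a right adjoint $i^!$, and if $X$ is an object of $\mathcal{E}$ of finite $\mathcal{R}$-dimension, then $i^!(X)$ is isomorphic to the object $L_0$ obtained from $X$ by the homotopy approximation construction described in the context.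
   Context: A Frobenius category is an exact category $\mathcal{E}$ with enough projectives and enough injectives in which the projective and injective objects coincide; $\mathcal{P}$ denotes the class of these objects and $\mathcal{T}=\mathcal{E}/\mathcal{P}$ the (stable) quotient category, which has the same objects as $\mathcal{E}$ and is triangulated. Each object $R$ comes with a conflation $R\to I(R)\to R[1]$ with $I(R)$ injective (the "injective hull"), and this gives the shift $R[1]$ in $\mathcal{T}$. A localizing subcategory is a full triangulated subcategory closed under direct sums (arbitrary coproducts). Precovers: a class $\mathcal{R}$ of objects of $\mathcal{E}$ is precovering (contravariantly finite) if for each object $X$ of $\mathcal{E}$ there is a (not necessarily unique) morphism $R_X\to X$ in $\mathcal{E}$ with $R_X\in\mathcal{R}$, called a precover, such that every morphism in $\mathcal{E}$ from an object of $\mathcal{R}$ to $X$ factors in $\mathcal{E}$ through $R_X\to X$. Resolutions and dimension: an $\mathcal{R}$-resolution of $X$ is obtained by setting $K_0=X$ and, inductively, choosing a precover $R_i\to K_i$ with kernel $K_{i+1}\to R_i$ in $\mathcal{E}$ (the sequences $K_{i+1}\to R_i\to K_i$ are not required to be conflations). If $K_d\in\mathcal{R}$ for some $d$, then $X$ has finite $\mathcal{R}$-dimension, and if $d$ is minimal with this property $X$ has $\mathcal{R}$-dimension $d$; in that case one truncates the resolution by taking $R_d=K_d$. Homotopy approximation: given such a resolution with $R_d=K_d\in\mathcal{R}$, set $L_d=R_d$ and $\ell_d=\mathrm{id}:L_d\to K_d$. Given $\ell_i:L_i\to K_i$ in $\mathcal{T}$ with $i\ge 1$, let $\epsilon_i$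 be the composite $L_i\xrightarrow{\ell_i}K_i\to R_{i-1}$ in $\mathcal{T}$, complete it to a distinguished triangle $L_i\xrightarrow{\epsilon_i}R_{i-1}\to L_{i-1}\to L_i[1]$, and, since the composite $L_i\to R_{i-1}\to K_{i-1}$ is zero, choose $\ell_{i-1}:L_{i-1}\to K_{i-1}$ completing the maps $L_i\to 0$ and $R_{i-1}\to K_{i-1}$ to a morphism of triangles to $0\to K_{i-1}\xrightarrow{=}K_{i-1}\to 0$. Iterating yields $L_0$ together with a morphism $L_0\to K_0=X$ in $\mathcal{T}$. *)

theory Defs
  imports "HOL-Algebra.Group"
begin

section \<open>Categories\<close>

text \<open>
  Categories are presented by a set of objects and a set of arrows inside two types. An arrow
  determines its domain and codomain, so hom-sets are disjoint; composition is meaningful on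
  composable arrows only and unconstrained elsewhere. A ``class of objects'' is a set of objects.
\<close>

record ('o, 'm) cat =
  Ob :: "'o set"
  Arr :: "'m set"
  Dom :: "'m \<Rightarrow> 'o"
  Cod :: "'m \<Rightarrow> 'o"
  Ident :: "'o \<Rightarrow> 'm"
  Comp :: "'m \<Rightarrow> 'm \<Rightarrow> 'm"  (infixr "\<star>\<index>" 70)

definition Hom :: "('o, 'm, 'z) cat_scheme \<Rightarrow> 'o \<Rightarrow> 'o \<Rightarrow> 'm set" where
  "Hom C A B = {f \<in> Arr C. Dom C f = A \<and> Cod C f = B}"

locale category =
  fixes C :: "('o, 'm, 'z) cat_scheme" (structure)
  assumes dom_closed: "f \<in> Arr C \<Longrightarrow> Dom C f \<in> Ob C"
    and cod_closed: "f \<in> Arr C \<Longrightarrow> Cod C f \<in> Ob C"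
    and ident_closed: "A \<in> Ob C \<Longrightarrow> Ident C A \<in> Hom C A A"
    and comp_closed: "\<lbrakk>f \<in> Hom C A B; g \<in> Hom C B D\<rbrakk> \<Longrightarrow> g \<star> f \<in> Hom C A D"
    and comp_ident_right: "f \<in> Hom C A B \<Longrightarrow> f \<star> Ident C A = f"
    and comp_ident_left: "f \<in> Hom C A B \<Longrightarrow> Ident C B \<star> f = f"
    and comp_assoc: "\<lbrakk>f \<in> Hom C A B; g \<in> Hom C B D; h \<in> Hom C D F\<rbrakk>
                       \<Longrightarrow> (h \<star> g) \<star> f = h \<star> (g \<star> f)"

definition iso_arr :: "('o, 'm, 'z) cat_scheme \<Rightarrow> 'm \<Rightarrow> bool" where
  "iso_arr C f \<longleftrightarrow> f \<in> Arr C \<and>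
     (\<exists>g \<in> Hom C (Cod C f) (Dom C f).
        g \<star>\<^bsub>C\<^esub> f = Ident C (Dom C f) \<and> f \<star>\<^bsub>C\<^esub> g = Ident C (Cod C f))"

definition isomorphic :: "('o, 'm, 'z) cat_scheme \<Rightarrow> 'o \<Rightarrow> 'o \<Rightarrow> bool" where
  "isomorphic C A B \<longleftrightarrow> (\<exists>f \<in> Hom C A B. iso_arr C f)"

definition is_coproduct ::
  "('o, 'm, 'z) cat_scheme \<Rightarrow> 'i set \<Rightarrow> ('i \<Rightarrow> 'o) \<Rightarrow> 'o \<Rightarrow> ('i \<Rightarrow> 'm) \<Rightarrow> bool" where
  "is_coproduct C I X Y j \<longleftrightarrow>
     (\<forall>i\<in>I. X i \<in> Ob C) \<and> Y \<in> Ob C \<and> (\<forall>i\<in>I. j i \<in> Hom C (X i) Y) \<and>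
     (\<forall>Z\<in>Ob C. \<forall>f. (\<forall>i\<in>I. f i \<in> Hom C (X i) Z) \<longrightarrow>
        (\<exists>!h. h \<in> Hom C Y Z \<and> (\<forall>i\<in>I. h \<star>\<^bsub>C\<^esub> j i = f i)))"

text \<open>The pushout of \<open>f : A \<rightarrow> B\<close> along \<open>g : A \<rightarrow> A'\<close>: \<open>g' : B \<rightarrow> D\<close> and \<open>f' : A' \<rightarrow> D\<close>
  with \<open>g' f = f' g\<close>, universal.\<close>

definition is_pushout :: "('o, 'm, 'z) cat_scheme \<Rightarrow> 'm \<Rightarrow> 'm \<Rightarrow> 'm \<Rightarrow> 'm \<Rightarrow> bool" where
  "is_pushout C f g f' g' \<longleftrightarrow>
     {f, g, f', g'} \<subseteq> Arr C \<and> Dom C f = Dom C g \<and>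
     Dom C g' = Cod C f \<and> Dom C f' = Cod C g \<and> Cod C f' = Cod C g' \<and>
     g' \<star>\<^bsub>C\<^esub> f = f' \<star>\<^bsub>C\<^esub> g \<and>
     (\<forall>Z\<in>Ob C. \<forall>x \<in> Hom C (Cod C f) Z. \<forall>y \<in> Hom C (Cod C g) Z.
        x \<star>\<^bsub>C\<^esub> f = y \<star>\<^bsub>C\<^esub> g \<longrightarrow>
        (\<exists>!h. h \<in> Hom C (Cod C f') Z \<and> h \<star>\<^bsub>C\<^esub> g' = x \<and> h \<star>\<^bsub>C\<^esub> f' = y))"

text \<open>Dually, for \<open>f : B \<rightarrow> A\<close> and \<open>g : A' \<rightarrow> A\<close>: \<open>g' : D \<rightarrow> B\<close> and \<open>f' : D \<rightarrow> A'\<close>.\<close>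

definition is_pullback :: "('o, 'm, 'z) cat_scheme \<Rightarrow> 'm \<Rightarrow> 'm \<Rightarrow> 'm \<Rightarrow> 'm \<Rightarrow> bool" where
  "is_pullback C f g f' g' \<longleftrightarrow>
     {f, g, f', g'} \<subseteq> Arr C \<and> Cod C f = Cod C g \<and>
     Cod C g' = Dom C f \<and> Cod C f' = Dom C g \<and> Dom C f' = Dom C g' \<and>
     f \<star>\<^bsub>C\<^esub> g' = g \<star>\<^bsub>C\<^esub> f' \<and>
     (\<forall>Z\<in>Ob C. \<forall>x \<in> Hom C Z (Dom C f). \<forall>y \<in> Hom C Z (Dom C g).
        f \<star>\<^bsub>C\<^esub> x = g \<star>\<^bsub>C\<^esub> y \<longrightarrow>
        (\<exists>!h. h \<in> Hom C Z (Dom C f') \<and> g' \<star>\<^bsub>C\<^esub> h = x \<and> f' \<star>\<^bsub>C\<^esub> h = y))"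

definition full_subcategory :: "('o, 'm, 'z) cat_scheme \<Rightarrow> 'o set \<Rightarrow> ('o, 'm, 'z) cat_scheme" where
  "full_subcategory C S = C\<lparr>Ob := S, Arr := {f \<in> Arr C. Dom C f \<in> S \<and> Cod C f \<in> S}\<rparr>"

definition is_functor ::
  "('o, 'm, 'z) cat_scheme \<Rightarrow> ('p, 'n, 'y) cat_scheme \<Rightarrow> ('o \<Rightarrow> 'p) \<Rightarrow> ('m \<Rightarrow> 'n) \<Rightarrow> bool" where
  "is_functor C D Fo Fm \<longleftrightarrow>
     (\<forall>A\<in>Ob C. Fo A \<in> Ob D) \<and>
     (\<forall>f\<in>Arr C. Fm f \<in> Hom D (Fo (Dom C f)) (Fo (Cod C f))) \<and>
     (\<forall>A\<in>Ob C. Fm (Ident C A) = Ident D (Fo A)) \<and>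
     (\<forall>f\<in>Arr C. \<forall>g\<in>Arr C. Dom C g = Cod C f \<longrightarrow> Fm (g \<star>\<^bsub>C\<^esub> f) = Fm g \<star>\<^bsub>D\<^esub> Fm f)"

definition is_right_adjoint ::
  "('o, 'm, 'z) cat_scheme \<Rightarrow> ('p, 'n, 'y) cat_scheme \<Rightarrow>
   ('o \<Rightarrow> 'p) \<Rightarrow> ('m \<Rightarrow> 'n) \<Rightarrow> ('p \<Rightarrow> 'o) \<Rightarrow> ('n \<Rightarrow> 'm) \<Rightarrow> bool" where
  "is_right_adjoint C D Fo Fm Go Gm \<longleftrightarrow>
     is_functor C D Fo Fm \<and> is_functor D C Go Gm \<and>
     (\<exists>\<phi>. (\<forall>A\<in>Ob C. \<forall>B\<in>Ob D. bij_betw (\<phi> A B) (Hom D (Fo A) B) (Hom C A (Go B))) \<and>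
          (\<forall>A\<in>Ob C. \<forall>A'\<in>Ob C. \<forall>B\<in>Ob D. \<forall>B'\<in>Ob D.
             \<forall>a \<in> Hom C A' A. \<forall>b \<in> Hom D B B'. \<forall>f \<in> Hom D (Fo A) B.
               \<phi> A' B' (b \<star>\<^bsub>D\<^esub> f \<star>\<^bsub>D\<^esub> Fm a) = Gm b \<star>\<^bsub>C\<^esub> \<phi> A B f \<star>\<^bsub>C\<^esub> a))"


section \<open>Additive categories\<close>

record ('o, 'm) addcat = "('o, 'm) cat" +
  Add :: "'m \<Rightarrow> 'm \<Rightarrow> 'm"
  Zero :: "'o \<Rightarrow> 'o \<Rightarrow> 'm"

definition hom_group :: "('o, 'm, 'z) addcat_scheme \<Rightarrow> 'o \<Rightarrow> 'o \<Rightarrow> 'm monoid" where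
  "hom_group C A B = \<lparr>carrier = Hom C A B, mult = Add C, one = Zero C A B\<rparr>"

definition zero_object :: "('o, 'm, 'z) addcat_scheme \<Rightarrow> 'o \<Rightarrow> bool" where
  "zero_object C Z \<longleftrightarrow> Z \<in> Ob C \<and>
     (\<forall>A\<in>Ob C. (\<exists>!f. f \<in> Hom C Z A) \<and> (\<exists>!f. f \<in> Hom C A Z))"

definition is_biproduct ::
  "('o, 'm, 'z) addcat_scheme \<Rightarrow> 'o \<Rightarrow> 'o \<Rightarrow> 'o \<Rightarrow> 'm \<Rightarrow> 'm \<Rightarrow> 'm \<Rightarrow> 'm \<Rightarrow> bool" where
  "is_biproduct C A B P i1 i2 p1 p2 \<longleftrightarrow>
     P \<in> Ob C \<and> i1 \<in> Hom C A P \<and> i2 \<in> Hom C B P \<and> p1 \<in> Hom C P A \<and> p2 \<in> Hom C P B \<and>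
     p1 \<star>\<^bsub>C\<^esub> i1 = Ident C A \<and> p2 \<star>\<^bsub>C\<^esub> i2 = Ident C B \<and>
     p1 \<star>\<^bsub>C\<^esub> i2 = Zero C B A \<and> p2 \<star>\<^bsub>C\<^esub> i1 = Zero C A B \<and>
     Add C (i1 \<star>\<^bsub>C\<^esub> p1) (i2 \<star>\<^bsub>C\<^esub> p2) = Ident C P"

locale additive_category = category C
  for C :: "('o, 'm, 'z) addcat_scheme" (structure) +
  assumes hom_comm_group: "\<lbrakk>A \<in> Ob C; B \<in> Ob C\<rbrakk> \<Longrightarrow> comm_group (hom_group C A B)"
    and comp_add_left: "\<lbrakk>f \<in> Hom C A B; g \<in> Hom C B D; g' \<in> Hom C B D\<rbrakk>
          \<Longrightarrow> Add C g g' \<star> f = Add C (g \<star> f) (g' \<star> f)"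
    and comp_add_right: "\<lbrakk>f \<in> Hom C A B; f' \<in> Hom C A B; g \<in> Hom C B D\<rbrakk>
          \<Longrightarrow> g \<star> Add C f f' = Add C (g \<star> f) (g \<star> f')"
    and ex_zero_object: "\<exists>Z. zero_object C Z"
    and ex_biproduct: "\<lbrakk>A \<in> Ob C; B \<in> Ob C\<rbrakk> \<Longrightarrow> \<exists>P i1 i2 p1 p2. is_biproduct C A B P i1 i2 p1 p2"

definition is_kernel :: "('o, 'm, 'z) addcat_scheme \<Rightarrow> 'm \<Rightarrow> 'm \<Rightarrow> bool" where
  "is_kernel C k f \<longleftrightarrow>
     k \<in> Arr C \<and> f \<in> Arr C \<and> Cod C k = Dom C f \<and>
     f \<star>\<^bsub>C\<^esub> k = Zero C (Dom C k) (Cod C f) \<and>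
     (\<forall>h\<in>Arr C. Cod C h = Dom C f \<and> f \<star>\<^bsub>C\<^esub> h = Zero C (Dom C h) (Cod C f) \<longrightarrow>
        (\<exists>!u. u \<in> Hom C (Dom C h) (Dom C k) \<and> k \<star>\<^bsub>C\<^esub> u = h))"

definition is_cokernel :: "('o, 'm, 'z) addcat_scheme \<Rightarrow> 'm \<Rightarrow> 'm \<Rightarrow> bool" where
  "is_cokernel C q f \<longleftrightarrow>
     q \<in> Arr C \<and> f \<in> Arr C \<and> Dom C q = Cod C f \<and>
     q \<star>\<^bsub>C\<^esub> f = Zero C (Dom C f) (Cod C q) \<and>
     (\<forall>h\<in>Arr C. Dom C h = Cod C f \<and> h \<star>\<^bsub>C\<^esub> f = Zero C (Dom C f) (Cod C h) \<longrightarrow>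
        (\<exists>!u. u \<in> Hom C (Cod C q) (Cod C h) \<and> u \<star>\<^bsub>C\<^esub> q = h))"


section \<open>Exact and Frobenius categories\<close>

text \<open>\<open>(f, g) \<in> Confl E\<close> says that \<open>A \<rightarrow> B \<rightarrow> D\<close>, given by \<open>f\<close> and \<open>g\<close>, is a conflation.\<close>

record ('o, 'm) exactcat = "('o, 'm) addcat" +
  Confl :: "('m \<times> 'm) set"

definition inflation :: "('o, 'm, 'z) exactcat_scheme \<Rightarrow> 'm \<Rightarrow> bool" where
  "inflation E f \<longleftrightarrow> (\<exists>g. (f, g) \<in> Confl E)"

definition deflation :: "('o, 'm, 'z) exactcat_scheme \<Rightarrow> 'm \<Rightarrow> bool" where
  "deflation E g \<longleftrightarrow> (\<exists>f. (f, g) \<in> Confl E)"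

text \<open>Quillen's axioms, in the self-dual form given by Buehler.\<close>

locale exact_category = additive_category E
  for E :: "('o, 'm, 'z) exactcat_scheme" (structure) +
  assumes confl_kernel: "(f, g) \<in> Confl E \<Longrightarrow> is_kernel E f g"
    and confl_cokernel: "(f, g) \<in> Confl E \<Longrightarrow> is_cokernel E g f"
    and confl_iso: "\<lbrakk>(f, g) \<in> Confl E; iso_arr E a; iso_arr E b; iso_arr E c;
          f' \<in> Hom E (Cod E a) (Cod E b); g' \<in> Hom E (Cod E b) (Cod E c);
          Dom E a = Dom E f; Dom E b = Cod E f; Dom E c = Cod E g;
          f' \<star> a = b \<star> f; g' \<star> b = c \<star> g\<rbrakk> \<Longrightarrow> (f', g') \<in> Confl E"
    and inflation_ident: "A \<in> Ob E \<Longrightarrow> inflation E (Ident E A)"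
    and deflation_ident: "A \<in> Ob E \<Longrightarrow> deflation E (Ident E A)"
    and inflation_comp: "\<lbrakk>inflation E f; inflation E g; Dom E g = Cod E f\<rbrakk> \<Longrightarrow> inflation E (g \<star> f)"
    and deflation_comp: "\<lbrakk>deflation E f; deflation E g; Dom E g = Cod E f\<rbrakk> \<Longrightarrow> deflation E (g \<star> f)"
    and inflation_pushout: "\<lbrakk>inflation E f; g \<in> Arr E; Dom E g = Dom E f\<rbrakk>
          \<Longrightarrow> \<exists>f' g'. is_pushout E f g f' g' \<and> inflation E f'"
    and deflation_pullback: "\<lbrakk>deflation E f; g \<in> Arr E; Cod E g = Cod E f\<rbrakk>
          \<Longrightarrow> \<exists>f' g'. is_pullback E f g f' g' \<and> deflation E f'"

definition projective :: "('o, 'm, 'z) exactcat_scheme \<Rightarrow> 'o \<Rightarrow> bool" where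
  "projective E P \<longleftrightarrow> P \<in> Ob E \<and>
     (\<forall>g f. deflation E g \<and> f \<in> Hom E P (Cod E g) \<longrightarrow>
        (\<exists>h \<in> Hom E P (Dom E g). g \<star>\<^bsub>E\<^esub> h = f))"

definition injective :: "('o, 'm, 'z) exactcat_scheme \<Rightarrow> 'o \<Rightarrow> bool" where
  "injective E J \<longleftrightarrow> J \<in> Ob E \<and>
     (\<forall>g f. inflation E g \<and> f \<in> Hom E (Dom E g) J \<longrightarrow>
        (\<exists>h \<in> Hom E (Cod E g) J. h \<star>\<^bsub>E\<^esub> g = f))"

locale frobenius_category = exact_category E
  for E :: "('o, 'm, 'z) exactcat_scheme" (structure) +
  assumes enough_projectives: "A \<in> Ob E \<Longrightarrow> \<exists>g. deflation E g \<and> projective E (Dom E g) \<and> Cod E g = A"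
    and enough_injectives: "A \<in> Ob E \<Longrightarrow> \<exists>f. inflation E f \<and> Dom E f = A \<and> injective E (Cod E f)"
    and projective_iff_injective: "projective E A \<longleftrightarrow> injective E A"

text \<open>A choice, for each object \<open>A\<close>, of a conflation \<open>A \<rightarrow> I(A) \<rightarrow> A[1]\<close> with \<open>I(A)\<close> injective:
  \<open>I(A)\<close> is the codomain of \<open>\<iota> A\<close> and \<open>A[1]\<close> is the codomain of \<open>\<pi> A\<close>. No minimality is required.\<close>

definition injective_hulls ::
  "('o, 'm, 'z) exactcat_scheme \<Rightarrow> ('o \<Rightarrow> 'm) \<Rightarrow> ('o \<Rightarrow> 'm) \<Rightarrow> bool" where
  "injective_hulls E \<iota> \<pi> \<longleftrightarrow>
     (\<forall>A\<in>Ob E. (\<iota> A, \<pi> A) \<in> Confl E \<and> Dom E (\<iota> A) = A \<and> injective E (Cod E (\<iota> A)))"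


section \<open>The stable category\<close>

text \<open>Two parallel arrows are identified when their difference factors through an object of
  \<open>\<P>\<close>, the class of projective (equivalently, injective) objects.\<close>

definition stably_equal :: "('o, 'm, 'z) exactcat_scheme \<Rightarrow> 'm \<Rightarrow> 'm \<Rightarrow> bool" where
  "stably_equal E f g \<longleftrightarrow>
     f \<in> Arr E \<and> g \<in> Arr E \<and> Dom E f = Dom E g \<and> Cod E f = Cod E g \<and>
     (\<exists>P a b. projective E P \<and> a \<in> Hom E (Dom E f) P \<and> b \<in> Hom E P (Cod E f) \<and>
        f = Add E g (b \<star>\<^bsub>E\<^esub> a))"

definition stable_class :: "('o, 'm, 'z) exactcat_scheme \<Rightarrow> 'm \<Rightarrow> 'm set" where
  "stable_class E f = {g. stably_equal E f g}"

definition quotient_category :: "('o, 'm, 'z) exactcat_scheme \<Rightarrow> ('o, 'm set) addcat" where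
  "quotient_category E =
     \<lparr>Ob = Ob E,
      Arr = stable_class E ` Arr E,
      Dom = (\<lambda>F. THE A. \<exists>f\<in>F. Dom E f = A),
      Cod = (\<lambda>F. THE A. \<exists>f\<in>F. Cod E f = A),
      Ident = (\<lambda>A. stable_class E (Ident E A)),
      Comp = (\<lambda>G F. \<Union>g\<in>G. \<Union>f\<in>F. stable_class E (g \<star>\<^bsub>E\<^esub> f)),
      Add = (\<lambda>F G. \<Union>f\<in>F. \<Union>g\<in>G. stable_class E (Add E f g)),
      Zero = (\<lambda>A B. stable_class E (Zero E A B))\<rparr>"

text \<open>An additive category with a shift on objects and arrows and a set of triangles; a triangle
  \<open>A \<rightarrow> B \<rightarrow> D \<rightarrow> A[1]\<close> is given by its three arrows.\<close>

record ('o, 'm) tricat = "('o, 'm) addcat" +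
  Shift :: "'o \<Rightarrow> 'o"
  ShiftArr :: "'m \<Rightarrow> 'm"
  Tri :: "('m \<times> 'm \<times> 'm) set"

definition stable_shift :: "('o, 'm, 'z) exactcat_scheme \<Rightarrow> ('o \<Rightarrow> 'm) \<Rightarrow> 'o \<Rightarrow> 'o" where
  "stable_shift E \<pi> A = Cod E (\<pi> A)"

text \<open>\<open>F[1]\<close> is the stable class of any \<open>h\<close> that fits into a morphism \<open>(f, g, h)\<close> from the conflation
  \<open>A \<rightarrow> I(A) \<rightarrow> A[1]\<close> to \<open>B \<rightarrow> I(B) \<rightarrow> B[1]\<close> with \<open>f\<close> in \<open>F\<close>.\<close>

definition stable_shift_arr ::
  "('o, 'm, 'z) exactcat_scheme \<Rightarrow> ('o \<Rightarrow> 'm) \<Rightarrow> ('o \<Rightarrow> 'm) \<Rightarrow> 'm set \<Rightarrow> 'm set" where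
  "stable_shift_arr E \<iota> \<pi> F =
     \<Union>{stable_class E h | f g h. f \<in> F \<and>
          g \<in> Hom E (Cod E (\<iota> (Dom E f))) (Cod E (\<iota> (Cod E f))) \<and>
          h \<in> Hom E (stable_shift E \<pi> (Dom E f)) (stable_shift E \<pi> (Cod E f)) \<and>
          g \<star>\<^bsub>E\<^esub> \<iota> (Dom E f) = \<iota> (Cod E f) \<star>\<^bsub>E\<^esub> f \<and>
          h \<star>\<^bsub>E\<^esub> \<pi> (Dom E f) = \<pi> (Cod E f) \<star>\<^bsub>E\<^esub> g}"

text \<open>Happel's standard triangle on \<open>f : A \<rightarrow> B\<close>: \<open>D\<close> is the pushout of \<open>\<iota> A : A \<rightarrow> I(A)\<close> along \<open>f\<close>,
  with legs \<open>v : B \<rightarrow> D\<close> and \<open>t : I(A) \<rightarrow> D\<close>, and \<open>w : D \<rightarrow> A[1]\<close> is induced by \<open>0\<close> on \<open>B\<close> and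
  \<open>\<pi> A\<close> on \<open>I(A)\<close>.\<close>

definition standard_triangle ::
  "('o, 'm, 'z) exactcat_scheme \<Rightarrow> ('o \<Rightarrow> 'm) \<Rightarrow> ('o \<Rightarrow> 'm) \<Rightarrow> 'm \<Rightarrow> 'm \<Rightarrow> 'm \<Rightarrow> bool" where
  "standard_triangle E \<iota> \<pi> f v w \<longleftrightarrow>
     (\<exists>t. is_pushout E (\<iota> (Dom E f)) f v t \<and>
          w \<in> Hom E (Cod E v) (stable_shift E \<pi> (Dom E f)) \<and>
          w \<star>\<^bsub>E\<^esub> v = Zero E (Cod E f) (stable_shift E \<pi> (Dom E f)) \<and>
          w \<star>\<^bsub>E\<^esub> t = \<pi> (Dom E f))"

text \<open>The distinguished triangles are those isomorphic, in the quotient category, to the image of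
  a standard triangle.\<close>

definition distinguished_triangle ::
  "('o, 'm, 'z) exactcat_scheme \<Rightarrow> ('o \<Rightarrow> 'm) \<Rightarrow> ('o \<Rightarrow> 'm) \<Rightarrow>
   'm set \<Rightarrow> 'm set \<Rightarrow> 'm set \<Rightarrow> bool" where
  "distinguished_triangle E \<iota> \<pi> U V W \<longleftrightarrow>
     (let Q = quotient_category E in
      \<exists>A B D. U \<in> Hom Q A B \<and> V \<in> Hom Q B D \<and> W \<in> Hom Q D (stable_shift E \<pi> A) \<and>
        (\<exists>f v w. standard_triangle E \<iota> \<pi> f v w \<and>
          (\<exists>a \<in> Hom Q (Dom E f) A. \<exists>b \<in> Hom Q (Cod E f) B. \<exists>c \<in> Hom Q (Cod E v) D.
             iso_arr Q a \<and> iso_arr Q b \<and> iso_arr Q c \<and>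
             b \<star>\<^bsub>Q\<^esub> stable_class E f = U \<star>\<^bsub>Q\<^esub> a \<and>
             c \<star>\<^bsub>Q\<^esub> stable_class E v = V \<star>\<^bsub>Q\<^esub> b \<and>
             stable_shift_arr E \<iota> \<pi> a \<star>\<^bsub>Q\<^esub> stable_class E w = W \<star>\<^bsub>Q\<^esub> c)))"

definition stable_category ::
  "('o, 'm, 'z) exactcat_scheme \<Rightarrow> ('o \<Rightarrow> 'm) \<Rightarrow> ('o \<Rightarrow> 'm) \<Rightarrow> ('o, 'm set) tricat" where
  "stable_category E \<iota> \<pi> =
     addcat.extend (quotient_category E)
       (tricat.fields (stable_shift E \<pi>) (stable_shift_arr E \<iota> \<pi>)
          {(U, V, W). distinguished_triangle E \<iota> \<pi> U V W})"


section \<open>Localizing subcategories\<close>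

text \<open>Full subcategories are given by their sets of objects. Triangulated subcategories are taken
  to be closed under isomorphism, as usual.\<close>

definition triangulated_subcategory :: "('o, 'm, 'z) tricat_scheme \<Rightarrow> 'o set \<Rightarrow> bool" where
  "triangulated_subcategory T S \<longleftrightarrow>
     S \<subseteq> Ob T \<and>
     (\<forall>Z. zero_object T Z \<longrightarrow> Z \<in> S) \<and>
     (\<forall>A\<in>S. \<forall>B\<in>Ob T. isomorphic T A B \<longrightarrow> B \<in> S) \<and>
     (\<forall>A\<in>Ob T. A \<in> S \<longleftrightarrow> Shift T A \<in> S) \<and>
     (\<forall>(u, v, w) \<in> Tri T. Dom T u \<in> S \<and> Cod T u \<in> S \<longrightarrow> Cod T v \<in> S)"

text \<open>
  The index sets of the coproducts range over all sets of arrows. This covers every coproduct: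
  if a coproduct has nonzero summands indexed by \<open>I\<close>, then the idempotents projecting it onto the
  single summands are distinct, so \<open>I\<close> embeds into the set of arrows; and zero summands do not
  affect the coproduct. No existence of coproducts is presupposed: those that exist in \<open>T\<close> must
  stay in \<open>S\<close>.
\<close>

definition localizing_subcategory :: "('o, 'm, 'z) tricat_scheme \<Rightarrow> 'o set \<Rightarrow> bool" where
  "localizing_subcategory T S \<longleftrightarrow>
     triangulated_subcategory T S \<and>
     (\<forall>(I :: 'm set) X Y j. is_coproduct T I X Y j \<and> (\<forall>i\<in>I. X i \<in> S) \<longrightarrow> Y \<in> S)"

definition localizing_closure :: "('o, 'm, 'z) tricat_scheme \<Rightarrow> 'o set \<Rightarrow> 'o set" where
  "localizing_closure T R = \<Inter>{S. localizing_subcategory T S \<and> R \<subseteq> S}"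

text \<open>Objects of a triangulated category matter up to isomorphism only, and \<open>A[-1]\<close> is determined
  only up to isomorphism, as an object \<open>B\<close> with \<open>B[1]\<close> isomorphic to \<open>A\<close>. So closure of \<open>R\<close> under
  the shifts \<open>[1]\<close> and \<open>[-1]\<close> is expressed up to isomorphism in \<open>T\<close>.\<close>

definition closed_under_shifts :: "('o, 'm, 'z) tricat_scheme \<Rightarrow> 'o set \<Rightarrow> bool" where
  "closed_under_shifts T R \<longleftrightarrow>
     (\<forall>A\<in>R. (\<exists>B\<in>R. isomorphic T B (Shift T A)) \<and> (\<exists>B\<in>R. isomorphic T (Shift T B) A))"


section \<open>Precovers, resolutions and homotopy approximations\<close>

definition precover :: "('o, 'm, 'z) cat_scheme \<Rightarrow> 'o set \<Rightarrow> 'o \<Rightarrow> 'm \<Rightarrow> bool" where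
  "precover E R X p \<longleftrightarrow>
     p \<in> Arr E \<and> Dom E p \<in> R \<and> Cod E p = X \<and>
     (\<forall>q\<in>Arr E. Dom E q \<in> R \<and> Cod E q = X \<longrightarrow>
        (\<exists>h \<in> Hom E (Dom E q) (Dom E p). q = p \<star>\<^bsub>E\<^esub> h))"

definition precovering :: "('o, 'm, 'z) cat_scheme \<Rightarrow> 'o set \<Rightarrow> bool" where
  "precovering E R \<longleftrightarrow> R \<subseteq> Ob E \<and> (\<forall>X\<in>Ob E. \<exists>p. precover E R X p)"

text \<open>A resolution of \<open>X\<close> truncated at \<open>d\<close>: precovers \<open>p i : R\<^sub>i \<rightarrow> K i\<close> with kernels
  \<open>k i : K (i + 1) \<rightarrow> R\<^sub>i\<close> for \<open>i < d\<close>, and last term \<open>R\<^sub>d = K d\<close>. The values of \<open>K\<close> beyond \<open>d\<close>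
  and of \<open>p\<close>, \<open>k\<close> from \<open>d\<close> on are irrelevant. The length \<open>d\<close> need not be minimal.\<close>

definition finite_resolution ::
  "('o, 'm, 'z) addcat_scheme \<Rightarrow> 'o set \<Rightarrow> 'o \<Rightarrow> nat \<Rightarrow>
   (nat \<Rightarrow> 'o) \<Rightarrow> (nat \<Rightarrow> 'm) \<Rightarrow> (nat \<Rightarrow> 'm) \<Rightarrow> bool" where
  "finite_resolution E R X d K p k \<longleftrightarrow>
     K 0 = X \<and> K d \<in> R \<and>
     (\<forall>i<d. precover E R (K i) (p i) \<and> is_kernel E (k i) (p i) \<and> Dom E (k i) = K (Suc i))"

definition finite_dimension :: "('o, 'm, 'z) addcat_scheme \<Rightarrow> 'o set \<Rightarrow> 'o \<Rightarrow> bool" where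
  "finite_dimension E R X \<longleftrightarrow> (\<exists>d K p k. finite_resolution E R X d K p k)"

text \<open>
  \<open>L0\<close> together with \<open>l0 : L0 \<rightarrow> X\<close> arises from \<open>X\<close> by some run of the construction, that is, for
  some resolution and some choices of triangles and of maps. A map \<open>l i : L i \<rightarrow> K i\<close> completes a
  morphism from the triangle on \<open>\<epsilon>\<close> to \<open>0 \<rightarrow> K i = K i \<rightarrow> 0[1]\<close> precisely if the middle square
  \<open>l i \<star> v = p i\<close> commutes, the other two squares having a zero object at one corner.
\<close>

definition homotopy_approximation ::
  "('o, 'm, 'z) exactcat_scheme \<Rightarrow> ('o \<Rightarrow> 'm) \<Rightarrow> ('o \<Rightarrow> 'm) \<Rightarrow> 'o set \<Rightarrow> 'o \<Rightarrow> 'o \<Rightarrow> 'm set \<Rightarrow> bool"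
  where
  "homotopy_approximation E \<iota> \<pi> R X L0 l0 \<longleftrightarrow>
     (let T = stable_category E \<iota> \<pi> in
      \<exists>d K p k L l. finite_resolution E R X d K p k \<and>
        L d = K d \<and> l d = Ident T (K d) \<and>
        (\<forall>i<d. let \<epsilon> = stable_class E (k i) \<star>\<^bsub>T\<^esub> l (Suc i) in
           \<exists>v w. (\<epsilon>, v, w) \<in> Tri T \<and> Cod T v = L i \<and>
             l i \<in> Hom T (L i) (K i) \<and> l i \<star>\<^bsub>T\<^esub> v = stable_class E (p i)) \<and>
        L0 = L 0 \<and> l0 = l 0)"

end

theory Submission
  imports Defs
begin

text \<open>
  A right adjoint \<open>i\<^sup>!\<close> of the inclusion of \<open>S\<close> is determined at \<open>X\<close>, up to isomorphism, by any
  \<open>l\<^sub>0 : L\<^sub>0 \<rightarrow> X\<close> with \<open>L\<^sub>0\<close> in \<open>S\<close> such that \<open>Hom(Z, l\<^sub>0)\<close> is bijective for every \<open>Z\<close> in \<open>S\<close>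
  (\<open>right_adjoint_isomorphic\<close>). The homotopy approximation is such a map. Its source is in \<open>S\<close>
  because it is an iterated cone of objects of \<open>R\<close>, so what matters is bijectivity, which is
  obtained in two steps.
  
  First, \<open>Hom(A, l\<^sub>0)\<close> is bijective for \<open>A\<close> in \<open>R\<close>. The sequence \<open>K\<^sub>i\<^sub>+\<^sub>1 \<rightarrow> R\<^sub>i \<rightarrow> K\<^sub>i\<close> of a
  resolution is not a conflation and need not give a triangle, but seen from \<open>R\<close> it behaves like
  one: for \<open>A\<close> in \<open>R\<close> the sequence
  \<open>0 \<rightarrow> Hom(A, K\<^sub>i\<^sub>+\<^sub>1) \<rightarrow> Hom(A, R\<^sub>i) \<rightarrow> Hom(A, K\<^sub>i) \<rightarrow> 0\<close> of stable homs is exact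
  (\<open>precover_hom_surjective\<close>, \<open>precover_kernel_exact\<close>, \<open>precover_kernel_hom_injective\<close>). In \<open>E\<close>
  itself this is the definition of a precover with a kernel. It passes to the stable category
  because an arrow out of \<open>A\<close> is stably zero iff it factors through the hull \<open>I(A)\<close>, which is again in
  \<open>R\<close>, and because arrows \<open>A[1] \<rightarrow> K\<^sub>i\<close> lift to \<open>R\<^sub>i\<close> as well (\<open>precover_lift_from_shift\<close>). Comparing
  the short exact sequences with the triangles \<open>L\<^sub>i\<^sub>+\<^sub>1 \<rightarrow> R\<^sub>i \<rightarrow> L\<^sub>i \<rightarrow> L\<^sub>i\<^sub>+\<^sub>1[1]\<close> as in the five lemma
  carries bijectivity from \<open>l\<^sub>i\<^sub>+\<^sub>1\<close> to \<open>l\<^sub>i\<close> (\<open>approximation_step\<close>), starting with the identity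
  \<open>l\<^sub>d\<close>.
  
  Second, bijectivity spreads from \<open>R\<close> to \<open>S\<close>. The cone of \<open>l\<^sub>0\<close> receives no nonzero map from \<open>R\<close>.
  The objects without nonzero maps to the right orthogonal of \<open>R\<close> form a localizing subcategory
  (\<open>left_perp_right_perp_localizing\<close>), so it contains \<open>S\<close> and the cone receives no nonzero map from
  \<open>S\<close> either.
  
  Of the triangulated structure only the long exact hom sequences and the fact that the shift is an
  equivalence enter; the locale \<open>exact_triangles\<close> records them. For the stable category they are
  established by diagram chases around Happel's standard triangle, where the pushout \<open>D\<close> of
  \<open>A \<rightarrow> I(A)\<close> along \<open>f : A \<rightarrow> B\<close> sits in a conflation \<open>B \<rightarrow> D \<rightarrow> A[1]\<close>.
\<close>

section \<open>Calculating with arrows\<close>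

text \<open>
  Typing facts are stated through \<open>Arr\<close>, \<open>Dom\<close> and \<open>Cod\<close> rather than through \<open>Hom\<close>: the middle
  object of a composite would be an extra variable in the premises of a rewrite rule, whereas in this
  form the simplifier can discharge the side conditions.
\<close>

context category
begin

lemma comp_arr [simp]:
  assumes "f \<in> Arr C" "g \<in> Arr C" "Dom C g = Cod C f"
  shows "g \<star> f \<in> Arr C" "Dom C (g \<star> f) = Dom C f" "Cod C (g \<star> f) = Cod C g"
  using comp_closed[of f "Dom C f" "Cod C f" g "Cod C g"] assms by (auto simp: Hom_def)

lemma ident_arr [simp]:
  assumes "A \<in> Ob C"
  shows "Ident C A \<in> Arr C" "Dom C (Ident C A) = A" "Cod C (Ident C A) = A"
  using ident_closed[OF assms] by (auto simp: Hom_def)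

lemma ident_comp [simp]:
  assumes "f \<in> Arr C"
  shows "Cod C f = A \<Longrightarrow> Ident C A \<star> f = f" "Dom C f = A \<Longrightarrow> f \<star> Ident C A = f"
  using comp_ident_left[of f "Dom C f" "Cod C f"] comp_ident_right[of f "Dom C f" "Cod C f"] assms
  by (auto simp: Hom_def)

lemma assoc [simp]:
  assumes "f \<in> Arr C" "g \<in> Arr C" "h \<in> Arr C" "Dom C g = Cod C f" "Dom C h = Cod C g"
  shows "(h \<star> g) \<star> f = h \<star> (g \<star> f)"
  using comp_assoc[of f "Dom C f" "Cod C f" g "Cod C g" h "Cod C h"] assms by (auto simp: Hom_def)

lemma isomorphicE:
  assumes "isomorphic C A B"
  obtains f g where "f \<in> Hom C A B" "g \<in> Hom C B A" "g \<star> f = Ident C A" "f \<star> g = Ident C B"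
  using assms by (auto simp: isomorphic_def iso_arr_def Hom_def)

lemma isomorphicI:
  assumes "f \<in> Hom C A B" "g \<in> Hom C B A" "g \<star> f = Ident C A" "f \<star> g = Ident C B"
  shows "isomorphic C A B"
  using assms by (auto simp: isomorphic_def iso_arr_def Hom_def intro!: bexI[of _ f] bexI[of _ g])

lemma iso_arrI:
  assumes "f \<in> Arr C" "g \<in> Arr C" "Dom C g = Cod C f" "Cod C g = Dom C f"
    "g \<star> f = Ident C (Dom C f)" "f \<star> g = Ident C (Cod C f)"
  shows "iso_arr C f"
proof -
  have "g \<in> Hom C (Cod C f) (Dom C f)" using assms by (simp add: Hom_def)
  then show ?thesis using assms unfolding iso_arr_def by blast
qed

lemma iso_arr_ident: "A \<in> Ob C \<Longrightarrow> iso_arr C (Ident C A)"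
  by (rule iso_arrI[of _ "Ident C A"]) auto

lemma isomorphic_sym: "isomorphic C A B \<Longrightarrow> isomorphic C B A"
  by (metis isomorphicE isomorphicI)

end

context additive_category
begin

definition neg :: "'m \<Rightarrow> 'm" where
  "neg f = inv\<^bsub>hom_group C (Dom C f) (Cod C f)\<^esub> f"

definition sub :: "'m \<Rightarrow> 'm \<Rightarrow> 'm" where
  "sub f g = Add C f (neg g)"

lemma hom_group_simps [simp]:
  "carrier (hom_group C A B) = Hom C A B" "mult (hom_group C A B) = Add C"
  "one (hom_group C A B) = Zero C A B"
  by (auto simp: hom_group_def)

lemma arr_ob [simp]: "f \<in> Arr C \<Longrightarrow> Dom C f \<in> Ob C" "f \<in> Arr C \<Longrightarrow> Cod C f \<in> Ob C"
  by (auto intro: dom_closed cod_closed)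

lemma zero_arr [simp]:
  assumes "A \<in> Ob C" "B \<in> Ob C"
  shows "Zero C A B \<in> Arr C" "Dom C (Zero C A B) = A" "Cod C (Zero C A B) = B"
proof -
  interpret comm_group "hom_group C A B" using assms by (rule hom_comm_group)
  show "Zero C A B \<in> Arr C" "Dom C (Zero C A B) = A" "Cod C (Zero C A B) = B"
    using one_closed by (auto simp: Hom_def)
qed

lemma add_arr [simp]:
  assumes "f \<in> Arr C" "g \<in> Arr C" "Dom C g = Dom C f" "Cod C g = Cod C f"
  shows "Add C f g \<in> Arr C" "Dom C (Add C f g) = Dom C f" "Cod C (Add C f g) = Cod C f"
proof -
  interpret comm_group "hom_group C (Dom C f) (Cod C f)" using assms by (simp add: hom_comm_group)
  show "Add C f g \<in> Arr C" "Dom C (Add C f g) = Dom C f" "Cod C (Add C f g) = Cod C f"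
    using m_closed[of f g] assms by (auto simp: Hom_def)
qed

lemma neg_arr [simp]:
  assumes "f \<in> Arr C"
  shows "neg f \<in> Arr C" "Dom C (neg f) = Dom C f" "Cod C (neg f) = Cod C f"
proof -
  interpret comm_group "hom_group C (Dom C f) (Cod C f)" using assms by (simp add: hom_comm_group)
  show "neg f \<in> Arr C" "Dom C (neg f) = Dom C f" "Cod C (neg f) = Cod C f"
    using inv_closed[of f] assms by (auto simp: Hom_def neg_def)
qed

lemma sub_arr [simp]:
  assumes "f \<in> Arr C" "g \<in> Arr C" "Dom C g = Dom C f" "Cod C g = Cod C f"
  shows "sub f g \<in> Arr C" "Dom C (sub f g) = Dom C f" "Cod C (sub f g) = Cod C f"
  using assms by (auto simp: sub_def)

lemma add_commute:
  assumes "f \<in> Arr C" "g \<in> Arr C" "Dom C g = Dom C f" "Cod C g = Cod C f"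
  shows "Add C f g = Add C g f"
proof -
  interpret comm_group "hom_group C (Dom C f) (Cod C f)" using assms by (simp add: hom_comm_group)
  show ?thesis using m_comm[of f g] assms by (auto simp: Hom_def)
qed

lemma add_assoc:
  assumes "f \<in> Arr C" "g \<in> Arr C" "Dom C g = Dom C f" "Cod C g = Cod C f"
    "h \<in> Arr C" "Dom C h = Dom C f" "Cod C h = Cod C f"
  shows "Add C (Add C f g) h = Add C f (Add C g h)"
proof -
  interpret comm_group "hom_group C (Dom C f) (Cod C f)" using assms by (simp add: hom_comm_group)
  show ?thesis using m_assoc[of f g h] assms by (auto simp: Hom_def)
qed

lemma add_zero [simp]:
  assumes "f \<in> Arr C" "Dom C f = A" "Cod C f = B"
  shows "Add C f (Zero C A B) = f" "Add C (Zero C A B) f = f"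
proof -
  interpret comm_group "hom_group C (Dom C f) (Cod C f)" using assms by (auto intro!: hom_comm_group)
  show "Add C f (Zero C A B) = f" "Add C (Zero C A B) f = f"
    using r_one[of f] l_one[of f] assms by (auto simp: Hom_def)
qed

lemma add_neg [simp]:
  assumes "f \<in> Arr C"
  shows "Add C f (neg f) = Zero C (Dom C f) (Cod C f)"
    "Add C (neg f) f = Zero C (Dom C f) (Cod C f)"
proof -
  interpret comm_group "hom_group C (Dom C f) (Cod C f)" using assms by (simp add: hom_comm_group)
  show "Add C f (neg f) = Zero C (Dom C f) (Cod C f)"
    "Add C (neg f) f = Zero C (Dom C f) (Cod C f)"
    using r_inv[of f] l_inv[of f] assms by (auto simp: Hom_def neg_def)
qed

lemma sub_add_cancel [simp]:
  assumes "f \<in> Arr C" "g \<in> Arr C" "Dom C g = Dom C f" "Cod C g = Cod C f"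
  shows "Add C (sub f g) g = f" "sub (Add C f g) g = f"
  using assms by (auto simp: sub_def add_assoc)

lemma sub_self [simp]: "f \<in> Arr C \<Longrightarrow> sub f f = Zero C (Dom C f) (Cod C f)"
  by (simp add: sub_def)

lemma sub_eq_iff:
  assumes "f \<in> Arr C" "g \<in> Arr C" "Dom C g = Dom C f" "Cod C g = Cod C f"
    "h \<in> Arr C" "Dom C h = Dom C f" "Cod C h = Cod C f"
  shows "sub f g = h \<longleftrightarrow> f = Add C h g"
  using assms by (metis sub_add_cancel)

lemma add_right_cancel:
  assumes "f \<in> Arr C" "g \<in> Arr C" "Dom C g = Dom C f" "Cod C g = Cod C f"
    "h \<in> Arr C" "Dom C h = Dom C f" "Cod C h = Cod C f"
  shows "Add C f h = Add C g h \<longleftrightarrow> f = g"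
  using assms by (metis sub_add_cancel(2))

lemma comp_add [simp]:
  assumes "f \<in> Arr C" "f' \<in> Arr C" "Dom C f' = Dom C f" "Cod C f' = Cod C f" "g \<in> Arr C"
  shows "Dom C g = Cod C f \<Longrightarrow> g \<star> Add C f f' = Add C (g \<star> f) (g \<star> f')"
    "Dom C f = Cod C g \<Longrightarrow> Add C f f' \<star> g = Add C (f \<star> g) (f' \<star> g)"
  using assms comp_add_right[of f "Dom C f" "Cod C f" f' g "Cod C g"]
    comp_add_left[of g "Dom C g" "Cod C g" f "Cod C f" f']
  by (auto simp: Hom_def)

lemma add_idem_zero:
  assumes "f \<in> Arr C" "Add C f f = f"
  shows "f = Zero C (Dom C f) (Cod C f)"
  using add_right_cancel[of f "Zero C (Dom C f) (Cod C f)" f] assms by simp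

lemma comp_zero [simp]:
  assumes "f \<in> Arr C" "A \<in> Ob C" "B \<in> Ob C"
  shows "Dom C f = B \<Longrightarrow> f \<star> Zero C A B = Zero C A (Cod C f)"
    "Cod C f = A \<Longrightarrow> Zero C A B \<star> f = Zero C (Dom C f) B"
proof -
  assume *: "Dom C f = B"
  have "Add C (f \<star> Zero C A B) (f \<star> Zero C A B) = f \<star> Add C (Zero C A B) (Zero C A B)"
    using assms * by (subst comp_add) auto
  also have "\<dots> = f \<star> Zero C A B" using assms by simp
  finally show "f \<star> Zero C A B = Zero C A (Cod C f)"
    using assms * add_idem_zero[of "f \<star> Zero C A B"] by simp
next
  assume *: "Cod C f = A"
  have "Add C (Zero C A B \<star> f) (Zero C A B \<star> f) = Add C (Zero C A B) (Zero C A B) \<star> f"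
    using assms * by (subst comp_add) auto
  also have "\<dots> = Zero C A B \<star> f" using assms by simp
  finally show "Zero C A B \<star> f = Zero C (Dom C f) B"
    using assms * add_idem_zero[of "Zero C A B \<star> f"] by simp
qed

lemma sub_eq_zero_iff:
  assumes "f \<in> Arr C" "g \<in> Arr C" "Dom C g = Dom C f" "Cod C g = Cod C f"
  shows "sub f g = Zero C (Dom C f) (Cod C f) \<longleftrightarrow> f = g"
  using assms by (simp add: sub_eq_iff)

lemma comp_sub [simp]:
  assumes "f \<in> Arr C" "f' \<in> Arr C" "Dom C f' = Dom C f" "Cod C f' = Cod C f" "g \<in> Arr C"
  shows "Dom C g = Cod C f \<Longrightarrow> g \<star> sub f f' = sub (g \<star> f) (g \<star> f')"
    "Dom C f = Cod C g \<Longrightarrow> sub f f' \<star> g = sub (f \<star> g) (f' \<star> g)"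
proof -
  assume *: "Dom C g = Cod C f"
  then have eq: "g \<star> f = Add C (g \<star> sub f f') (g \<star> f')"
    using assms by (subst comp_add(1)[symmetric]) auto
  show "g \<star> sub f f' = sub (g \<star> f) (g \<star> f')"
    by (intro sub_eq_iff[THEN iffD2, symmetric] eq) (use assms * in simp_all)
next
  assume *: "Dom C f = Cod C g"
  then have eq: "f \<star> g = Add C (sub f f' \<star> g) (f' \<star> g)"
    using assms by (subst comp_add(2)[symmetric]) auto
  show "sub f f' \<star> g = sub (f \<star> g) (f' \<star> g)"
    by (intro sub_eq_iff[THEN iffD2, symmetric] eq) (use assms * in simp_all)
qed

lemma kernelD:
  assumes "is_kernel C k f"
  shows "k \<in> Arr C" "f \<in> Arr C" "Cod C k = Dom C f" "f \<star> k = Zero C (Dom C k) (Cod C f)"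
  using assms by (auto simp: is_kernel_def)

lemma cokernelD:
  assumes "is_cokernel C q f"
  shows "q \<in> Arr C" "f \<in> Arr C" "Dom C q = Cod C f" "q \<star> f = Zero C (Dom C f) (Cod C q)"
  using assms by (auto simp: is_cokernel_def)

lemma kernel_ex1:
  assumes "is_kernel C k f" "h \<in> Arr C" "Cod C h = Dom C f" "f \<star> h = Zero C (Dom C h) (Cod C f)"
  shows "\<exists>!u. u \<in> Hom C (Dom C h) (Dom C k) \<and> k \<star> u = h"
  using assms unfolding is_kernel_def by blast

lemma cokernel_ex1:
  assumes "is_cokernel C q f" "h \<in> Arr C" "Dom C h = Cod C f" "h \<star> f = Zero C (Dom C f) (Cod C h)"
  shows "\<exists>!u. u \<in> Hom C (Cod C q) (Cod C h) \<and> u \<star> q = h"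
  using assms unfolding is_cokernel_def by blast

lemma kernel_lift:
  assumes "is_kernel C k f" "h \<in> Arr C" "Cod C h = Dom C f" "f \<star> h = Zero C (Dom C h) (Cod C f)"
  obtains u where "u \<in> Arr C" "Dom C u = Dom C h" "Cod C u = Dom C k" "h = k \<star> u"
  using kernel_ex1[OF assms] by (auto simp: Hom_def)

lemma cokernel_lift:
  assumes "is_cokernel C q f" "h \<in> Arr C" "Dom C h = Cod C f" "h \<star> f = Zero C (Dom C f) (Cod C h)"
  obtains u where "u \<in> Arr C" "Dom C u = Cod C q" "Cod C u = Cod C h" "h = u \<star> q"
  using cokernel_ex1[OF assms] by (auto simp: Hom_def)

lemma kernel_mono:
  assumes "is_kernel C k f" "u \<in> Arr C" "u' \<in> Arr C" "Cod C u = Dom C k" "Cod C u' = Dom C k"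
    "Dom C u' = Dom C u" "k \<star> u = k \<star> u'"
  shows "u = u'"
proof -
  note k = kernelD[OF assms(1)]
  have "f \<star> (k \<star> u) = (f \<star> k) \<star> u" using k assms(2,4) by (subst assoc) auto
  then have "f \<star> (k \<star> u) = Zero C (Dom C (k \<star> u)) (Cod C f)"
    using k assms(2,4) by simp
  then have "\<exists>!v. v \<in> Hom C (Dom C (k \<star> u)) (Dom C k) \<and> k \<star> v = k \<star> u"
    using k assms(2,4) by (intro kernel_ex1[OF assms(1)]) auto
  moreover have "u \<in> Hom C (Dom C (k \<star> u)) (Dom C k)" "u' \<in> Hom C (Dom C (k \<star> u)) (Dom C k)"
    using assms k by (auto simp: Hom_def)
  ultimately show ?thesis using assms(7) by metis
qed

lemma cokernel_epi:
  assumes "is_cokernel C q f" "u \<in> Arr C" "u' \<in> Arr C" "Dom C u = Cod C q" "Dom C u' = Cod C q"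
    "Cod C u' = Cod C u" "u \<star> q = u' \<star> q"
  shows "u = u'"
proof -
  note q = cokernelD[OF assms(1)]
  have "(u \<star> q) \<star> f = Zero C (Dom C f) (Cod C (u \<star> q))"
    using q assms(2,4) by simp
  then have "\<exists>!v. v \<in> Hom C (Cod C q) (Cod C (u \<star> q)) \<and> v \<star> q = u \<star> q"
    using q assms(2,4) by (intro cokernel_ex1[OF assms(1)]) auto
  moreover have "u \<in> Hom C (Cod C q) (Cod C (u \<star> q))" "u' \<in> Hom C (Cod C q) (Cod C (u \<star> q))"
    using assms q by (auto simp: Hom_def)
  ultimately show ?thesis using assms(7) by metis
qed

text \<open>
  The form in which kernels serve in diagram chases: two arrows with the same composite differ by
  an arrow through the kernel.
\<close>

lemma kernel_diff:
  assumes "is_kernel C k f" "x \<in> Arr C" "y \<in> Arr C" "Cod C x = Dom C f" "Cod C y = Dom C f"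
    "Dom C y = Dom C x" "f \<star> x = f \<star> y"
  obtains u where "u \<in> Arr C" "Dom C u = Dom C x" "Cod C u = Dom C k" "x = Add C (k \<star> u) y"
proof -
  note k = kernelD[OF assms(1)]
  have "f \<star> sub x y = Zero C (Dom C (sub x y)) (Cod C f)" using assms k by simp
  from kernel_lift[OF assms(1) _ _ this]
  obtain u where u: "u \<in> Arr C" "Dom C u = Dom C x" "Cod C u = Dom C k" "sub x y = k \<star> u"
    using assms by (metis sub_arr)
  have "x = Add C (k \<star> u) y"
    by (rule sub_eq_iff[THEN iffD1, OF _ _ _ _ _ _ _ u(4)]) (use assms k u(1-3) in simp_all)
  then show ?thesis using that u by blast
qed

lemma cokernel_diff:
  assumes "is_cokernel C q f" "x \<in> Arr C" "y \<in> Arr C" "Dom C x = Cod C f" "Dom C y = Cod C f"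
    "Cod C y = Cod C x" "x \<star> f = y \<star> f"
  obtains u where "u \<in> Arr C" "Dom C u = Cod C q" "Cod C u = Cod C x" "x = Add C (u \<star> q) y"
proof -
  note q = cokernelD[OF assms(1)]
  have "sub x y \<star> f = Zero C (Dom C f) (Cod C (sub x y))" using assms q by simp
  from cokernel_lift[OF assms(1) _ _ this]
  obtain u where u: "u \<in> Arr C" "Dom C u = Cod C q" "Cod C u = Cod C x" "sub x y = u \<star> q"
    using assms by (metis sub_arr)
  have "x = Add C (u \<star> q) y"
    by (rule sub_eq_iff[THEN iffD1, OF _ _ _ _ _ _ _ u(4)]) (use assms q u(1-3) in simp_all)
  then show ?thesis using that u by blast
qed

end

section \<open>Weak kernels and bijectivity on homs\<close>

text \<open>
  Exactness of \<open>Hom(Z, _)\<close>, for all \<open>Z\<close>, at the middle object of \<open>u\<close>, \<open>v\<close>: unlike for a kernel, the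
  factorization through \<open>u\<close> need not be unique. Dually for \<open>weak_cokernel\<close> and \<open>Hom(_, Z)\<close>.
\<close>

definition weak_kernel :: "('o, 'm, 'z) addcat_scheme \<Rightarrow> 'm \<Rightarrow> 'm \<Rightarrow> bool" where
  "weak_kernel C u v \<longleftrightarrow>
     u \<in> Arr C \<and> v \<in> Arr C \<and> Cod C u = Dom C v \<and> v \<star>\<^bsub>C\<^esub> u = Zero C (Dom C u) (Cod C v) \<and>
     (\<forall>y\<in>Arr C. Cod C y = Dom C v \<and> v \<star>\<^bsub>C\<^esub> y = Zero C (Dom C y) (Cod C v) \<longrightarrow>
        (\<exists>x \<in> Hom C (Dom C y) (Dom C u). y = u \<star>\<^bsub>C\<^esub> x))"

definition weak_cokernel :: "('o, 'm, 'z) addcat_scheme \<Rightarrow> 'm \<Rightarrow> 'm \<Rightarrow> bool" where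
  "weak_cokernel C v u \<longleftrightarrow>
     u \<in> Arr C \<and> v \<in> Arr C \<and> Cod C u = Dom C v \<and> v \<star>\<^bsub>C\<^esub> u = Zero C (Dom C u) (Cod C v) \<and>
     (\<forall>y\<in>Arr C. Dom C y = Cod C u \<and> y \<star>\<^bsub>C\<^esub> u = Zero C (Dom C u) (Cod C y) \<longrightarrow>
        (\<exists>x \<in> Hom C (Cod C v) (Cod C y). y = x \<star>\<^bsub>C\<^esub> v))"

definition hom_zero :: "('o, 'm, 'z) addcat_scheme \<Rightarrow> 'o \<Rightarrow> 'o \<Rightarrow> bool" where
  "hom_zero C A B \<longleftrightarrow> Hom C A B \<subseteq> {Zero C A B}"

text \<open>
  Injectivity is expressed by a trivial kernel, which is what diagram chases produce; the two agree
  by additivity (\<open>hom_injective_cancel\<close>).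
\<close>

definition hom_injective :: "('o, 'm, 'z) addcat_scheme \<Rightarrow> 'o \<Rightarrow> 'm \<Rightarrow> bool" where
  "hom_injective C A l \<longleftrightarrow>
     (\<forall>x \<in> Hom C A (Dom C l). l \<star>\<^bsub>C\<^esub> x = Zero C A (Cod C l) \<longrightarrow> x = Zero C A (Dom C l))"

definition hom_surjective :: "('o, 'm, 'z) cat_scheme \<Rightarrow> 'o \<Rightarrow> 'm \<Rightarrow> bool" where
  "hom_surjective C A l \<longleftrightarrow> (\<forall>y \<in> Hom C A (Cod C l). \<exists>x \<in> Hom C A (Dom C l). y = l \<star>\<^bsub>C\<^esub> x)"

context additive_category
begin

lemma weak_kernelD:
  assumes "weak_kernel C u v"
  shows "u \<in> Arr C" "v \<in> Arr C" "Cod C u = Dom C v" "v \<star> u = Zero C (Dom C u) (Cod C v)"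
  using assms by (auto simp: weak_kernel_def)

lemma weak_cokernelD:
  assumes "weak_cokernel C v u"
  shows "u \<in> Arr C" "v \<in> Arr C" "Cod C u = Dom C v" "v \<star> u = Zero C (Dom C u) (Cod C v)"
  using assms by (auto simp: weak_cokernel_def)

lemma weak_kernel_lift:
  assumes "weak_kernel C u v" "y \<in> Hom C Z (Dom C v)" "v \<star> y = Zero C Z (Cod C v)"
  obtains x where "x \<in> Hom C Z (Dom C u)" "y = u \<star> x"
proof -
  have "y \<in> Arr C" "Cod C y = Dom C v" "Dom C y = Z" using assms(2) by (auto simp: Hom_def)
  then show ?thesis using assms(1,3) that unfolding weak_kernel_def by blast
qed

lemma weak_cokernel_lift:
  assumes "weak_cokernel C v u" "y \<in> Hom C (Cod C u) Z" "y \<star> u = Zero C (Dom C u) Z"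
  obtains x where "x \<in> Hom C (Cod C v) Z" "y = x \<star> v"
proof -
  have "y \<in> Arr C" "Dom C y = Cod C u" "Cod C y = Z" using assms(2) by (auto simp: Hom_def)
  then show ?thesis using assms(1,3) that unfolding weak_cokernel_def by blast
qed

lemma hom_injective_cancel:
  assumes "hom_injective C A l" "l \<in> Arr C" "x \<in> Hom C A (Dom C l)" "y \<in> Hom C A (Dom C l)"
    "l \<star> x = l \<star> y"
  shows "x = y"
proof -
  have xy: "x \<in> Arr C" "y \<in> Arr C" "Dom C y = Dom C x" "Cod C y = Cod C x" "Dom C x = A"
    "Cod C x = Dom C l"
    using assms by (auto simp: Hom_def)
  have "l \<star> sub x y = Zero C A (Cod C l)"
    using xy assms(2,5) by simp
  then have "sub x y = Zero C A (Dom C l)"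
    using assms(1) xy unfolding hom_injective_def by (simp add: Hom_def)
  then show ?thesis using xy sub_eq_zero_iff[of x y] by simp
qed

lemma hom_zero_iso:
  assumes "isomorphic C A A'" "isomorphic C B B'" "hom_zero C A B"
  shows "hom_zero C A' B'"
  unfolding hom_zero_def
proof
  fix f assume f: "f \<in> Hom C A' B'"
  obtain a a' where a: "a \<in> Hom C A A'" "a' \<in> Hom C A' A" "a' \<star> a = Ident C A" "a \<star> a' = Ident C A'"
    using assms(1) by (rule isomorphicE)
  obtain b b' where b: "b \<in> Hom C B B'" "b' \<in> Hom C B' B" "b' \<star> b = Ident C B" "b \<star> b' = Ident C B'"
    using assms(2) by (rule isomorphicE)
  have "b' \<star> f \<star> a \<in> Hom C A B"
    using f a b by (auto simp: Hom_def)
  then have z: "b' \<star> f \<star> a = Zero C A B"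
    using assms(3) unfolding hom_zero_def by blast
  have "f = (b \<star> b') \<star> f \<star> (a \<star> a')"
    unfolding a b using f by (auto simp: Hom_def)
  also have "\<dots> = b \<star> (b' \<star> f \<star> a) \<star> a'"
    using f a(1,2) b(1,2) by (auto simp: Hom_def)
  also have "\<dots> = Zero C A' B'"
    unfolding z using a(1,2) b(1,2) by (auto simp: Hom_def)
  finally show "f \<in> {Zero C A' B'}" by simp
qed

lemma isomorphic_refl: "A \<in> Ob C \<Longrightarrow> isomorphic C A A"
  by (rule isomorphicI[of "Ident C A" _ _ "Ident C A"]) (auto simp: Hom_def)

lemma isomorphic_ob: "isomorphic C A B \<Longrightarrow> A \<in> Ob C" "isomorphic C A B \<Longrightarrow> B \<in> Ob C"
  by (auto simp: isomorphic_def Hom_def)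

lemma weak_kernel_iso:
  assumes wk: "weak_kernel C u v"
    and a: "a \<in> Hom C (Dom C u) (Dom C u')" "iso_arr C a"
    and b: "b \<in> Hom C (Dom C v) (Dom C v')" "iso_arr C b"
    and c: "c \<in> Hom C (Cod C v) (Cod C v')" "iso_arr C c"
    and uv': "u' \<in> Arr C" "v' \<in> Arr C" "Cod C u' = Dom C v'"
    and sq: "b \<star> u = u' \<star> a" "c \<star> v = v' \<star> b"
  shows "weak_kernel C u' v'"
proof -
  note uv = weak_kernelD[OF wk]
  obtain a' where a': "a' \<in> Hom C (Dom C u') (Dom C u)" "a' \<star> a = Ident C (Dom C u)"
    "a \<star> a' = Ident C (Dom C u')"
    using a unfolding iso_arr_def by (auto simp: Hom_def)
  obtain b' where b': "b' \<in> Hom C (Dom C v') (Dom C v)" "b' \<star> b = Ident C (Dom C v)"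
    "b \<star> b' = Ident C (Dom C v')"
    using b unfolding iso_arr_def by (auto simp: Hom_def)
  obtain c' where c': "c' \<in> Hom C (Cod C v') (Cod C v)" "c' \<star> c = Ident C (Cod C v)"
    "c \<star> c' = Ident C (Cod C v')"
    using c unfolding iso_arr_def by (auto simp: Hom_def)
  have h: "a \<in> Arr C" "Dom C a = Dom C u" "Cod C a = Dom C u'" "b \<in> Arr C" "Dom C b = Dom C v"
    "Cod C b = Dom C v'"
     "c \<in> Arr C" "Dom C c = Cod C v" "Cod C c = Cod C v'"
     "a' \<in> Arr C" "Dom C a' = Dom C u'" "Cod C a' = Dom C u" "b' \<in> Arr C" "Dom C b' = Dom C v'"
       "Cod C b' = Dom C v"
     "c' \<in> Arr C" "Dom C c' = Cod C v'" "Cod C c' = Cod C v"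
    using a b c a' b' c' by (auto simp: Hom_def)
  note h = h uv' uv(1-3)
  have "v' \<star> u' = v' \<star> (u' \<star> a) \<star> a'" using h a'(3) by simp
  also have "\<dots> = (v' \<star> b) \<star> u \<star> a'" unfolding sq(1)[symmetric] using h by simp
  also have "\<dots> = c \<star> (v \<star> u) \<star> a'" unfolding sq[symmetric] using h by simp
  also have "\<dots> = Zero C (Dom C u') (Cod C v')" unfolding uv(4) using h by simp
  finally have zero: "v' \<star> u' = Zero C (Dom C u') (Cod C v')" .
  have "\<exists>x \<in> Hom C (Dom C y) (Dom C u'). y = u' \<star> x"
    if y: "y \<in> Arr C" "Cod C y = Dom C v'" "v' \<star> y = Zero C (Dom C y) (Cod C v')" for y
  proof -
    have "v \<star> (b' \<star> y) = c' \<star> (c \<star> v) \<star> b' \<star> y"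
      using h y c'(2) by (simp flip: assoc)
    also have "\<dots> = c' \<star> v' \<star> (b \<star> b') \<star> y" unfolding sq using h y by simp
    also have "\<dots> = Zero C (Dom C y) (Cod C v)" unfolding b' using y h by simp
    finally obtain x where x: "x \<in> Hom C (Dom C y) (Dom C u)" "b' \<star> y = u \<star> x"
      using weak_kernel_lift[OF wk, of "b' \<star> y" "Dom C y"] h y(1,2) by (auto simp: Hom_def)
    have "y = b \<star> b' \<star> y" using h y(1,2) b'(3) by (simp flip: assoc)
    also have "\<dots> = (b \<star> u) \<star> x" unfolding x(2) using x(1) h by (simp add: Hom_def)
    also have "\<dots> = u' \<star> a \<star> x" unfolding sq(1) using x(1) h by (simp add: Hom_def)
    finally have eq: "y = u' \<star> a \<star> x" .
    have "a \<star> x \<in> Hom C (Dom C y) (Dom C u')" using x(1) h by (auto simp: Hom_def)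
    with eq show ?thesis by blast
  qed
  then show ?thesis using zero uv' unfolding weak_kernel_def by blast
qed

lemma weak_cokernel_iso:
  assumes wk: "weak_cokernel C v u"
    and a: "a \<in> Hom C (Dom C u) (Dom C u')" "iso_arr C a"
    and b: "b \<in> Hom C (Dom C v) (Dom C v')" "iso_arr C b"
    and c: "c \<in> Hom C (Cod C v) (Cod C v')" "iso_arr C c"
    and uv': "u' \<in> Arr C" "v' \<in> Arr C" "Cod C u' = Dom C v'"
    and sq: "b \<star> u = u' \<star> a" "c \<star> v = v' \<star> b"
  shows "weak_cokernel C v' u'"
proof -
  note uv = weak_cokernelD[OF wk]
  obtain a' where a': "a' \<in> Hom C (Dom C u') (Dom C u)" "a' \<star> a = Ident C (Dom C u)"
    "a \<star> a' = Ident C (Dom C u')"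
    using a unfolding iso_arr_def by (auto simp: Hom_def)
  obtain b' where b': "b' \<in> Hom C (Dom C v') (Dom C v)" "b' \<star> b = Ident C (Dom C v)"
    "b \<star> b' = Ident C (Dom C v')"
    using b unfolding iso_arr_def by (auto simp: Hom_def)
  obtain c' where c': "c' \<in> Hom C (Cod C v') (Cod C v)" "c' \<star> c = Ident C (Cod C v)"
    "c \<star> c' = Ident C (Cod C v')"
    using c unfolding iso_arr_def by (auto simp: Hom_def)
  have h: "a \<in> Arr C" "Dom C a = Dom C u" "Cod C a = Dom C u'" "b \<in> Arr C" "Dom C b = Dom C v"
    "Cod C b = Dom C v'"
     "c \<in> Arr C" "Dom C c = Cod C v" "Cod C c = Cod C v'"
     "a' \<in> Arr C" "Dom C a' = Dom C u'" "Cod C a' = Dom C u" "b' \<in> Arr C" "Dom C b' = Dom C v'"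
       "Cod C b' = Dom C v"
     "c' \<in> Arr C" "Dom C c' = Cod C v'" "Cod C c' = Cod C v"
    using a b c a' b' c' by (auto simp: Hom_def)
  note h = h uv' uv(1-3)
  have "v' \<star> u' = v' \<star> (u' \<star> a) \<star> a'" using h a'(3) by simp
  also have "\<dots> = (v' \<star> b) \<star> u \<star> a'" unfolding sq(1)[symmetric] using h by simp
  also have "\<dots> = c \<star> (v \<star> u) \<star> a'" unfolding sq[symmetric] using h by simp
  also have "\<dots> = Zero C (Dom C u') (Cod C v')" unfolding uv(4) using h by simp
  finally have zero: "v' \<star> u' = Zero C (Dom C u') (Cod C v')" .
  have "\<exists>x \<in> Hom C (Cod C v') (Cod C y). y = x \<star> v'"
    if y: "y \<in> Arr C" "Dom C y = Cod C u'" "y \<star> u' = Zero C (Dom C u') (Cod C y)" for y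
  proof -
    have "(y \<star> b) \<star> u = y \<star> (u' \<star> a)" unfolding sq[symmetric] using h y by simp
    also have "\<dots> = (y \<star> u') \<star> a" using h y(1,2) by simp
    also have "\<dots> = Zero C (Dom C u) (Cod C y)" unfolding y(3) using h y by simp
    finally obtain x where x: "x \<in> Hom C (Cod C v) (Cod C y)" "y \<star> b = x \<star> v"
      using weak_cokernel_lift[OF wk, of "y \<star> b" "Cod C y"] h y(1,2) by (auto simp: Hom_def)
    have "y = (y \<star> b) \<star> b'" using h y(1,2) b'(3) by simp
    also have "\<dots> = x \<star> v \<star> b'" unfolding x(2) using x(1) h by (simp add: Hom_def)
    also have "v \<star> b' = c' \<star> (c \<star> v) \<star> b'"  using h c'(2) by (simp flip: assoc)
    also have "\<dots> = c' \<star> v'" unfolding sq(2) using h b'(3) by simp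
    finally have "y = x \<star> c' \<star> v'" .
    also have "\<dots> = (x \<star> c') \<star> v'" using x(1) h by (simp add: Hom_def)
    finally have eq: "y = (x \<star> c') \<star> v'" .
    have "x \<star> c' \<in> Hom C (Cod C v') (Cod C y)" using x(1) h by (auto simp: Hom_def)
    with eq show ?thesis by blast
  qed
  then show ?thesis using zero uv' unfolding weak_cokernel_def by blast
qed

text \<open>
  The arrow \<open>c : G X \<rightarrow> X\<close> corresponding to the identity of \<open>G X\<close> is universal among arrows from \<open>S\<close> to
  \<open>X\<close>, by naturality of the adjunction. The hypotheses on \<open>l\<close> say the same of \<open>l\<close>, and two universal
  arrows have isomorphic sources.
\<close>

lemma right_adjoint_isomorphic:
  assumes adj: "is_right_adjoint (full_subcategory C S) C (\<lambda>A. A) (\<lambda>f. f) G Gm"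
    and X: "X \<in> Ob C" and L: "L \<in> S" and l: "l \<in> Hom C L X"
    and inj: "\<And>Z. Z \<in> S \<Longrightarrow> hom_injective C Z l"
    and surj: "\<And>Z. Z \<in> S \<Longrightarrow> hom_surjective C Z l"
  shows "isomorphic C (G X) L"
proof -
  let ?S = "full_subcategory C S"
  have S: "Ob ?S = S" "\<And>A B. A \<in> S \<Longrightarrow> B \<in> S \<Longrightarrow> Hom ?S A B = Hom C A B" "Comp ?S = Comp C"
    "Ident ?S = Ident C"
    by (auto simp: full_subcategory_def Hom_def)
  have F: "is_functor C ?S G Gm" and S_ob: "S \<subseteq> Ob C"
    using adj unfolding is_right_adjoint_def is_functor_def[of ?S] S by auto
  have GX: "G X \<in> S" and Gid: "Gm (Ident C X) = Ident C (G X)"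
    using F X unfolding is_functor_def S by auto
  from adj obtain \<phi> where
    bij': "\<forall>A\<in>S. \<forall>B\<in>Ob C. bij_betw (\<phi> A B) (Hom C A B) (Hom ?S A (G B))"
    and nat': "\<forall>A\<in>S. \<forall>A'\<in>S. \<forall>B\<in>Ob C. \<forall>B'\<in>Ob C.
      \<forall>a \<in> Hom ?S A' A. \<forall>b \<in> Hom C B B'. \<forall>f \<in> Hom C A B.
      \<phi> A' B' (b \<star> f \<star> a) = Gm b \<star> \<phi> A B f \<star> a"
    unfolding is_right_adjoint_def S by blast
  have bij: "\<And>A B. A \<in> S \<Longrightarrow> B \<in> Ob C \<Longrightarrow> bij_betw (\<phi> A B) (Hom C A B) (Hom ?S A (G B))"
    and nat: "\<And>A A' B B' a b f. A \<in> S \<Longrightarrow> A' \<in> S \<Longrightarrow> B \<in> Ob C \<Longrightarrow> B' \<in> Ob C \<Longrightarrow>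
      a \<in> Hom ?S A' A \<Longrightarrow> b \<in> Hom C B B' \<Longrightarrow> f \<in> Hom C A B \<Longrightarrow>
      \<phi> A' B' (b \<star> f \<star> a) = Gm b \<star> \<phi> A B f \<star> a"
    using bij' nat' by blast+
  have "Ident C (G X) \<in> Hom ?S (G X) (G X)" using S GX S_ob by (auto simp: Hom_def)
  then obtain c where c: "c \<in> Hom C (G X) X" "\<phi> (G X) X c = Ident C (G X)"
    using bij_betw_imp_surj_on[OF bij[OF GX X]] by (metis imageE)
  have counit: "\<phi> A X (c \<star> a) = a" if "A \<in> S" "a \<in> Hom C A (G X)" for A a
    using nat[OF GX that(1) X X _ _ c(1), of a "Ident C X"] that c X S GX S_ob
    by (auto simp: Gid Hom_def)
  obtain u where u: "u \<in> Hom C (G X) L" "c = l \<star> u"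
    using surj[OF GX] c(1) l by (auto simp: hom_surjective_def Hom_def)
  define u' where "u' = \<phi> L X l"
  have u': "u' \<in> Hom C L (G X)"
    using bij[OF L X] l S GX L by (auto simp: bij_betw_def u'_def)
  have cu': "c \<star> u' = l"
  proof -
    have "\<phi> L X (c \<star> u') = \<phi> L X l" using counit[OF L u'] by (simp add: u'_def)
    then show ?thesis using bij[OF L X] l c(1) u'
      by (auto simp: bij_betw_def inj_on_def Hom_def)
  qed
  have "u' \<star> u = Ident C (G X)"
  proof -
    have "c \<star> (u' \<star> u) = (c \<star> u') \<star> u" using c(1) u(1) u' by (subst assoc) (auto simp: Hom_def)
    then have "c \<star> (u' \<star> u) = c" by (simp add: cu' u(2)[symmetric])
    moreover have "u' \<star> u \<in> Hom C (G X) (G X)" using u u' by (auto simp: Hom_def)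
    ultimately show ?thesis using counit[OF GX, of "u' \<star> u"] c(2) by simp
  qed
  moreover have "u \<star> u' = Ident C L"
  proof (rule hom_injective_cancel[OF inj[OF L]])
    have "l \<star> (u \<star> u') = (l \<star> u) \<star> u'" using l u(1) u' by (subst assoc) (auto simp: Hom_def)
    then show "l \<star> (u \<star> u') = l \<star> Ident C L"
      using l by (auto simp: u(2)[symmetric] cu' Hom_def)
  qed (use l u(1) u' S_ob L in \<open>auto simp: Hom_def\<close>)
  ultimately show ?thesis using u(1) u' by (intro isomorphicI)
qed

end

section \<open>Triangles and double orthogonals\<close>

text \<open>
  The part of the structure of a triangulated category that the comparison of \<open>L\<^sub>0\<close> with \<open>i\<^sup>!(X)\<close> uses:
  the long exact hom sequences of a triangle, cut into weak kernels and weak cokernels, and a shift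
  that is fully faithful and essentially surjective. Faithfulness is expressed by reflection of zero.
\<close>

locale exact_triangles = additive_category T
  for T :: "('o, 'm, 'z) tricat_scheme" (structure) +
  assumes shift_ob: "A \<in> Ob T \<Longrightarrow> Shift T A \<in> Ob T"
    and shift_hom: "f \<in> Hom T A B \<Longrightarrow> ShiftArr T f \<in> Hom T (Shift T A) (Shift T B)"
    and shift_comp: "f \<in> Hom T A B \<Longrightarrow> g \<in> Hom T B D \<Longrightarrow> ShiftArr T (g \<star> f) = ShiftArr T g \<star> ShiftArr T f"
    and shift_zero_iff: "f \<in> Hom T A B \<Longrightarrow>
          ShiftArr T f = Zero T (Shift T A) (Shift T B) \<longleftrightarrow> f = Zero T A B"
    and shift_full: "A \<in> Ob T \<Longrightarrow> B \<in> Ob T \<Longrightarrow> g \<in> Hom T (Shift T A) (Shift T B) \<Longrightarrow>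
          \<exists>f \<in> Hom T A B. g = ShiftArr T f"
    and shift_surj: "Y \<in> Ob T \<Longrightarrow> \<exists>B\<in>Ob T. isomorphic T (Shift T B) Y"
    and tri_ex: "u \<in> Arr T \<Longrightarrow> \<exists>v w. (u, v, w) \<in> Tri T"
    and tri_cod: "(u, v, w) \<in> Tri T \<Longrightarrow> Cod T w = Shift T (Dom T u)"
    and tri_weak_kernel: "(u, v, w) \<in> Tri T \<Longrightarrow> weak_kernel T u v"
      "(u, v, w) \<in> Tri T \<Longrightarrow> weak_kernel T v w"
      "(u, v, w) \<in> Tri T \<Longrightarrow> weak_kernel T w (ShiftArr T u)"
    and tri_weak_cokernel: "(u, v, w) \<in> Tri T \<Longrightarrow> weak_cokernel T v u"
      "(u, v, w) \<in> Tri T \<Longrightarrow> weak_cokernel T w v"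
begin

lemma triD:
  assumes "(u, v, w) \<in> Tri T"
  shows "u \<in> Arr T" "v \<in> Arr T" "w \<in> Arr T" "Dom T v = Cod T u" "Dom T w = Cod T v"
    "Cod T w = Shift T (Dom T u)" "v \<star> u = Zero T (Dom T u) (Cod T v)"
    "ShiftArr T u \<star> w = Zero T (Cod T v) (Shift T (Cod T u))"
proof -
  show *: "u \<in> Arr T" "v \<in> Arr T" "w \<in> Arr T" "Dom T v = Cod T u" "Dom T w = Cod T v"
    "Cod T w = Shift T (Dom T u)" "v \<star> u = Zero T (Dom T u) (Cod T v)"
    using weak_kernelD[OF tri_weak_kernel(1)[OF assms]] weak_kernelD[OF tri_weak_kernel(2)[OF assms]]
      tri_cod[OF assms] by simp_all
  have "ShiftArr T u \<in> Hom T (Shift T (Dom T u)) (Shift T (Cod T u))"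
    using * by (intro shift_hom) (simp add: Hom_def)
  then show "ShiftArr T u \<star> w = Zero T (Cod T v) (Shift T (Cod T u))"
    using weak_kernelD[OF tri_weak_kernel(3)[OF assms]] * by (simp add: Hom_def)
qed

lemma hom_zero_shift:
  assumes "A \<in> Ob T" "B \<in> Ob T"
  shows "hom_zero T (Shift T A) (Shift T B) \<longleftrightarrow> hom_zero T A B"
proof
  assume *: "hom_zero T (Shift T A) (Shift T B)"
  show "hom_zero T A B"
    unfolding hom_zero_def
  proof
    fix f assume f: "f \<in> Hom T A B"
    then show "f \<in> {Zero T A B}"
      using * shift_hom[OF f] shift_zero_iff[OF f] by (auto simp: hom_zero_def)
  qed
next
  assume *: "hom_zero T A B"
  show "hom_zero T (Shift T A) (Shift T B)"
    unfolding hom_zero_def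
  proof
    fix g assume "g \<in> Hom T (Shift T A) (Shift T B)"
    then obtain f where f: "f \<in> Hom T A B" "g = ShiftArr T f"
      using shift_full assms by blast
    then show "g \<in> {Zero T (Shift T A) (Shift T B)}"
      using * shift_zero_iff[OF f(1)] by (auto simp: hom_zero_def)
  qed
qed

definition right_perp :: "'o set \<Rightarrow> 'o set" where
  "right_perp R = {Y \<in> Ob T. \<forall>A\<in>R. hom_zero T A Y}"

definition left_perp :: "'o set \<Rightarrow> 'o set" where
  "left_perp P = {Z \<in> Ob T. \<forall>Y\<in>P. hom_zero T Z Y}"

text \<open>
  \<open>R\<close> is closed under \<open>[1]\<close> and \<open>[-1]\<close> up to isomorphism, and \<open>Hom(A[1], B[1])\<close> vanishes together
  with \<open>Hom(A, B)\<close>; so both shifts can be moved from \<open>B\<close> to \<open>R\<close>.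
\<close>

lemma shift_right_perp:
  assumes R: "closed_under_shifts T R" "R \<subseteq> Ob T" and B: "B \<in> Ob T"
  shows "Shift T B \<in> right_perp R \<longleftrightarrow> B \<in> right_perp R"
proof
  assume *: "Shift T B \<in> right_perp R"
  have "hom_zero T A B" if A: "A \<in> R" for A
  proof -
    obtain A' where A': "A' \<in> R" "isomorphic T A' (Shift T A)"
      using R A unfolding closed_under_shifts_def by blast
    have "hom_zero T A' (Shift T B)" using * A' by (auto simp: right_perp_def)
    then have "hom_zero T (Shift T A) (Shift T B)"
      using hom_zero_iso[OF A'(2) isomorphic_refl[OF shift_ob[OF B]]] by blast
    then show ?thesis using A R B by (auto simp: hom_zero_shift)
  qed
  then show "B \<in> right_perp R" using B by (auto simp: right_perp_def)
next
  assume *: "B \<in> right_perp R"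
  have "hom_zero T A (Shift T B)" if A: "A \<in> R" for A
  proof -
    obtain A' where A': "A' \<in> R" "isomorphic T (Shift T A') A"
      using R A unfolding closed_under_shifts_def by blast
    have "hom_zero T A' B" using * A' by (auto simp: right_perp_def)
    then have "hom_zero T (Shift T A') (Shift T B)"
      using A' R B by (auto simp: hom_zero_shift)
    then show ?thesis
      using hom_zero_iso[OF A'(2) isomorphic_refl[OF shift_ob[OF B]]] by blast
  qed
  then show "Shift T B \<in> right_perp R" using shift_ob[OF B] by (auto simp: right_perp_def)
qed

lemma right_perp_iso:
  assumes "isomorphic T A B" "A \<in> right_perp R" "R \<subseteq> Ob T"
  shows "B \<in> right_perp R"
  using assms isomorphic_ob[OF assms(1)] hom_zero_iso[OF isomorphic_refl assms(1)]
  by (auto simp: right_perp_def)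

text \<open>
  The right orthogonal of \<open>R\<close> is closed under \<open>[1]\<close> and \<open>[-1]\<close>, the latter existing by essential
  surjectivity of the shift, and so is its left orthogonal. Closure under cones follows, as a map
  out of the cone of \<open>A \<rightarrow> B\<close> that vanishes on \<open>B\<close> factors through \<open>A[1]\<close>. A map out of a coproduct
  is determined by its components, so it vanishes if they do.
\<close>

lemma left_perp_right_perp_localizing:
  assumes R: "closed_under_shifts T R" "R \<subseteq> Ob T"
  shows "localizing_subcategory T (left_perp (right_perp R))"
proof -
  let ?P = "right_perp R" and ?N = "left_perp (right_perp R)"
  have P_ob: "Y \<in> Ob T" if "Y \<in> ?P" for Y using that by (auto simp: right_perp_def)
  have N_zero: "f = Zero T Z Y" if "Z \<in> ?N" "Y \<in> ?P" "f \<in> Hom T Z Y" for Z Y f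
    using that by (auto simp: left_perp_def hom_zero_def)
  have N_shift: "Z \<in> ?N \<longleftrightarrow> Shift T Z \<in> ?N" if Z: "Z \<in> Ob T" for Z
  proof
    assume *: "Z \<in> ?N"
    have "hom_zero T (Shift T Z) Y" if Y: "Y \<in> ?P" for Y
    proof -
      obtain B where B: "B \<in> Ob T" "isomorphic T (Shift T B) Y"
        using shift_surj[OF P_ob[OF Y]] by blast
      then have "Shift T B \<in> ?P" using right_perp_iso isomorphic_sym Y R by blast
      then have "B \<in> ?P" using shift_right_perp[OF R B(1)] by blast
      then have "hom_zero T Z B" using * by (auto simp: left_perp_def)
      then have "hom_zero T (Shift T Z) (Shift T B)" using Z B by (simp add: hom_zero_shift)
      then show ?thesis using hom_zero_iso[OF isomorphic_refl[OF shift_ob[OF Z]] B(2)] by blast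
    qed
    then show "Shift T Z \<in> ?N" using shift_ob[OF Z] by (auto simp: left_perp_def)
  next
    assume *: "Shift T Z \<in> ?N"
    have "hom_zero T Z Y" if Y: "Y \<in> ?P" for Y
    proof -
      have "Shift T Y \<in> ?P" using shift_right_perp[OF R P_ob[OF Y]] Y by blast
      then have "hom_zero T (Shift T Z) (Shift T Y)" using * by (auto simp: left_perp_def)
      then show ?thesis using Z P_ob[OF Y] by (simp add: hom_zero_shift)
    qed
    then show "Z \<in> ?N" using Z by (auto simp: left_perp_def)
  qed
  have N_cone: "Cod T v \<in> ?N" if t: "(u, v, w) \<in> Tri T" and N: "Dom T u \<in> ?N" "Cod T u \<in> ?N" for u v w
  proof -
    note t' = triD[OF t]
    have "hom_zero T (Cod T v) Y" if Y: "Y \<in> ?P" for Y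
      unfolding hom_zero_def
    proof
      fix f assume f: "f \<in> Hom T (Cod T v) Y"
      then have "f \<star> v \<in> Hom T (Cod T u) Y" using t' by (auto simp: Hom_def)
      then have "f \<star> v = Zero T (Cod T u) Y" using N_zero N Y by blast
      then obtain g where g: "g \<in> Hom T (Shift T (Dom T u)) Y" "f = g \<star> w"
        using weak_cokernel_lift[OF tri_weak_cokernel(2)[OF t] f] t' by auto
      have "g = Zero T (Shift T (Dom T u)) Y"
        using N_zero[OF _ Y g(1)] N_shift N t' by auto
      then have "f = Zero T (Cod T v) Y" unfolding g(2) using t' P_ob[OF Y] shift_ob by simp
      then show "f \<in> {Zero T (Cod T v) Y}" by simp
    qed
    then show ?thesis using t' by (auto simp: left_perp_def)
  qed
  have N_coprod: "Y \<in> ?N" if c: "is_coproduct T I X Y j" and N: "\<forall>i\<in>I. X i \<in> ?N"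
    for I :: "'m set" and X Y j
  proof -
    have "hom_zero T Y W" if W: "W \<in> ?P" for W
      unfolding hom_zero_def
    proof
      fix f assume f: "f \<in> Hom T Y W"
      have j: "j i \<in> Hom T (X i) Y" "X i \<in> Ob T" if "i \<in> I" for i
        using c that by (auto simp: is_coproduct_def)
      have Y: "Y \<in> Ob T" using c by (simp add: is_coproduct_def)
      have "\<exists>!h. h \<in> Hom T Y W \<and> (\<forall>i\<in>I. h \<star> j i = Zero T (X i) W)"
        using c P_ob[OF W] j unfolding is_coproduct_def
        by (elim conjE) (auto simp: Hom_def dest!: bspec[of _ _ W] spec[of _ "\<lambda>i. Zero T (X i) W"])
      moreover have "f \<star> j i = Zero T (X i) W" if i: "i \<in> I" for i
        using N_zero[of "X i" W "f \<star> j i"] f j[OF i] i N W by (auto simp: Hom_def)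
      moreover have "Zero T Y W \<star> j i = Zero T (X i) W" if i: "i \<in> I" for i
        using j[OF i] P_ob[OF W] Y by (auto simp: Hom_def)
      moreover have "Zero T Y W \<in> Hom T Y W" using Y P_ob[OF W] by (auto simp: Hom_def)
      ultimately show "f \<in> {Zero T Y W}" using f by blast
    qed
    then show ?thesis using c by (auto simp: left_perp_def is_coproduct_def)
  qed
  have "Z \<in> ?N" if "zero_object T Z" for Z
  proof -
    have Z: "Z \<in> Ob T" using that by (simp add: zero_object_def)
    have "hom_zero T Z Y" if Y: "Y \<in> ?P" for Y
    proof -
      have "\<exists>!f. f \<in> Hom T Z Y" using \<open>zero_object T Z\<close> P_ob[OF Y] by (auto simp: zero_object_def)
      moreover have "Zero T Z Y \<in> Hom T Z Y" using Z P_ob[OF Y] by (auto simp: Hom_def)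
      ultimately show ?thesis unfolding hom_zero_def by blast
    qed
    then show ?thesis using Z by (auto simp: left_perp_def)
  qed
  moreover have "B \<in> ?N" if "A \<in> ?N" "isomorphic T A B" for A B
    using that isomorphic_ob[OF that(2)] hom_zero_iso[OF that(2) isomorphic_refl] P_ob
    by (auto simp: left_perp_def)
  moreover have "?N \<subseteq> Ob T" by (auto simp: left_perp_def)
  ultimately show ?thesis
    using N_shift N_cone N_coprod
    unfolding localizing_subcategory_def triangulated_subcategory_def
    by blast
qed

lemma localizing_closure_subset:
  assumes "localizing_subcategory T S" "R \<subseteq> S"
  shows "localizing_closure T R \<subseteq> S"
  using assms by (auto simp: localizing_closure_def)

lemma localizing_closure_left_perp:
  assumes R: "closed_under_shifts T R" "R \<subseteq> Ob T"
  shows "localizing_closure T R \<subseteq> left_perp (right_perp R)"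
  using left_perp_right_perp_localizing[OF R] R(2)
  by (intro localizing_closure_subset) (auto simp: left_perp_def right_perp_def)

lemma localizing_closure_cone:
  assumes "(u, v, w) \<in> Tri T" "Dom T u \<in> localizing_closure T R" "Cod T u \<in> localizing_closure T R"
  shows "Cod T v \<in> localizing_closure T R"
  unfolding localizing_closure_def
proof (rule InterI)
  fix S assume S: "S \<in> {S. localizing_subcategory T S \<and> R \<subseteq> S}"
  then have "Dom T u \<in> S" "Cod T u \<in> S"
    using assms(2,3) unfolding localizing_closure_def by blast+
  moreover have "\<forall>(u, v, w) \<in> Tri T. Dom T u \<in> S \<and> Cod T u \<in> S \<longrightarrow> Cod T v \<in> S"
    using S unfolding localizing_subcategory_def triangulated_subcategory_def by blast
  ultimately show "Cod T v \<in> S" using assms(1) by blast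
qed

text \<open>
  Every \<open>A\<close> in \<open>R\<close> is isomorphic to some \<open>B[1]\<close> with \<open>B\<close> in \<open>R\<close>, and \<open>Hom(B[1], e[1])\<close> is
  \<open>Hom(B, e)\<close>.
\<close>

lemma shift_hom_injective:
  assumes R: "closed_under_shifts T R" "R \<subseteq> Ob T"
    and e: "e \<in> Arr T" "\<And>A. A \<in> R \<Longrightarrow> hom_injective T A e" and A: "A \<in> R"
  shows "hom_injective T A (ShiftArr T e)"
  unfolding hom_injective_def
proof (intro ballI impI)
  have se: "ShiftArr T e \<in> Hom T (Shift T (Dom T e)) (Shift T (Cod T e))"
    using e by (intro shift_hom) (simp add: Hom_def)
  fix x
  assume "x \<in> Hom T A (Dom T (ShiftArr T e))"
    and "ShiftArr T e \<star> x = Zero T A (Cod T (ShiftArr T e))"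
  then have x: "x \<in> Hom T A (Shift T (Dom T e))" "ShiftArr T e \<star> x = Zero T A (Shift T (Cod T e))"
    using se by (auto simp: Hom_def)
  obtain B where B: "B \<in> R" "isomorphic T (Shift T B) A"
    using R A unfolding closed_under_shifts_def by blast
  obtain a a' where a: "a \<in> Hom T (Shift T B) A" "a' \<in> Hom T A (Shift T B)" "a \<star> a' = Ident T A"
    using B(2) by (rule isomorphicE)
  have "x \<star> a \<in> Hom T (Shift T B) (Shift T (Dom T e))" using x a by (auto simp: Hom_def)
  then obtain y where y: "y \<in> Hom T B (Dom T e)" "x \<star> a = ShiftArr T y"
    using shift_full B(1) R(2) e(1) arr_ob by blast
  have ey: "e \<star> y \<in> Hom T B (Cod T e)" using y e by (auto simp: Hom_def)
  have "ShiftArr T (e \<star> y) = ShiftArr T e \<star> x \<star> a"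
    unfolding y(2) by (rule shift_comp[OF y(1)]) (use e in \<open>simp add: Hom_def\<close>)
  also have "\<dots> = (ShiftArr T e \<star> x) \<star> a" using se x(1) a(1) by (subst assoc) (auto simp: Hom_def)
  also have "\<dots> = Zero T (Shift T B) (Shift T (Cod T e))"
    unfolding x(2) using a(1) e shift_ob by (auto simp: Hom_def)
  finally have "e \<star> y = Zero T B (Cod T e)" using shift_zero_iff[OF ey] by simp
  then have "y = Zero T B (Dom T e)" using e(2)[OF B(1)] y(1) by (auto simp: hom_injective_def)
  then have xa: "x \<star> a = Zero T (Shift T B) (Shift T (Dom T e))"
    using y shift_zero_iff[OF y(1)] by simp
  have "x = (x \<star> a) \<star> a'" using x(1) a by (auto simp: Hom_def)
  also have "\<dots> = Zero T A (Shift T (Dom T e))"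
    unfolding xa using a(2) x(1) shift_ob B(1) R e by (auto simp: Hom_def)
  finally show "x = Zero T A (Dom T (ShiftArr T e))" using se by (simp add: Hom_def)
qed

text \<open>
  The inductive step for the homotopy approximation, a version of the five lemma. Here \<open>k\<close>, \<open>p\<close> is a
  pair \<open>K\<^sub>i\<^sub>+\<^sub>1 \<rightarrow> R\<^sub>i \<rightarrow> K\<^sub>i\<close> that is short exact on \<open>Hom(A, _)\<close>, and the map \<open>Hom(A, L\<^sub>i) \<rightarrow> Hom(A, L\<^sub>i\<^sub>+\<^sub>1[1])\<close>
  of the triangle vanishes since the following one is injective by \<open>shift_hom_injective\<close>. So
  \<open>Hom(A, L\<^sub>i)\<close> and \<open>Hom(A, K\<^sub>i)\<close> are cokernels of the same map up to the bijection \<open>Hom(A, l')\<close>.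
\<close>

lemma approximation_step:
  assumes R: "closed_under_shifts T R" "R \<subseteq> Ob T"
    and t: "(k \<star> l', v, w) \<in> Tri T"
    and l': "l' \<in> Arr T" and k: "k \<in> Arr T" "Dom T k = Cod T l'"
    and l: "l \<in> Hom T (Cod T v) K" and p: "p \<in> Hom T (Cod T k) K" "l \<star> v = p"
    and l'_inj: "\<And>A. A \<in> R \<Longrightarrow> hom_injective T A l'"
    and l'_surj: "\<And>A. A \<in> R \<Longrightarrow> hom_surjective T A l'"
    and k_inj: "\<And>A. A \<in> R \<Longrightarrow> hom_injective T A k"
    and p_surj: "\<And>A. A \<in> R \<Longrightarrow> hom_surjective T A p"
    and exact: "\<And>A y. A \<in> R \<Longrightarrow> y \<in> Hom T A (Cod T k) \<Longrightarrow> p \<star> y = Zero T A K \<Longrightarrow>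
      \<exists>z \<in> Hom T A (Dom T k). y = k \<star> z"
    and A: "A \<in> R"
  shows "hom_injective T A l" "hom_surjective T A l"
proof -
  let ?e = "k \<star> l'"
  note t' = triD[OF t]
  have h: "Dom T v = Cod T k" "v \<in> Arr T" "w \<in> Arr T" "l \<in> Arr T" "Dom T l = Cod T v" "Cod T l = K"
    "K \<in> Ob T"
    using t' l' k l by (auto simp: Hom_def)
  have e_inj: "hom_injective T B ?e" if "B \<in> R" for B
    unfolding hom_injective_def
  proof (intro ballI impI)
    fix x assume x: "x \<in> Hom T B (Dom T ?e)" "?e \<star> x = Zero T B (Cod T ?e)"
    then have "k \<star> (l' \<star> x) = Zero T B (Cod T k)" "l' \<star> x \<in> Hom T B (Dom T k)"
      using l' k by (auto simp: Hom_def)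
    then have "l' \<star> x = Zero T B (Cod T l')"
      using k_inj[OF that] k by (auto simp: hom_injective_def)
    then show "x = Zero T B (Dom T ?e)"
      using l'_inj[OF that] x l' k by (auto simp: hom_injective_def)
  qed
  show "hom_surjective T A l"
    unfolding hom_surjective_def
  proof
    fix y assume y: "y \<in> Hom T A (Cod T l)"
    then obtain x where x: "x \<in> Hom T A (Cod T k)" "y = p \<star> x"
      using p_surj[OF A] p h by (auto simp: hom_surjective_def Hom_def)
    have "y = l \<star> (v \<star> x)" unfolding x(2) p(2)[symmetric] using x(1) h by (auto simp: Hom_def)
    moreover have "v \<star> x \<in> Hom T A (Dom T l)" using x(1) h by (auto simp: Hom_def)
    ultimately show "\<exists>x \<in> Hom T A (Dom T l). y = l \<star> x" by blast
  qed
  show "hom_injective T A l"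
    unfolding hom_injective_def
  proof (intro ballI impI)
    fix x assume "x \<in> Hom T A (Dom T l)" "l \<star> x = Zero T A (Cod T l)"
    then have x: "x \<in> Hom T A (Cod T v)" "l \<star> x = Zero T A K" using h by auto
    have xh: "x \<in> Arr T" "Dom T x = A" "Cod T x = Cod T v" using x by (auto simp: Hom_def)
    have se: "ShiftArr T ?e \<in> Hom T (Shift T (Dom T ?e)) (Shift T (Cod T ?e))"
      by (rule shift_hom) (use t' in \<open>simp add: Hom_def\<close>)
    have "ShiftArr T ?e \<star> (w \<star> x) = (ShiftArr T ?e \<star> w) \<star> x"
      using se xh t' by (subst assoc) (auto simp: Hom_def)
    also have "\<dots> = Zero T A (Shift T (Cod T ?e))"
      unfolding t'(8) using xh t' shift_ob by simp
    finally have "ShiftArr T ?e \<star> (w \<star> x) = Zero T A (Shift T (Cod T ?e))" .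
    moreover have "w \<star> x \<in> Hom T A (Shift T (Dom T ?e))" using xh t' by (auto simp: Hom_def)
    ultimately have "w \<star> x = Zero T A (Shift T (Dom T ?e))"
      using shift_hom_injective[OF R t'(1) e_inj A] se unfolding hom_injective_def by (auto simp: Hom_def)
    then obtain y where y: "y \<in> Hom T A (Cod T k)" "x = v \<star> y"
      using weak_kernel_lift[OF tri_weak_kernel(2)[OF t], of x A] x t' h by auto
    have "p \<star> y = l \<star> (v \<star> y)" unfolding p(2)[symmetric] using y(1) h by (auto simp: Hom_def)
    then have "p \<star> y = Zero T A K" using y x by simp
    then obtain z where z: "z \<in> Hom T A (Dom T k)" "y = k \<star> z" using exact[OF A y(1)] by blast
    then obtain z' where z': "z' \<in> Hom T A (Dom T l')" "z = l' \<star> z'"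
      using l'_surj[OF A] k by (auto simp: hom_surjective_def)
    have "x = (v \<star> ?e) \<star> z'" unfolding y(2) z(2) z'(2) using z'(1) l' k h by (auto simp: Hom_def)
    also have "\<dots> = Zero T A (Cod T v)" unfolding t'(7) using z'(1) l' k h by (auto simp: Hom_def)
    finally show "x = Zero T A (Dom T l)" using h by simp
  qed
qed

text \<open>
  \<open>Hom(Z, l)\<close> is bijective as soon as \<open>Z\<close> and \<open>Z[1]\<close> have no nonzero maps to the cone of \<open>l\<close>. The cone
  lies in the right orthogonal of \<open>R\<close> by the hypotheses on \<open>l\<close>.
\<close>

lemma hom_bijective_localizing_closure:
  assumes R: "closed_under_shifts T R" "R \<subseteq> Ob T" and l: "l \<in> Arr T"
    and inj: "\<And>A. A \<in> R \<Longrightarrow> hom_injective T A l"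
    and surj: "\<And>A. A \<in> R \<Longrightarrow> hom_surjective T A l"
    and Z: "Z \<in> localizing_closure T R"
  shows "hom_injective T Z l" "hom_surjective T Z l"
proof -
  obtain v w where t: "(l, v, w) \<in> Tri T" using tri_ex[OF l] by blast
  note t' = triD[OF t]
  have sl: "ShiftArr T l \<in> Hom T (Shift T (Dom T l)) (Shift T (Cod T l))"
    by (rule shift_hom) (use l in \<open>simp add: Hom_def\<close>)
  have "hom_zero T A (Cod T v)" if A: "A \<in> R" for A
    unfolding hom_zero_def
  proof
    fix f assume f: "f \<in> Hom T A (Cod T v)"
    have fh: "f \<in> Arr T" "Dom T f = A" "Cod T f = Cod T v" using f by (auto simp: Hom_def)
    have "ShiftArr T l \<star> (w \<star> f) = (ShiftArr T l \<star> w) \<star> f"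
      using sl fh t' by (subst assoc) (auto simp: Hom_def)
    also have "\<dots> = Zero T A (Shift T (Cod T l))"
      unfolding t'(8) using fh t' shift_ob by simp
    finally have "ShiftArr T l \<star> (w \<star> f) = Zero T A (Shift T (Cod T l))" .
    moreover have "w \<star> f \<in> Hom T A (Shift T (Dom T l))" using fh t' by (auto simp: Hom_def)
    ultimately have "w \<star> f = Zero T A (Shift T (Dom T l))"
      using shift_hom_injective[OF R l inj A] sl unfolding hom_injective_def by (auto simp: Hom_def)
    then obtain g where g: "g \<in> Hom T A (Cod T l)" "f = v \<star> g"
      using weak_kernel_lift[OF tri_weak_kernel(2)[OF t], of f A] f t' by auto
    obtain g' where g': "g' \<in> Hom T A (Dom T l)" "g = l \<star> g'"
      using surj[OF A] g(1) by (auto simp: hom_surjective_def)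
    have "f = (v \<star> l) \<star> g'" unfolding g(2) g'(2) using g'(1) t'(1-6) by (auto simp: Hom_def)
    also have "\<dots> = Zero T A (Cod T v)" unfolding t'(7) using g'(1) t' by (auto simp: Hom_def)
    finally show "f \<in> {Zero T A (Cod T v)}" by simp
  qed
  then have C: "Cod T v \<in> right_perp R" using t' by (auto simp: right_perp_def)
  then have Z0: "hom_zero T Z (Cod T v)" and Z_ob: "Z \<in> Ob T"
    using localizing_closure_left_perp[OF R] Z by (auto simp: left_perp_def)
  have "Shift T Z \<in> left_perp (right_perp R)"
    using left_perp_right_perp_localizing[OF R] localizing_closure_left_perp[OF R] Z Z_ob
    unfolding localizing_subcategory_def triangulated_subcategory_def by blast
  then have sZ0: "hom_zero T (Shift T Z) (Cod T v)" using C by (auto simp: left_perp_def)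
  show "hom_surjective T Z l"
    unfolding hom_surjective_def
  proof
    fix y assume y: "y \<in> Hom T Z (Cod T l)"
    then have "v \<star> y \<in> Hom T Z (Cod T v)" using t' by (auto simp: Hom_def)
    then have "v \<star> y = Zero T Z (Cod T v)" using Z0 by (auto simp: hom_zero_def)
    then show "\<exists>x \<in> Hom T Z (Dom T l). y = l \<star> x"
      using weak_kernel_lift[OF tri_weak_kernel(1)[OF t], of y Z] y t' by metis
  qed
  show "hom_injective T Z l"
    unfolding hom_injective_def
  proof (intro ballI impI)
    fix x assume x: "x \<in> Hom T Z (Dom T l)" "l \<star> x = Zero T Z (Cod T l)"
    have lx: "l \<star> x \<in> Hom T Z (Cod T l)" using x(1) l by (auto simp: Hom_def)
    have sx: "ShiftArr T x \<in> Hom T (Shift T Z) (Shift T (Dom T l))" by (rule shift_hom[OF x(1)])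
    have "ShiftArr T l \<star> ShiftArr T x = ShiftArr T (l \<star> x)"
      by (rule shift_comp[OF x(1), symmetric]) (use l in \<open>simp add: Hom_def\<close>)
    also have "\<dots> = Zero T (Shift T Z) (Shift T (Cod T l))" using shift_zero_iff[OF lx] x(2) by simp
    finally obtain h where h: "h \<in> Hom T (Shift T Z) (Cod T v)" "ShiftArr T x = w \<star> h"
      using weak_kernel_lift[OF tri_weak_kernel(3)[OF t], of "ShiftArr T x" "Shift T Z"] sl sx t'
      by (auto simp: Hom_def)
    have "h = Zero T (Shift T Z) (Cod T v)" using sZ0 h(1) by (auto simp: hom_zero_def)
    then have "ShiftArr T x = Zero T (Shift T Z) (Shift T (Dom T l))"
      unfolding h(2) using t' shift_ob[OF Z_ob] by simp
    then show "x = Zero T Z (Dom T l)" using shift_zero_iff[OF x(1)] by simp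
  qed
qed

end

section \<open>Null arrows and stable equality\<close>

locale frobenius_hulls = frobenius_category E
  for E :: "('o, 'm, 'z) exactcat_scheme" (structure) +
  fixes \<iota> \<pi> :: "'o \<Rightarrow> 'm"
  assumes injective_hulls: "injective_hulls E \<iota> \<pi>"
begin

lemma conflD:
  assumes "(f, g) \<in> Confl E"
  shows "is_kernel E f g" "is_cokernel E g f" "f \<in> Arr E" "g \<in> Arr E" "Dom E g = Cod E f"
    "g \<star> f = Zero E (Dom E f) (Cod E g)" "inflation E f" "deflation E g"
  using confl_kernel[OF assms] confl_cokernel[OF assms] cokernelD[of g f] assms
  by (auto simp: inflation_def deflation_def)

lemma injective_extend:
  assumes "injective E J" "inflation E i" "f \<in> Arr E" "Dom E f = Dom E i" "Cod E f = J"
  obtains h where "h \<in> Arr E" "Dom E h = Cod E i" "Cod E h = J" "h \<star> i = f"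
proof -
  have "f \<in> Hom E (Dom E i) J" using assms by (simp add: Hom_def)
  then obtain h where "h \<in> Hom E (Cod E i) J" "h \<star> i = f"
    using assms unfolding injective_def by blast
  then show ?thesis using that unfolding Hom_def by blast
qed

lemma projective_lift:
  assumes "projective E P" "deflation E q" "f \<in> Arr E" "Cod E f = Cod E q" "Dom E f = P"
  obtains h where "h \<in> Arr E" "Dom E h = P" "Cod E h = Dom E q" "q \<star> h = f"
proof -
  have "f \<in> Hom E P (Cod E q)" using assms by (simp add: Hom_def)
  then obtain h where "h \<in> Hom E P (Dom E q)" "q \<star> h = f"
    using assms unfolding projective_def by blast
  then show ?thesis using that unfolding Hom_def by blast
qed

lemma hull:
  assumes "A \<in> Ob E"
  shows "(\<iota> A, \<pi> A) \<in> Confl E" "injective E (Cod E (\<iota> A))" "projective E (Cod E (\<iota> A))"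
  using injective_hulls assms by (auto simp: injective_hulls_def projective_iff_injective)

lemma hull_arr [simp]:
  assumes "A \<in> Ob E"
  shows "\<iota> A \<in> Arr E" "\<pi> A \<in> Arr E" "Dom E (\<iota> A) = A" "Dom E (\<pi> A) = Cod E (\<iota> A)"
    "\<pi> A \<star> \<iota> A = Zero E A (Cod E (\<pi> A))"
  using conflD[OF hull(1)[OF assms]] injective_hulls assms by (auto simp: injective_hulls_def)

definition null :: "'m \<Rightarrow> bool" where
  "null f \<longleftrightarrow> f \<in> Arr E \<and>
     (\<exists>P a b. projective E P \<and> a \<in> Hom E (Dom E f) P \<and> b \<in> Hom E P (Cod E f) \<and> f = b \<star> a)"

lemma nullI:
  assumes "projective E P" "a \<in> Arr E" "b \<in> Arr E" "Cod E a = P" "Dom E b = P"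
  shows "null (b \<star> a)"
proof -
  have "a \<in> Hom E (Dom E (b \<star> a)) P" "b \<in> Hom E P (Cod E (b \<star> a))" "b \<star> a \<in> Arr E"
    using assms by (auto simp: Hom_def)
  then show ?thesis using assms(1) unfolding null_def by blast
qed

lemma null_arr: "null f \<Longrightarrow> f \<in> Arr E"
  by (simp add: null_def)

lemma null_factor:
  assumes "null f"
  obtains a b where "a \<in> Arr E" "b \<in> Arr E" "projective E (Cod E a)" "Dom E b = Cod E a"
    "Dom E a = Dom E f" "Cod E b = Cod E f" "b \<star> a = f"
proof -
  from assms obtain P a b where *: "projective E P" "a \<in> Hom E (Dom E f) P" "b \<in> Hom E P (Cod E f)"
    and f: "f = b \<star> a"
    unfolding null_def by blast
  show ?thesis by (rule that[OF _ _ _ _ _ _ f[symmetric]]) (use * in \<open>auto simp: Hom_def\<close>)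
qed

text \<open>
  The middle object of a factorization of \<open>f\<close> is injective as well as projective, so the first factor
  extends along every inflation. Dually, in \<open>null_lift\<close>, the second factor lifts along every
  deflation.
\<close>

lemma null_extend:
  assumes f: "null f" and i: "inflation E i" "i \<in> Arr E" "Dom E i = Dom E f"
  obtains g where "null g" "g \<in> Arr E" "Dom E g = Cod E i" "Cod E g = Cod E f" "g \<star> i = f"
proof -
  obtain a b where ab: "a \<in> Arr E" "b \<in> Arr E" "projective E (Cod E a)" "Dom E b = Cod E a"
    "Dom E a = Dom E f" "Cod E b = Cod E f" "b \<star> a = f" using f by (rule null_factor)
  obtain a' where a': "a' \<in> Arr E" "Dom E a' = Cod E i" "Cod E a' = Cod E a" "a' \<star> i = a"
    using injective_extend[OF _ i(1), of "Cod E a" a] ab i projective_iff_injective by auto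
  have "(b \<star> a') \<star> i = f" using ab a' i by simp
  moreover have "null (b \<star> a')" by (rule nullI[OF ab(3)]) (use ab a' in auto)
  ultimately show ?thesis using ab(1-6) a'(1-3) by (intro that[of "b \<star> a'"]) auto
qed

text \<open>
  A test object for nullity that depends only on the domain; it makes sums of null arrows null.
\<close>

lemma null_hull:
  assumes f: "null f" and A: "Dom E f = A"
  obtains g where "g \<in> Arr E" "Dom E g = Cod E (\<iota> A)" "Cod E g = Cod E f" "g \<star> \<iota> A = f"
proof -
  have "A \<in> Ob E" using null_arr[OF f] A by auto
  then show ?thesis
    using null_extend[OF f, of "\<iota> A"] A conflD(7)[OF hull(1)] that by auto
qed

lemma null_lift:
  assumes f: "null f" and q: "deflation E q" "q \<in> Arr E" "Cod E q = Cod E f"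
  obtains g where "null g" "g \<in> Arr E" "Cod E g = Dom E q" "Dom E g = Dom E f" "q \<star> g = f"
proof -
  obtain a b where ab: "a \<in> Arr E" "b \<in> Arr E" "projective E (Cod E a)" "Dom E b = Cod E a"
    "Dom E a = Dom E f" "Cod E b = Cod E f" "b \<star> a = f" using f by (rule null_factor)
  obtain b' where b': "b' \<in> Arr E" "Dom E b' = Cod E a" "Cod E b' = Dom E q" "q \<star> b' = b"
    using projective_lift[OF ab(3) q(1), of b] ab q by auto
  have "q \<star> (b' \<star> a) = (q \<star> b') \<star> a" using ab(1-6) b'(1-3) q by simp
  then have "q \<star> (b' \<star> a) = f" unfolding b'(4) ab(7) .
  moreover have "null (b' \<star> a)" by (rule nullI[OF ab(3)]) (use ab b' in auto)
  ultimately show ?thesis using ab(1-6) b'(1-3) by (intro that[of "b' \<star> a"]) auto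
qed

lemma null_comp:
  assumes "null f" "g \<in> Arr E"
  shows "Dom E g = Cod E f \<Longrightarrow> null (g \<star> f)" "Cod E g = Dom E f \<Longrightarrow> null (f \<star> g)"
proof -
  obtain a b where ab: "a \<in> Arr E" "b \<in> Arr E" "projective E (Cod E a)" "Dom E b = Cod E a"
    "Dom E a = Dom E f" "Cod E b = Cod E f" "b \<star> a = f" using assms(1) by (rule null_factor)
  show "null (g \<star> f)" if "Dom E g = Cod E f"
    using nullI[OF ab(3), of a "g \<star> b"] ab assms that by simp
  show "null (f \<star> g)" if "Cod E g = Dom E f"
    using nullI[OF ab(3), of "a \<star> g" b] ab assms that by (simp flip: assoc)
qed

lemma null_zero [simp]:
  assumes "A \<in> Ob E" "B \<in> Ob E"
  shows "null (Zero E A B)"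
  using nullI[OF hull(3)[OF assms(1)], of "\<iota> A" "Zero E (Cod E (\<iota> A)) B"] assms by simp

lemma null_add:
  assumes "null f" "null g" "Dom E g = Dom E f" "Cod E g = Cod E f"
  shows "null (Add E f g)"
proof -
  note arr = null_arr[OF assms(1)] null_arr[OF assms(2)]
  let ?A = "Dom E f"
  have A: "?A \<in> Ob E" using arr by simp
  obtain f' where f': "f' \<in> Arr E" "Dom E f' = Cod E (\<iota> ?A)" "Cod E f' = Cod E f" "f' \<star> \<iota> ?A = f"
    using null_hull[OF assms(1) refl] by blast
  obtain g' where g': "g' \<in> Arr E" "Dom E g' = Cod E (\<iota> ?A)" "Cod E g' = Cod E g" "g' \<star> \<iota> ?A = g"
    using null_hull[OF assms(2,3)] by blast
  have "null (Add E f' g' \<star> \<iota> ?A)"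
    by (rule nullI[OF hull(3)[OF A]]) (use f' g' A assms in auto)
  then show ?thesis using f' g' A assms by simp
qed

lemma null_neg:
  assumes "null f"
  shows "null (neg f)"
proof -
  note f = null_arr[OF assms]
  have "Add E (neg (Ident E (Cod E f)) \<star> f) f = Add E (neg (Ident E (Cod E f))) (Ident E (Cod E f)) \<star> f"
    using f by (subst comp_add(2)) auto
  also have "\<dots> = Zero E (Dom E f) (Cod E f)" using f by simp
  also have "\<dots> = Add E (neg f) f" using f by simp
  finally have "neg (Ident E (Cod E f)) \<star> f = neg f" using f by (subst (asm) add_right_cancel) auto
  moreover have "null (neg (Ident E (Cod E f)) \<star> f)" using f assms by (intro null_comp(1)) auto
  ultimately show ?thesis by simp
qed

lemma stably_equal_iff:
  "stably_equal E f g \<longleftrightarrow>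
     f \<in> Arr E \<and> g \<in> Arr E \<and> Dom E f = Dom E g \<and> Cod E f = Cod E g \<and>
     (\<exists>n. null n \<and> Dom E n = Dom E f \<and> Cod E n = Cod E f \<and> f = Add E n g)"
proof
  assume "stably_equal E f g"
  then obtain P a b where *: "f \<in> Arr E" "g \<in> Arr E" "Dom E f = Dom E g" "Cod E f = Cod E g"
    "projective E P" "a \<in> Hom E (Dom E f) P" "b \<in> Hom E P (Cod E f)" "f = Add E g (b \<star> a)"
    unfolding stably_equal_def by blast
  have "null (b \<star> a)" by (rule nullI[OF *(5)]) (use * in \<open>auto simp: Hom_def\<close>)
  moreover have "f = Add E (b \<star> a) g"
    by (rule trans[OF *(8)], rule add_commute) (use *(2-7) in \<open>auto simp: Hom_def\<close>)
  moreover have "Dom E (b \<star> a) = Dom E f" "Cod E (b \<star> a) = Cod E f" using *(6,7) by (auto simp: Hom_def)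
  ultimately show "f \<in> Arr E \<and> g \<in> Arr E \<and> Dom E f = Dom E g \<and> Cod E f = Cod E g \<and>
     (\<exists>n. null n \<and> Dom E n = Dom E f \<and> Cod E n = Cod E f \<and> f = Add E n g)"
    using *(1-4) by blast
next
  assume "f \<in> Arr E \<and> g \<in> Arr E \<and> Dom E f = Dom E g \<and> Cod E f = Cod E g \<and>
     (\<exists>n. null n \<and> Dom E n = Dom E f \<and> Cod E n = Cod E f \<and> f = Add E n g)"
  then obtain n where *: "f \<in> Arr E" "g \<in> Arr E" "Dom E f = Dom E g" "Cod E f = Cod E g"
     "null n" "Dom E n = Dom E f" "Cod E n = Cod E f" "f = Add E n g" by blast
  have "f = Add E g n"
    by (rule trans[OF *(8)], rule add_commute) (use *(2-7) null_arr in auto)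
  moreover obtain P a b where "projective E P" "a \<in> Hom E (Dom E n) P" "b \<in> Hom E P (Cod E n)"
    "n = b \<star> a"
    using *(5) unfolding null_def by blast
  ultimately show "stably_equal E f g"
    using *(1-4,6,7) unfolding stably_equal_def by metis
qed

lemma stably_equalI:
  assumes "null n" "g \<in> Arr E" "Dom E n = Dom E g" "Cod E n = Cod E g" "f = Add E n g"
  shows "stably_equal E f g"
proof -
  have "f \<in> Arr E" "Dom E f = Dom E g" "Cod E f = Cod E g"
    unfolding assms(5) using assms(1-4) null_arr by auto
  then show ?thesis using assms unfolding stably_equal_iff by metis
qed

lemma stably_equalE:
  assumes "stably_equal E f g"
  obtains n where "f \<in> Arr E" "g \<in> Arr E" "Dom E f = Dom E g" "Cod E f = Cod E g"
    "null n" "n \<in> Arr E" "Dom E n = Dom E g" "Cod E n = Cod E g" "f = Add E n g"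
  using assms null_arr unfolding stably_equal_iff by metis

lemma stably_equal_refl: "f \<in> Arr E \<Longrightarrow> stably_equal E f f"
  by (rule stably_equalI[of "Zero E (Dom E f) (Cod E f)"]) auto

lemma stably_equal_sym:
  assumes "stably_equal E f g"
  shows "stably_equal E g f"
proof -
  obtain n where n: "f \<in> Arr E" "g \<in> Arr E" "Dom E f = Dom E g" "Cod E f = Cod E g"
    "null n" "n \<in> Arr E" "Dom E n = Dom E g" "Cod E n = Cod E g" "f = Add E n g"
      using assms by (rule stably_equalE)
  have "Add E (neg n) f = Add E (Add E (neg n) n) g"
    unfolding n(9) using n(2-8) by (intro add_assoc[symmetric]) auto
  also have "\<dots> = g" using n(2,6,7,8) by simp
  finally show ?thesis using n by (intro stably_equalI[OF null_neg[OF n(5)]]) auto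
qed

lemma stably_equal_trans:
  assumes "stably_equal E f g" "stably_equal E g h"
  shows "stably_equal E f h"
proof -
  obtain n where n: "f \<in> Arr E" "g \<in> Arr E" "Dom E f = Dom E g" "Cod E f = Cod E g"
    "null n" "n \<in> Arr E" "Dom E n = Dom E g" "Cod E n = Cod E g" "f = Add E n g" using assms(1)
      by (rule stably_equalE)
  obtain m where m: "g \<in> Arr E" "h \<in> Arr E" "Dom E g = Dom E h" "Cod E g = Cod E h"
    "null m" "m \<in> Arr E" "Dom E m = Dom E h" "Cod E m = Cod E h" "g = Add E m h" using assms(2)
      by (rule stably_equalE)
  have "f = Add E n (Add E m h)" using n(9) m(9) by simp
  also have "\<dots> = Add E (Add E n m) h"
    using n(6-8) m(2-8) by (intro add_assoc[symmetric]) auto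
  finally show ?thesis
    using n(7,8) m(2,3,4,7,8) n(6) m(6) by (intro stably_equalI[OF null_add[OF n(5) m(5)]]) auto
qed

lemma stable_class_eq_iff:
  assumes "f \<in> Arr E"
  shows "stable_class E f = stable_class E g \<longleftrightarrow> stably_equal E f g"
proof
  assume *: "stable_class E f = stable_class E g"
  have "f \<in> stable_class E f" using stably_equal_refl[OF assms] by (simp add: stable_class_def)
  then have "f \<in> stable_class E g" unfolding * .
  then have "stably_equal E g f" by (simp add: stable_class_def)
  then show "stably_equal E f g" by (rule stably_equal_sym)
next
  assume "stably_equal E f g"
  then show "stable_class E f = stable_class E g"
    using stably_equal_trans stably_equal_sym unfolding stable_class_def by blast
qed

lemma stably_equal_comp:
  assumes "stably_equal E f f'" "stably_equal E g g'" "Dom E g = Cod E f"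
  shows "stably_equal E (g \<star> f) (g' \<star> f')"
proof -
  obtain n where n: "f \<in> Arr E" "f' \<in> Arr E" "Dom E f = Dom E f'" "Cod E f = Cod E f'"
    "null n" "n \<in> Arr E" "Dom E n = Dom E f'" "Cod E n = Cod E f'" "f = Add E n f'" using assms(1)
      by (rule stably_equalE)
  obtain m where m: "g \<in> Arr E" "g' \<in> Arr E" "Dom E g = Dom E g'" "Cod E g = Cod E g'"
    "null m" "m \<in> Arr E" "Dom E m = Dom E g'" "Cod E m = Cod E g'" "g = Add E m g'" using assms(2)
      by (rule stably_equalE)
  have d: "Dom E g' = Cod E f'" using assms(3) n m by simp
  have 1: "stably_equal E (g \<star> f) (g \<star> f')"
  proof (rule stably_equalI[of "g \<star> n"])
    show "null (g \<star> n)" using null_comp(1)[OF n(5) m(1)] n m(3) d by simp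
    show "g \<star> f = Add E (g \<star> n) (g \<star> f')"
      unfolding n(9) using n(2,6,7,8) m(1,3) d by (intro comp_add(1)) auto
  qed (use n(2,6,7,8) m(1,3) d in auto)
  have 2: "stably_equal E (g \<star> f') (g' \<star> f')"
  proof (rule stably_equalI[of "m \<star> f'"])
    show "null (m \<star> f')" using null_comp(2)[OF m(5) n(2)] m d by simp
    show "g \<star> f' = Add E (m \<star> f') (g' \<star> f')"
      unfolding m(9) using m(2,6,7,8) n(2) d by (intro comp_add(2)) auto
  qed (use m(2,6,7,8) n(2) d in auto)
  show ?thesis by (rule stably_equal_trans[OF 1 2])
qed

lemma stably_equal_add:
  assumes "stably_equal E f f'" "stably_equal E g g'" "Dom E g = Dom E f" "Cod E g = Cod E f"
  shows "stably_equal E (Add E f g) (Add E f' g')"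
proof -
  have left: "stably_equal E (Add E x z) (Add E x' z)"
    if x: "stably_equal E x x'" and z': "z \<in> Arr E" "Dom E z = Dom E x" "Cod E z = Cod E x" for x x' z
  proof -
    obtain n where n: "x \<in> Arr E" "x' \<in> Arr E" "Dom E x = Dom E x'" "Cod E x = Cod E x'"
      "null n" "n \<in> Arr E" "Dom E n = Dom E x'" "Cod E n = Cod E x'" "x = Add E n x'"
        using x by (rule stably_equalE)
    have z: "Dom E z = Dom E x'" "Cod E z = Cod E x'" using z' n by auto
    show ?thesis
    proof (rule stably_equalI[OF n(5)])
      show "Add E x z = Add E n (Add E x' z)"
        unfolding n(9) using n(2,6,7,8) z z'(1) by (intro add_assoc) auto
    qed (use n(2,6,7,8) z z'(1) in auto)
  qed
  have f: "f \<in> Arr E" "f' \<in> Arr E" "Dom E f = Dom E f'" "Cod E f = Cod E f'"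
    and g: "g \<in> Arr E" "g' \<in> Arr E" "Dom E g = Dom E g'" "Cod E g = Cod E g'"
    using assms(1,2) by (auto simp: stably_equal_def)
  have d: "Dom E g' = Dom E f'" "Cod E g' = Cod E f'" using assms(3,4) f g by auto
  have "stably_equal E (Add E f g) (Add E f' g)" using left[OF assms(1) g(1)] assms(3,4) by simp
  moreover have "stably_equal E (Add E g f') (Add E g' f')" using left[OF assms(2) f(2)] d g by simp
  moreover have "Add E g f' = Add E f' g" using f g d by (intro add_commute) auto
  moreover have "Add E g' f' = Add E f' g'" using f g d by (intro add_commute) auto
  ultimately show ?thesis using stably_equal_trans by metis
qed

section \<open>The stable category is additive\<close>

abbreviation T :: "('o, 'm set) tricat" where
  "T \<equiv> stable_category E \<iota> \<pi>"

abbreviation cls :: "'m \<Rightarrow> 'm set" where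
  "cls \<equiv> stable_class E"

lemma in_stable_class_iff: "g \<in> cls f \<longleftrightarrow> stably_equal E f g"
  by (simp add: stable_class_def)

lemma T_sel [simp]:
  "Ob T = Ob E" "Arr T = cls ` Arr E" "Ident T A = cls (Ident E A)" "Zero T A B = cls (Zero E A B)"
  "Shift T = stable_shift E \<pi>" "ShiftArr T = stable_shift_arr E \<iota> \<pi>"
  "(u, v, w) \<in> Tri T \<longleftrightarrow> distinguished_triangle E \<iota> \<pi> u v w"
  by (simp_all add: stable_category_def quotient_category_def addcat.defs tricat.defs)

text \<open>
  The operations of the quotient are unions over all representatives. Since stable equality is a
  congruence, all members of such a union coincide, and any representative can be used.
\<close>

lemma T_dom_cod [simp]:
  assumes "f \<in> Arr E"
  shows "Dom T (cls f) = Dom E f" "Cod T (cls f) = Cod E f"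
proof -
  have *: "f \<in> cls f" "\<And>g. g \<in> cls f \<Longrightarrow> Dom E g = Dom E f \<and> Cod E g = Cod E f"
    using stably_equal_refl[OF assms] by (auto simp: in_stable_class_iff stably_equal_def)
  have "Dom T (cls f) = (THE A. \<exists>g\<in>cls f. Dom E g = A)" "Cod T (cls f) = (THE A. \<exists>g\<in>cls f. Cod E g = A)"
    by (simp_all add: stable_category_def quotient_category_def addcat.defs tricat.defs)
  moreover have "(THE A. \<exists>g\<in>cls f. Dom E g = A) = Dom E f" "(THE A. \<exists>g\<in>cls f. Cod E g = A) = Cod E f"
    by (rule the_equality; use * in metis)+
  ultimately show "Dom T (cls f) = Dom E f" "Cod T (cls f) = Cod E f" by auto
qed

lemma T_comp [simp]:
  assumes "f \<in> Arr E" "g \<in> Arr E" "Dom E g = Cod E f"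
  shows "cls g \<star>\<^bsub>T\<^esub> cls f = cls (g \<star> f)"
proof -
  have *: "cls g \<star>\<^bsub>T\<^esub> cls f = (\<Union>g'\<in>cls g. \<Union>f'\<in>cls f. cls (g' \<star> f'))"
    by (simp add: stable_category_def quotient_category_def addcat.defs tricat.defs)
  have eq: "cls (g' \<star> f') = cls (g \<star> f)" if "g' \<in> cls g" "f' \<in> cls f" for f' g'
  proof -
    have "stably_equal E (g \<star> f) (g' \<star> f')"
      using that assms by (intro stably_equal_comp) (auto simp: in_stable_class_iff)
    then show ?thesis using assms by (subst (asm) stable_class_eq_iff[symmetric]) auto
  qed
  have "(\<Union>g'\<in>cls g. \<Union>f'\<in>cls f. cls (g' \<star> f')) = (\<Union>g'\<in>cls g. \<Union>f'\<in>cls f. cls (g \<star> f))"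
    by (intro SUP_cong refl eq)
  moreover have "cls f \<noteq> {}" "cls g \<noteq> {}" using assms stably_equal_refl in_stable_class_iff by blast+
  ultimately show ?thesis using * by simp
qed

lemma T_add [simp]:
  assumes "f \<in> Arr E" "g \<in> Arr E" "Dom E g = Dom E f" "Cod E g = Cod E f"
  shows "Add T (cls f) (cls g) = cls (Add E f g)"
proof -
  have *: "Add T (cls f) (cls g) = (\<Union>f'\<in>cls f. \<Union>g'\<in>cls g. cls (Add E f' g'))"
    by (simp add: stable_category_def quotient_category_def addcat.defs tricat.defs)
  have eq: "cls (Add E f' g') = cls (Add E f g)" if "g' \<in> cls g" "f' \<in> cls f" for f' g'
  proof -
    have "stably_equal E (Add E f g) (Add E f' g')"
      using that assms by (intro stably_equal_add) (auto simp: in_stable_class_iff)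
    then show ?thesis using assms by (subst (asm) stable_class_eq_iff[symmetric]) auto
  qed
  have "(\<Union>f'\<in>cls f. \<Union>g'\<in>cls g. cls (Add E f' g')) = (\<Union>f'\<in>cls f. \<Union>g'\<in>cls g. cls (Add E f g))"
    by (intro SUP_cong refl eq)
  moreover have "cls f \<noteq> {}" "cls g \<noteq> {}" using assms stably_equal_refl in_stable_class_iff by blast+
  ultimately show ?thesis using * by simp
qed

lemma T_hom_iff: "F \<in> Hom T A B \<longleftrightarrow> (\<exists>f \<in> Hom E A B. F = cls f)"
  by (auto simp: Hom_def)

lemma T_homE:
  assumes "F \<in> Hom T A B"
  obtains f where "f \<in> Arr E" "Dom E f = A" "Cod E f = B" "F = cls f"
  using assms by (auto simp: Hom_def)

lemma T_homI [intro]: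
  assumes "f \<in> Arr E" "Dom E f = A" "Cod E f = B"
  shows "cls f \<in> Hom T A B"
  using assms by (auto simp: Hom_def)

lemma cls_zero_iff [simp]:
  assumes "f \<in> Arr E" "Dom E f = A" "Cod E f = B"
  shows "cls f = cls (Zero E A B) \<longleftrightarrow> null f"
proof -
  have "A \<in> Ob E" "B \<in> Ob E" using assms by auto
  note AB = this
  show ?thesis
    unfolding stable_class_eq_iff[OF assms(1)]
  proof
    assume "stably_equal E f (Zero E A B)"
    then obtain n where "null n" "n \<in> Arr E" "Dom E n = A" "Cod E n = B" "f = Add E n (Zero E A B)"
      using AB by (elim stably_equalE) simp
    then show "null f" by simp
  next
    assume "null f"
    then show "stably_equal E f (Zero E A B)"
      using assms AB by (intro stably_equalI[of f]) auto
  qed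
qed

lemma is_biproduct_T:
  assumes b: "is_biproduct E A B P i1 i2 p1 p2" and AB: "A \<in> Ob E" "B \<in> Ob E"
  shows "is_biproduct T A B P (cls i1) (cls i2) (cls p1) (cls p2)"
proof -
  have arr: "i1 \<in> Arr E" "Dom E i1 = A" "Cod E i1 = P" "i2 \<in> Arr E" "Dom E i2 = B" "Cod E i2 = P"
    "p1 \<in> Arr E" "Dom E p1 = P" "Cod E p1 = A" "p2 \<in> Arr E" "Dom E p2 = P" "Cod E p2 = B" "P \<in> Ob E"
    using b by (auto simp: is_biproduct_def Hom_def)
  have eq: "p1 \<star> i1 = Ident E A" "p2 \<star> i2 = Ident E B" "p1 \<star> i2 = Zero E B A" "p2 \<star> i1 = Zero E A B"
    "Add E (i1 \<star> p1) (i2 \<star> p2) = Ident E P"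
    using b by (auto simp: is_biproduct_def)
  show ?thesis
    unfolding is_biproduct_def using arr by (auto simp: eq)
qed

lemma zero_object_T:
  assumes z: "zero_object E Z"
  shows "zero_object T Z"
proof -
  have "\<exists>!F. F \<in> Hom T A B" if f: "\<exists>!f. f \<in> Hom E A B" for A B
  proof -
    obtain f where f1: "f \<in> Hom E A B" and f2: "\<And>g. g \<in> Hom E A B \<Longrightarrow> g = f" using f by blast
    show ?thesis
    proof (rule ex1I[of _ "cls f"])
      show "cls f \<in> Hom T A B" using f1 by (auto simp: T_hom_iff)
    next
      fix F assume "F \<in> Hom T A B"
      then show "F = cls f" using f2 by (auto simp: T_hom_iff)
    qed
  qed
  then show ?thesis using z by (simp add: zero_object_def)
qed

lemma additive_category_T: "additive_category T"
proof (intro additive_category.intro category.intro additive_category_axioms.intro)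
  fix F assume "F \<in> Arr T"
  then show "Dom T F \<in> Ob T" "Cod T F \<in> Ob T" by auto
next
  fix A assume "A \<in> Ob T"
  then show "Ident T A \<in> Hom T A A" by auto
next
  fix F A B G D assume "F \<in> Hom T A B" "G \<in> Hom T B D"
  then show "G \<star>\<^bsub>T\<^esub> F \<in> Hom T A D" by (elim T_homE) (auto simp: Hom_def)
next
  fix F A B assume "F \<in> Hom T A B"
  then show "F \<star>\<^bsub>T\<^esub> Ident T A = F" "Ident T B \<star>\<^bsub>T\<^esub> F = F" by (auto elim!: T_homE)
next
  fix F A B G D H K assume "F \<in> Hom T A B" "G \<in> Hom T B D" "H \<in> Hom T D K"
  then show "(H \<star>\<^bsub>T\<^esub> G) \<star>\<^bsub>T\<^esub> F = H \<star>\<^bsub>T\<^esub> G \<star>\<^bsub>T\<^esub> F" by (auto elim!: T_homE)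
next
  fix A B assume "A \<in> Ob T" "B \<in> Ob T"
  then have AB: "A \<in> Ob E" "B \<in> Ob E" by auto
  show "comm_group (hom_group T A B)"
  proof (rule comm_groupI)
    fix F G assume F: "F \<in> carrier (hom_group T A B)" and G: "G \<in> carrier (hom_group T A B)"
    then obtain f g where f: "f \<in> Arr E" "Dom E f = A" "Cod E f = B" "F = cls f"
      and g: "g \<in> Arr E" "Dom E g = A" "Cod E g = B" "G = cls g"
      by (auto simp: hom_group_def elim!: T_homE)
    show "F \<otimes>\<^bsub>hom_group T A B\<^esub> G \<in> carrier (hom_group T A B)"
      using f g by (auto simp: hom_group_def)
    show "F \<otimes>\<^bsub>hom_group T A B\<^esub> G = G \<otimes>\<^bsub>hom_group T A B\<^esub> F"
      using f g add_commute[of f g] by (auto simp: hom_group_def)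
    fix H assume H: "H \<in> carrier (hom_group T A B)"
    then obtain h where h: "h \<in> Arr E" "Dom E h = A" "Cod E h = B" "H = cls h"
      by (auto simp: hom_group_def elim!: T_homE)
    show "F \<otimes>\<^bsub>hom_group T A B\<^esub> G \<otimes>\<^bsub>hom_group T A B\<^esub> H
        = F \<otimes>\<^bsub>hom_group T A B\<^esub> (G \<otimes>\<^bsub>hom_group T A B\<^esub> H)"
      using f g h add_assoc[of f g h] by (auto simp: hom_group_def)
  next
    show "\<one>\<^bsub>hom_group T A B\<^esub> \<in> carrier (hom_group T A B)"
      using AB by (auto simp: hom_group_def)
  next
    fix F assume F: "F \<in> carrier (hom_group T A B)"
    then obtain f where f: "f \<in> Arr E" "Dom E f = A" "Cod E f = B" "F = cls f"
      by (auto simp: hom_group_def elim!: T_homE)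
    show "\<one>\<^bsub>hom_group T A B\<^esub> \<otimes>\<^bsub>hom_group T A B\<^esub> F = F"
      using f AB by (auto simp: hom_group_def)
    show "\<exists>G \<in> carrier (hom_group T A B). G \<otimes>\<^bsub>hom_group T A B\<^esub> F = \<one>\<^bsub>hom_group T A B\<^esub>"
      using f AB by (intro bexI[of _ "cls (neg f)"]) (auto simp: hom_group_def)
  qed
next
  fix F A B G D G' assume "F \<in> Hom T A B" "G \<in> Hom T B D" "G' \<in> Hom T B D"
  then show "Add T G G' \<star>\<^bsub>T\<^esub> F = Add T (G \<star>\<^bsub>T\<^esub> F) (G' \<star>\<^bsub>T\<^esub> F)" by (auto elim!: T_homE)
next
  fix F A B F' G D assume "F \<in> Hom T A B" "F' \<in> Hom T A B" "G \<in> Hom T B D"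
  then show "G \<star>\<^bsub>T\<^esub> Add T F F' = Add T (G \<star>\<^bsub>T\<^esub> F) (G \<star>\<^bsub>T\<^esub> F')" by (auto elim!: T_homE)
next
  show "\<exists>Z. zero_object T Z" using ex_zero_object zero_object_T by blast
next
  fix A B assume "A \<in> Ob T" "B \<in> Ob T"
  then show "\<exists>P i1 i2 p1 p2. is_biproduct T A B P i1 i2 p1 p2"
    using ex_biproduct[of A B] is_biproduct_T[of A B] by fastforce
qed

section \<open>Conflations and the shift in the stable category\<close>

sublocale stable: additive_category T
  by (rule additive_category_T)

lemma stably_equalI2:
  assumes "null n" "g \<in> Arr E" "Dom E n = Dom E g" "Cod E n = Cod E g" "f = Add E g n"
  shows "stably_equal E f g"
  by (rule stably_equalI[OF assms(1-4)], rule trans[OF assms(5)], rule add_commute)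
    (use assms(1-4) null_arr in auto)

lemma stable_weak_kernelI:
  assumes uv: "u \<in> Arr E" "v \<in> Arr E" "Cod E u = Dom E v" "null (v \<star> u)"
    and lift: "\<And>y. y \<in> Arr E \<Longrightarrow> Cod E y = Dom E v \<Longrightarrow> null (v \<star> y) \<Longrightarrow>
      \<exists>x. x \<in> Arr E \<and> Dom E x = Dom E y \<and> Cod E x = Dom E u \<and> stably_equal E y (u \<star> x)"
  shows "weak_kernel T (cls u) (cls v)"
proof -
  have "\<exists>X \<in> Hom T (Dom T Y) (Dom T (cls u)). Y = cls u \<star>\<^bsub>T\<^esub> X"
    if Y: "Y \<in> Arr T" "Cod T Y = Dom T (cls v)" "cls v \<star>\<^bsub>T\<^esub> Y = Zero T (Dom T Y) (Cod T (cls v))" for Y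
  proof -
    obtain y where y: "y \<in> Arr E" "Y = cls y" using Y(1) by auto
    have "Cod E y = Dom E v" "null (v \<star> y)" using Y(2,3) y uv by auto
    then obtain x where x: "x \<in> Arr E" "Dom E x = Dom E y" "Cod E x = Dom E u"
      "stably_equal E y (u \<star> x)"
      using lift[OF y(1)] by blast
    have "cls y = cls (u \<star> x)" using x y by (simp add: stable_class_eq_iff)
    then have "Y = cls u \<star>\<^bsub>T\<^esub> cls x" using x uv y by simp
    moreover have "cls x \<in> Hom T (Dom T Y) (Dom T (cls u))" using x(1-3) y uv by auto
    ultimately show ?thesis by blast
  qed
  then show ?thesis using uv unfolding weak_kernel_def by simp
qed

lemma stable_weak_cokernelI:
  assumes uv: "u \<in> Arr E" "v \<in> Arr E" "Cod E u = Dom E v" "null (v \<star> u)"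
    and lift: "\<And>y. y \<in> Arr E \<Longrightarrow> Dom E y = Cod E u \<Longrightarrow> null (y \<star> u) \<Longrightarrow>
      \<exists>x. x \<in> Arr E \<and> Cod E x = Cod E y \<and> Dom E x = Cod E v \<and> stably_equal E y (x \<star> v)"
  shows "weak_cokernel T (cls v) (cls u)"
proof -
  have "\<exists>X \<in> Hom T (Cod T (cls v)) (Cod T Y). Y = X \<star>\<^bsub>T\<^esub> cls v"
    if Y: "Y \<in> Arr T" "Dom T Y = Cod T (cls u)" "Y \<star>\<^bsub>T\<^esub> cls u = Zero T (Dom T (cls u)) (Cod T Y)" for Y
  proof -
    obtain y where y: "y \<in> Arr E" "Y = cls y" using Y(1) by auto
    have "Dom E y = Cod E u" "null (y \<star> u)" using Y(2,3) y uv by auto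
    then obtain x where x: "x \<in> Arr E" "Cod E x = Cod E y" "Dom E x = Cod E v"
      "stably_equal E y (x \<star> v)"
      using lift[OF y(1)] by blast
    have "cls y = cls (x \<star> v)" using x y by (simp add: stable_class_eq_iff)
    then have "Y = cls x \<star>\<^bsub>T\<^esub> cls v" using x uv y by simp
    moreover have "cls x \<in> Hom T (Cod T (cls v)) (Cod T Y)" using x(1-3) y uv by auto
    ultimately show ?thesis by blast
  qed
  then show ?thesis using uv unfolding weak_cokernel_def by simp
qed

text \<open>
  If \<open>v \<star> y\<close> is null, it lifts along the deflation \<open>v\<close> to a null arrow \<open>n\<close>; then \<open>y\<close> and \<open>n\<close> have the
  same composite with \<open>v\<close>, so they differ by an arrow through the kernel \<open>u\<close>.
\<close>

lemma confl_weak_kernel: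
  assumes c: "(u, v) \<in> Confl E"
  shows "weak_kernel T (cls u) (cls v)"
proof (rule stable_weak_kernelI)
  note uv = conflD[OF c]
  show "u \<in> Arr E" "v \<in> Arr E" "Cod E u = Dom E v" "null (v \<star> u)" using uv by auto
  fix y assume y: "y \<in> Arr E" "Cod E y = Dom E v" "null (v \<star> y)"
  obtain n where n: "null n" "n \<in> Arr E" "Cod E n = Dom E v" "Dom E n = Dom E (v \<star> y)" "v \<star> n = v \<star> y"
    using null_lift[OF y(3) uv(8) uv(4)] y uv by auto
  have dn: "Dom E n = Dom E y" using n(4) y(1,2) uv by simp
  obtain x where x: "x \<in> Arr E" "Dom E x = Dom E y" "Cod E x = Dom E u" "y = Add E (u \<star> x) n"
    by (rule kernel_diff[OF uv(1) y(1) n(2) y(2) n(3) dn n(5)[symmetric]])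
  have "stably_equal E y (u \<star> x)"
    by (rule stably_equalI2[OF n(1) _ _ _ x(4)]) (use n(2,3) dn y(1,2) uv x(1-3) in auto)
  with x show "\<exists>x. x \<in> Arr E \<and> Dom E x = Dom E y \<and> Cod E x = Dom E u \<and> stably_equal E y (u \<star> x)"
    by blast
qed

lemma confl_weak_cokernel:
  assumes c: "(u, v) \<in> Confl E"
  shows "weak_cokernel T (cls v) (cls u)"
proof (rule stable_weak_cokernelI)
  note uv = conflD[OF c]
  show "u \<in> Arr E" "v \<in> Arr E" "Cod E u = Dom E v" "null (v \<star> u)" using uv by auto
  fix y assume y: "y \<in> Arr E" "Dom E y = Cod E u" "null (y \<star> u)"
  obtain n where n: "null n" "n \<in> Arr E" "Dom E n = Cod E u" "Cod E n = Cod E (y \<star> u)" "n \<star> u = y \<star> u"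
    using null_extend[OF y(3) uv(7) uv(3)] y uv by auto
  have cn: "Cod E n = Cod E y" using n(4) y(1,2) uv by simp
  obtain x where x: "x \<in> Arr E" "Dom E x = Cod E v" "Cod E x = Cod E y" "y = Add E (x \<star> v) n"
    by (rule cokernel_diff[OF uv(2) y(1) n(2) y(2) n(3) cn n(5)[symmetric]])
  have "stably_equal E y (x \<star> v)"
    by (rule stably_equalI2[OF n(1) _ _ _ x(4)]) (use n(2,3) cn y(1,2) uv x(1-3) in auto)
  with x show "\<exists>x. x \<in> Arr E \<and> Cod E x = Cod E y \<and> Dom E x = Cod E v \<and> stably_equal E y (x \<star> v)"
    by blast
qed

text \<open>
  A morphism between the chosen conflations \<open>A \<rightarrow> I(A) \<rightarrow> A[1]\<close>; the class of \<open>h\<close> is then the shift of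
  the class of \<open>f\<close>.
\<close>

definition hull_map :: "'m \<Rightarrow> 'm \<Rightarrow> 'm \<Rightarrow> bool" where
  "hull_map f g h \<longleftrightarrow> f \<in> Arr E \<and>
     g \<in> Hom E (Cod E (\<iota> (Dom E f))) (Cod E (\<iota> (Cod E f))) \<and>
     h \<in> Hom E (stable_shift E \<pi> (Dom E f)) (stable_shift E \<pi> (Cod E f)) \<and>
     g \<star> \<iota> (Dom E f) = \<iota> (Cod E f) \<star> f \<and> h \<star> \<pi> (Dom E f) = \<pi> (Cod E f) \<star> g"

lemma hull_mapD:
  assumes "hull_map f g h"
  shows "f \<in> Arr E" "g \<in> Arr E" "Dom E g = Cod E (\<iota> (Dom E f))" "Cod E g = Cod E (\<iota> (Cod E f))"
    "h \<in> Arr E" "Dom E h = Cod E (\<pi> (Dom E f))" "Cod E h = Cod E (\<pi> (Cod E f))"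
    "g \<star> \<iota> (Dom E f) = \<iota> (Cod E f) \<star> f" "h \<star> \<pi> (Dom E f) = \<pi> (Cod E f) \<star> g"
  using assms by (auto simp: hull_map_def Hom_def stable_shift_def)

lemma hull_mapI:
  assumes "f \<in> Arr E" "Dom E f = A" "Cod E f = B"
    "g \<in> Arr E" "Dom E g = Cod E (\<iota> A)" "Cod E g = Cod E (\<iota> B)"
    "h \<in> Arr E" "Dom E h = Cod E (\<pi> A)" "Cod E h = Cod E (\<pi> B)"
    "g \<star> \<iota> A = \<iota> B \<star> f" "h \<star> \<pi> A = \<pi> B \<star> g"
  shows "hull_map f g h"
  using assms by (auto simp: hull_map_def Hom_def stable_shift_def)

lemma hull_map_ex:
  assumes f: "f \<in> Arr E"
  obtains g h where "hull_map f g h"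
proof -
  let ?A = "Dom E f" and ?B = "Cod E f"
  have AB: "?A \<in> Ob E" "?B \<in> Ob E" using f by auto
  obtain g where g: "g \<in> Arr E" "Dom E g = Cod E (\<iota> ?A)" "Cod E g = Cod E (\<iota> ?B)" "g \<star> \<iota> ?A = \<iota> ?B \<star> f"
    using injective_extend[OF hull(2)[OF AB(2)] conflD(7)[OF hull(1)[OF AB(1)]], of "\<iota> ?B \<star> f"] f AB by auto
  have "(\<pi> ?B \<star> g) \<star> \<iota> ?A = \<pi> ?B \<star> \<iota> ?B \<star> f" using g f AB by simp
  also have "\<dots> = (\<pi> ?B \<star> \<iota> ?B) \<star> f" using f AB by (intro assoc[symmetric]) auto
  also have "\<dots> = Zero E ?A (Cod E (\<pi> ?B))" using f AB by simp
  finally have z: "(\<pi> ?B \<star> g) \<star> \<iota> ?A = Zero E ?A (Cod E (\<pi> ?B))" .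
  have pg: "\<pi> ?B \<star> g \<in> Arr E" "Dom E (\<pi> ?B \<star> g) = Cod E (\<iota> ?A)" "Cod E (\<pi> ?B \<star> g) = Cod E (\<pi> ?B)"
    using g f AB by auto
  obtain h where h: "h \<in> Arr E" "Dom E h = Cod E (\<pi> ?A)" "Cod E h = Cod E (\<pi> ?B)" "\<pi> ?B \<star> g = h \<star> \<pi> ?A"
    by (rule cokernel_lift[OF conflD(2)[OF hull(1)[OF AB(1)]] pg(1,2), unfolded pg(3)])
      (use z AB in auto)
  have "hull_map f g h"
    by (rule hull_mapI[OF f refl refl g(1-3) h(1-3) g(4) h(4)[symmetric]])
  then show ?thesis by (rule that)
qed

text \<open>
  If \<open>f\<close> and \<open>f'\<close> differ by \<open>e \<star> \<iota> A\<close>, then \<open>g\<close> and \<open>g'\<close> agree on \<open>A\<close> up to the correction \<open>\<iota> B \<star> e\<close>,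
  which \<open>\<pi> B\<close> kills. What remains of their difference factors through \<open>A[1]\<close>, and so \<open>h\<close> and \<open>h'\<close>
  differ by an arrow through \<open>I(B)\<close>.
\<close>

lemma hull_map_stably_unique:
  assumes fgh: "hull_map f g h" and fgh': "hull_map f' g' h'" and ff': "stably_equal E f f'"
  shows "stably_equal E h h'"
proof -
  note m = hull_mapD[OF fgh] and m' = hull_mapD[OF fgh']
  obtain A B where A: "Dom E f = A" "Cod E f = B" by blast
  obtain n where n: "Dom E f' = A" "Cod E f' = B"
    "null n" "n \<in> Arr E" "Dom E n = A" "Cod E n = B" "f = Add E n f'"
    using ff' A by (elim stably_equalE) auto
  have AB: "A \<in> Ob E" "B \<in> Ob E" using A m by auto
  note c = conflD[OF hull(1)[OF AB(1)]] and d = conflD[OF hull(1)[OF AB(2)]]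
  obtain e where e: "e \<in> Arr E" "Dom E e = Cod E (\<iota> A)" "Cod E e = B" "e \<star> \<iota> A = n"
    using null_hull[OF n(3,5)] n by auto
  note m = m[unfolded A] and m' = m'[unfolded n(1,2)]
  \<comment> \<open>\<open>g2\<close> extends \<open>\<iota> B \<star> f\<close>, as \<open>g\<close> does, and has the same composite with \<open>\<pi> B\<close> as \<open>g'\<close>.\<close>
  define g2 where "g2 = Add E (\<iota> B \<star> e) g'"
  have g2: "g2 \<in> Arr E" "Dom E g2 = Cod E (\<iota> A)" "Cod E g2 = Cod E (\<iota> B)"
    using e AB m' by (auto simp: g2_def)
  have "g2 \<star> \<iota> A = Add E (\<iota> B \<star> n) (\<iota> B \<star> f')"
    using e(1-3) AB m' by (simp add: g2_def e(4) m'(8))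
  also have "\<dots> = \<iota> B \<star> f" unfolding n(7) using n(1,2,4-6) AB m'(1) by simp
  finally have gg2: "g \<star> \<iota> A = g2 \<star> \<iota> A" using m(8) by simp
  have dc: "Dom E g2 = Cod E (\<iota> A)" "Cod E g2 = Cod E g" using g2 m by auto
  obtain k where k: "k \<in> Arr E" "Dom E k = Cod E (\<pi> A)" "Cod E k = Cod E g" "g = Add E (k \<star> \<pi> A) g2"
    by (rule cokernel_diff[OF c(2) m(2) g2(1) m(3) dc gg2])
  note k = k(1,2) k(3)[unfolded m(4)] k(4)
  have pg2: "\<pi> B \<star> g2 = \<pi> B \<star> g'"
  proof -
    have "\<pi> B \<star> g2 = Add E ((\<pi> B \<star> \<iota> B) \<star> e) (\<pi> B \<star> g')"
      unfolding g2_def using e(1-3) AB m' by (simp flip: assoc)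
    then show ?thesis using e(1-3) AB m' by simp
  qed
  have "h \<star> \<pi> A = \<pi> B \<star> g" using m(9) by simp
  also have "\<dots> = Add E (\<pi> B \<star> k \<star> \<pi> A) (\<pi> B \<star> g2)" unfolding k(4) using k(1-3) g2 AB by simp
  also have "\<dots> = Add E ((\<pi> B \<star> k) \<star> \<pi> A) (h' \<star> \<pi> A)" unfolding pg2 m'(9)[symmetric]
    using k(1-3) AB by simp
  also have "\<dots> = Add E (\<pi> B \<star> k) h' \<star> \<pi> A" using k(1-3) m' AB by (intro comp_add(2)[symmetric]) auto
  finally have "h = Add E (\<pi> B \<star> k) h'"
    by (rule cokernel_epi[OF c(2), rotated -1]) (use k(1-3) m m' AB in auto)
  moreover have "null (\<pi> B \<star> k)" by (rule nullI[OF hull(3)[OF AB(2)]]) (use k(1-3) AB in auto)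
  ultimately show ?thesis using k(1-3) m' AB by (intro stably_equalI[of "\<pi> B \<star> k"]) auto
qed

lemma stable_shift_arr_cls:
  assumes fgh: "hull_map f g h"
  shows "stable_shift_arr E \<iota> \<pi> (cls f) = cls h"
proof -
  have f: "f \<in> Arr E" and h: "h \<in> Arr E" using hull_mapD[OF fgh] by auto
  have eq: "cls h' = cls h" if "f' \<in> cls f" "hull_map f' g' h'" for f' g' h'
    using hull_map_stably_unique[OF fgh that(2)] that(1) h by (simp add: in_stable_class_iff stable_class_eq_iff[symmetric])
  have "stable_shift_arr E \<iota> \<pi> (cls f) = \<Union>{cls h' | f' g' h'. f' \<in> cls f \<and> hull_map f' g' h'}"
  proof -
    have "f' \<in> Arr E" if "f' \<in> cls f"
      for f' using that by (simp add: in_stable_class_iff stably_equal_def)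
    then show ?thesis unfolding stable_shift_arr_def hull_map_def by (intro arg_cong[of _ _ Union]) blast
  qed
  also have "{cls h' | f' g' h'. f' \<in> cls f \<and> hull_map f' g' h'} = {cls h}"
  proof -
    have "f \<in> cls f" using stably_equal_refl[OF f] by (simp add: in_stable_class_iff)
    then show ?thesis using eq fgh by blast
  qed
  finally show ?thesis by simp
qed

lemma hull_map_ident:
  assumes "A \<in> Ob E"
  shows "hull_map (Ident E A) (Ident E (Cod E (\<iota> A))) (Ident E (Cod E (\<pi> A)))"
  by (rule hull_mapI[of _ A A]) (use assms in auto)

lemma hull_map_comp:
  assumes m: "hull_map f g h" and m': "hull_map f' g' h'" and d: "Dom E f' = Cod E f"
  shows "hull_map (f' \<star> f) (g' \<star> g) (h' \<star> h)"
proof -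
  note m = hull_mapD[OF m] and m' = hull_mapD[OF m', unfolded d]
  let ?A = "Dom E f" and ?B = "Cod E f" and ?D = "Cod E f'"
  have ob: "?A \<in> Ob E" "?B \<in> Ob E" "?D \<in> Ob E" using m m' by auto
  show ?thesis
  proof (rule hull_mapI[of _ ?A ?D])
    have "(g' \<star> g) \<star> \<iota> ?A = g' \<star> (\<iota> ?B \<star> f)" unfolding m(8)[symmetric] using m m' ob by simp
    also have "\<dots> = (g' \<star> \<iota> ?B) \<star> f" using m m' ob by (intro assoc[symmetric]) auto
    also have "\<dots> = \<iota> ?D \<star> f' \<star> f" unfolding m'(8) using m m' ob d by simp
    finally show "(g' \<star> g) \<star> \<iota> ?A = \<iota> ?D \<star> f' \<star> f" .
    have "(h' \<star> h) \<star> \<pi> ?A = h' \<star> (\<pi> ?B \<star> g)" unfolding m(9)[symmetric] using m m' ob by simp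
    also have "\<dots> = (h' \<star> \<pi> ?B) \<star> g" using m m' ob by (intro assoc[symmetric]) auto
    also have "\<dots> = \<pi> ?D \<star> g' \<star> g" unfolding m'(9) using m m' ob by simp
    finally show "(h' \<star> h) \<star> \<pi> ?A = \<pi> ?D \<star> g' \<star> g" .
  qed (use m m' d in auto)
qed

text \<open>
  If \<open>h\<close> is null, it lifts to \<open>c : A[1] \<rightarrow> I(B)\<close>. Correcting \<open>g\<close> by \<open>c \<star> \<pi> A\<close> makes it factor through
  \<open>\<iota> B\<close>, which extends \<open>f\<close> to \<open>I(A)\<close>. The converse is well-definedness of the shift at the zero class.
\<close>

lemma hull_map_null_iff:
  assumes m: "hull_map f g h"
  shows "null h \<longleftrightarrow> null f"
proof
  note m = hull_mapD[OF m]
  let ?A = "Dom E f" and ?B = "Cod E f"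
  have AB: "?A \<in> Ob E" "?B \<in> Ob E" using m by auto
  note c = conflD[OF hull(1)[OF AB(1)]] and d = conflD[OF hull(1)[OF AB(2)]]
  assume nh: "null h"
  obtain c where c: "c \<in> Arr E" "Cod E c = Dom E (\<pi> ?B)" "Dom E c = Dom E h" "\<pi> ?B \<star> c = h"
    by (rule null_lift[OF nh d(8,4) m(7)[symmetric]])
  note c = c(1) c(2)[unfolded hull_arr(4)[OF AB(2)]] c(3)[unfolded m(6)] c(4)
  have "\<pi> ?B \<star> (c \<star> \<pi> ?A) = (\<pi> ?B \<star> c) \<star> \<pi> ?A" using c(1-3) AB by (intro assoc[symmetric]) auto
  also have "\<dots> = \<pi> ?B \<star> g" unfolding c(4) m(9) ..
  finally have pg: "\<pi> ?B \<star> g = \<pi> ?B \<star> (c \<star> \<pi> ?A)" by simp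
  have cp: "c \<star> \<pi> ?A \<in> Arr E" "Cod E g = Dom E (\<pi> ?B)" "Cod E (c \<star> \<pi> ?A) = Dom E (\<pi> ?B)"
    "Dom E (c \<star> \<pi> ?A) = Dom E g"
    using c(1-3) m AB by auto
  obtain e where e: "e \<in> Arr E" "Dom E e = Dom E g" "Cod E e = Dom E (\<iota> ?B)"
    "g = Add E (\<iota> ?B \<star> e) (c \<star> \<pi> ?A)"
    by (rule kernel_diff[OF d(1) m(2) cp pg])
  note e = e(1) e(2)[unfolded m(3)] e(3)[unfolded hull_arr(3)[OF AB(2)]] e(4)
  have "\<iota> ?B \<star> f = g \<star> \<iota> ?A" using m(8) by simp
  also have "\<dots> = \<iota> ?B \<star> e \<star> \<iota> ?A" unfolding e(4) using e(1-3) c(1-3) AB by simp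
  finally have "f = e \<star> \<iota> ?A"
    by (rule kernel_mono[OF d(1), rotated -1]) (use e(1-3) m AB in auto)
  moreover have "null (e \<star> \<iota> ?A)" by (rule nullI[OF hull(3)[OF AB(1)]]) (use e(1-3) AB in auto)
  ultimately show "null f" by simp
next
  note hm = hull_mapD[OF m]
  let ?A = "Dom E f" and ?B = "Cod E f"
  have AB: "?A \<in> Ob E" "?B \<in> Ob E" using hm by auto
  assume "null f"
  then have s: "stably_equal E f (Zero E ?A ?B)"
    using hm AB by (intro stably_equalI[of f]) auto
  have z: "hull_map (Zero E ?A ?B) (Zero E (Cod E (\<iota> ?A)) (Cod E (\<iota> ?B))) (Zero E (Cod E (\<pi> ?A)) (Cod E (\<pi> ?B)))"
    by (rule hull_mapI[of _ ?A ?B]) (use AB in auto)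
  have "stably_equal E h (Zero E (Cod E (\<pi> ?A)) (Cod E (\<pi> ?B)))"
    by (rule hull_map_stably_unique[OF m z s])
  then show "null h" unfolding stable_class_eq_iff[OF hm(5), symmetric] cls_zero_iff[OF hm(5-7)] .
qed

lemma hull_map_full:
  assumes AB: "A \<in> Ob E" "B \<in> Ob E"
    and h: "h \<in> Arr E" "Dom E h = Cod E (\<pi> A)" "Cod E h = Cod E (\<pi> B)"
  obtains f g where "hull_map f g h" "Dom E f = A" "Cod E f = B"
proof -
  note c = conflD[OF hull(1)[OF AB(1)]] and d = conflD[OF hull(1)[OF AB(2)]]
  obtain g where g: "g \<in> Arr E" "Dom E g = Cod E (\<iota> A)" "Cod E g = Cod E (\<iota> B)" "\<pi> B \<star> g = h \<star> \<pi> A"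
    using projective_lift[OF hull(3)[OF AB(1)] d(8), of "h \<star> \<pi> A"] h AB by auto
  have "\<pi> B \<star> (g \<star> \<iota> A) = (\<pi> B \<star> g) \<star> \<iota> A" using g AB by (intro assoc[symmetric]) auto
  also have "\<dots> = Zero E A (Cod E (\<pi> B))" unfolding g(4) using h AB by simp
  finally have z: "\<pi> B \<star> (g \<star> \<iota> A) = Zero E A (Cod E (\<pi> B))" .
  have gi: "g \<star> \<iota> A \<in> Arr E" "Cod E (g \<star> \<iota> A) = Dom E (\<pi> B)" "Dom E (g \<star> \<iota> A) = A"
    using g AB by auto
  obtain f where f: "f \<in> Arr E" "Dom E f = A" "Cod E f = Dom E (\<iota> B)" "g \<star> \<iota> A = \<iota> B \<star> f"
    using z by (rule kernel_lift[OF d(1) gi(1,2), unfolded gi(3)])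
  note f = f[unfolded hull_arr(3)[OF AB(2)]]
  have "hull_map f g h"
    by (rule hull_mapI[OF f(1-3) g(1-3) h f(4) g(4)[symmetric]])
  then show ?thesis using f(2,3) by (rule that)
qed

text \<open>
  On the common subobject \<open>b \<star> a\<close> is the identity, so \<open>b \<star> a - 1\<close> factors through \<open>q\<close>, and on the
  quotients \<open>\<beta> \<star> \<alpha> - 1\<close> factors through the injective middle object.
\<close>

lemma cosyzygy_retract:
  assumes c: "(m, q) \<in> Confl E" "(m', q') \<in> Confl E" "injective E (Cod E m)"
    and ab: "a \<in> Arr E" "Dom E a = Cod E m" "Cod E a = Cod E m'" "a \<star> m = m'"
      "b \<in> Arr E" "Dom E b = Cod E m'" "Cod E b = Cod E m" "b \<star> m' = m"
    and \<alpha>\<beta>: "\<alpha> \<in> Arr E" "Dom E \<alpha> = Cod E q" "Cod E \<alpha> = Cod E q'" "\<alpha> \<star> q = q' \<star> a"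
      "\<beta> \<in> Arr E" "Dom E \<beta> = Cod E q'" "Cod E \<beta> = Cod E q" "\<beta> \<star> q' = q \<star> b"
  shows "stably_equal E (\<beta> \<star> \<alpha>) (Ident E (Cod E q))"
proof -
  note mq = conflD[OF c(1)] and mq' = conflD[OF c(2)]
  have bam: "(b \<star> a) \<star> m = Ident E (Cod E m) \<star> m" using ab mq by simp
  have ba: "b \<star> a \<in> Arr E" "Ident E (Cod E m) \<in> Arr E" "Dom E (b \<star> a) = Cod E m"
    "Dom E (Ident E (Cod E m)) = Cod E m"
    "Cod E (Ident E (Cod E m)) = Cod E (b \<star> a)" "Cod E (b \<star> a) = Cod E m"
    using ab mq by auto
  obtain e where e: "e \<in> Arr E" "Dom E e = Cod E q" "Cod E e = Cod E (b \<star> a)"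
    "b \<star> a = Add E (e \<star> q) (Ident E (Cod E m))"
    by (rule cokernel_diff[OF mq(2) ba(1-5) bam])
  note e = e(1,2) e(3)[unfolded ba(6)] e(4)
  have "(\<beta> \<star> \<alpha>) \<star> q = \<beta> \<star> (q' \<star> a)" unfolding \<alpha>\<beta>(4)[symmetric] using \<alpha>\<beta>(1-3,5-7) mq by simp
  also have "\<dots> = (\<beta> \<star> q') \<star> a" using \<alpha>\<beta>(1-3,5-7) mq mq' ab(1-3) by (intro assoc[symmetric]) auto
  also have "\<dots> = q \<star> (b \<star> a)" unfolding \<alpha>\<beta>(8) using ab(1-3,5-7) mq by simp
  also have "\<dots> = Add E (q \<star> e) (Ident E (Cod E q)) \<star> q" unfolding e(4) using e(1-3) mq by simp
  finally have "\<beta> \<star> \<alpha> = Add E (q \<star> e) (Ident E (Cod E q))"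
    by (rule cokernel_epi[OF mq(2), rotated -1]) (use e(1-3) \<alpha>\<beta>(1-3,5-7) mq in auto)
  moreover have "null (q \<star> e)"
    by (rule nullI[of "Cod E m"]) (use c(3) e(1-3) mq in \<open>auto simp: projective_iff_injective\<close>)
  ultimately show ?thesis using e(1-3) mq by (intro stably_equalI[of "q \<star> e"]) auto
qed

text \<open>
  The shift does not depend, up to isomorphism, on the injective object used to compute it.
\<close>

lemma cosyzygy_isomorphic:
  assumes c: "(m, q) \<in> Confl E" "(m', q') \<in> Confl E" and d: "Dom E m' = Dom E m"
    and inj: "injective E (Cod E m)" "injective E (Cod E m')"
  shows "isomorphic T (Cod E q) (Cod E q')"
proof -
  note mq = conflD[OF c(1)] and mq' = conflD[OF c(2)]
  have ex: "\<exists>a \<alpha>. a \<in> Arr E \<and> Dom E a = Cod E m \<and> Cod E a = Cod E m' \<and> a \<star> m = m' \<and>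
      \<alpha> \<in> Arr E \<and> Dom E \<alpha> = Cod E q \<and> Cod E \<alpha> = Cod E q' \<and> \<alpha> \<star> q = q' \<star> a"
    if mq: "(m, q) \<in> Confl E" and mq': "(m', q') \<in> Confl E" and d: "Dom E m' = Dom E m"
      and inj: "injective E (Cod E m')" for m q m' q'
  proof -
    note mq = conflD[OF mq] and mq' = conflD[OF mq']
    obtain a where a: "a \<in> Arr E" "Dom E a = Cod E m" "Cod E a = Cod E m'" "a \<star> m = m'"
      using injective_extend[OF inj mq(7), of m'] mq' d by auto
    have z: "(q' \<star> a) \<star> m = Zero E (Dom E m) (Cod E q')" using a mq mq' d by simp
    have qa: "q' \<star> a \<in> Arr E" "Dom E (q' \<star> a) = Cod E m" "Cod E (q' \<star> a) = Cod E q'"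
      using a mq' by auto
    obtain \<alpha> where "\<alpha> \<in> Arr E" "Dom E \<alpha> = Cod E q" "Cod E \<alpha> = Cod E q'" "q' \<star> a = \<alpha> \<star> q"
      using z by (rule cokernel_lift[OF mq(2) qa(1,2), unfolded qa(3)])
    with a show ?thesis by metis
  qed
  obtain a \<alpha> where a: "a \<in> Arr E" "Dom E a = Cod E m" "Cod E a = Cod E m'" "a \<star> m = m'"
      and \<alpha>: "\<alpha> \<in> Arr E" "Dom E \<alpha> = Cod E q" "Cod E \<alpha> = Cod E q'" "\<alpha> \<star> q = q' \<star> a"
    using ex[OF c(1,2) d inj(2)] by blast
  obtain b \<beta> where b: "b \<in> Arr E" "Dom E b = Cod E m'" "Cod E b = Cod E m" "b \<star> m' = m"
      and \<beta>: "\<beta> \<in> Arr E" "Dom E \<beta> = Cod E q'" "Cod E \<beta> = Cod E q" "\<beta> \<star> q' = q \<star> b"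
    using ex[OF c(2,1) d[symmetric] inj(1)] by blast
  have 1: "stably_equal E (\<beta> \<star> \<alpha>) (Ident E (Cod E q))"
    by (rule cosyzygy_retract[OF c inj(1) a b \<alpha> \<beta>])
  have 2: "stably_equal E (\<alpha> \<star> \<beta>) (Ident E (Cod E q'))"
    by (rule cosyzygy_retract[OF c(2,1) inj(2) b a \<beta> \<alpha>])
  show ?thesis
    by (rule stable.isomorphicI[of "cls \<alpha>" _ _ "cls \<beta>"])
      (use \<alpha>(1-3) \<beta>(1-3) 1 2 in \<open>auto simp: stable_class_eq_iff\<close>)
qed

text \<open>
  The kernel of a deflation from a projective object onto \<open>Y\<close> serves as \<open>Y[-1]\<close>, because its middle
  object is also injective.
\<close>

lemma shift_essentially_surjective:
  assumes Y: "Y \<in> Ob E"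
  shows "\<exists>B\<in>Ob E. isomorphic T (stable_shift E \<pi> B) Y"
proof -
  obtain q where q: "deflation E q" "projective E (Dom E q)" "Cod E q = Y"
    using enough_projectives[OF Y] by blast
  then obtain m where m: "(m, q) \<in> Confl E" by (auto simp: deflation_def)
  note mq = conflD[OF m]
  have B: "Dom E m \<in> Ob E" using mq by simp
  have "isomorphic T (Cod E (\<pi> (Dom E m))) (Cod E q)"
    by (rule cosyzygy_isomorphic[OF hull(1)[OF B] m])
      (use hull(2)[OF B] B q mq in \<open>auto simp flip: projective_iff_injective\<close>)
  then show ?thesis using B q by (auto simp: stable_shift_def)
qed

section \<open>Exactness of standard triangles\<close>

lemma pushoutD:
  assumes "is_pushout E i f v t"
  shows "i \<in> Arr E" "f \<in> Arr E" "v \<in> Arr E" "t \<in> Arr E" "Dom E f = Dom E i" "Dom E t = Cod E i"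
    "Dom E v = Cod E f" "Cod E t = Cod E v" "t \<star> i = v \<star> f"
  using assms by (auto simp: is_pushout_def)

lemma pushout_ex1:
  assumes "is_pushout E i f v t" "x \<in> Arr E" "y \<in> Arr E" "Dom E x = Cod E i" "Dom E y = Cod E f"
    "Cod E x = Z" "Cod E y = Z" "x \<star> i = y \<star> f"
  shows "\<exists>!h. h \<in> Hom E (Cod E v) Z \<and> h \<star> t = x \<and> h \<star> v = y"
proof -
  have "Z \<in> Ob E" "x \<in> Hom E (Cod E i) Z" "y \<in> Hom E (Cod E f) Z" using assms by (auto simp: Hom_def)
  then show ?thesis using assms(1,8) unfolding is_pushout_def by blast
qed

lemma pushout_lift:
  assumes "is_pushout E i f v t" "x \<in> Arr E" "y \<in> Arr E" "Dom E x = Cod E i" "Dom E y = Cod E f"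
    "Cod E x = Z" "Cod E y = Z" "x \<star> i = y \<star> f"
  obtains h where "h \<in> Arr E" "Dom E h = Cod E v" "Cod E h = Z" "h \<star> t = x" "h \<star> v = y"
proof -
  obtain h where "h \<in> Hom E (Cod E v) Z" "h \<star> t = x" "h \<star> v = y"
    using pushout_ex1[OF assms] by blast
  then show ?thesis using that unfolding Hom_def by blast
qed

lemma pushout_eq:
  assumes p: "is_pushout E i f v t" and h: "h \<in> Arr E" "Dom E h = Cod E v"
    and h': "h' \<in> Arr E" "Dom E h' = Cod E v" "Cod E h' = Cod E h"
    and eq: "h \<star> t = h' \<star> t" "h \<star> v = h' \<star> v"
  shows "h = h'"
proof -
  note p' = pushoutD[OF p]
  have "(h \<star> t) \<star> i = (h \<star> v) \<star> f" using p' h by simp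
  then have "\<exists>!k. k \<in> Hom E (Cod E v) (Cod E h) \<and> k \<star> t = h \<star> t \<and> k \<star> v = h \<star> v"
    using p' h by (intro pushout_ex1[OF p]) auto
  moreover have "h \<in> Hom E (Cod E v) (Cod E h)" "h' \<in> Hom E (Cod E v) (Cod E h)"
    using h h' by (auto simp: Hom_def)
  ultimately show ?thesis using eq by metis
qed

lemma pushout_cokernel:
  assumes c: "(i, q) \<in> Confl E" and p: "is_pushout E i f v t"
    and w: "w \<in> Arr E" "Dom E w = Cod E v" "Cod E w = Cod E q"
      "w \<star> v = Zero E (Cod E f) (Cod E q)" "w \<star> t = q"
  shows "is_cokernel E w v"
proof -
  note p' = pushoutD[OF p] and c' = conflD[OF c]
  have "\<exists>!u. u \<in> Hom E (Cod E w) (Cod E h) \<and> u \<star> w = h"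
    if h: "h \<in> Arr E" "Dom E h = Cod E v" "h \<star> v = Zero E (Dom E v) (Cod E h)" for h
  proof -
    have "(h \<star> t) \<star> i = (h \<star> v) \<star> f" using p' h(1,2) by simp
    also have "\<dots> = Zero E (Dom E i) (Cod E h)" unfolding h(3) using p' h(1,2) by simp
    finally have z: "(h \<star> t) \<star> i = Zero E (Dom E i) (Cod E h)" .
    have ht: "h \<star> t \<in> Arr E" "Dom E (h \<star> t) = Cod E i" "Cod E (h \<star> t) = Cod E h"
      using p' h(1,2) by auto
    obtain u where u: "u \<in> Arr E" "Dom E u = Cod E q" "Cod E u = Cod E h" "h \<star> t = u \<star> q"
      using z by (rule cokernel_lift[OF c'(2) ht(1,2), unfolded ht(3)])
    show ?thesis
    proof (rule ex1I[of _ u])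
      have "u \<star> w = h"
      proof (rule pushout_eq[OF p])
        show "(u \<star> w) \<star> t = h \<star> t" unfolding u(4) using u(1-3) w(1-3,5) p' by simp
        have "(u \<star> w) \<star> v = Zero E (Cod E f) (Cod E h)" using u(1-3) w p' c' by simp
        then show "(u \<star> w) \<star> v = h \<star> v" unfolding h(3) using p' by simp
      qed (use u(1-3) w(1-3) p' h(1,2) in auto)
      then show "u \<in> Hom E (Cod E w) (Cod E h) \<and> u \<star> w = h" using u(1-3) w by (auto simp: Hom_def)
    next
      fix u' assume "u' \<in> Hom E (Cod E w) (Cod E h) \<and> u' \<star> w = h"
      then have u': "u' \<in> Arr E" "Dom E u' = Cod E q" "Cod E u' = Cod E h" "u' \<star> w = h"
        using w by (auto simp: Hom_def)
      have "u' \<star> q = (u' \<star> w) \<star> t" using u'(1-3) w(1-3,5) p' by simp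
      also have "\<dots> = u \<star> q" unfolding u'(4) u(4) ..
      finally show "u' = u"
        by (rule cokernel_epi[OF c'(2), rotated -1]) (use u(1-3) u'(1-3) in auto)
    qed
  qed
  then show ?thesis unfolding is_cokernel_def using p' w by auto
qed

text \<open>
  Some pushout of an inflation is an inflation, so it is part of a conflation; any other pushout,
  together with its cokernel \<open>w\<close>, gives an isomorphic pair of arrows.
\<close>

lemma pushout_confl:
  assumes c: "(i, q) \<in> Confl E" and p: "is_pushout E i f v t"
    and w: "w \<in> Arr E" "Dom E w = Cod E v" "Cod E w = Cod E q"
      "w \<star> v = Zero E (Cod E f) (Cod E q)" "w \<star> t = q"
  shows "(v, w) \<in> Confl E"
proof -
  note p' = pushoutD[OF p] and c' = conflD[OF c]
  have cok: "is_cokernel E w v" by (rule pushout_cokernel[OF c p w])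
  obtain v' t' where pv: "is_pushout E i f v' t'" and inf: "inflation E v'"
    using inflation_pushout[OF c'(7) p'(2,5)] by blast
  note pv' = pushoutD[OF pv]
  obtain q' where vq: "(v', q') \<in> Confl E" using inf by (auto simp: inflation_def)
  note vq' = conflD[OF vq]
  obtain b where b: "b \<in> Arr E" "Dom E b = Cod E v'" "Cod E b = Cod E v" "b \<star> t' = t" "b \<star> v' = v"
    by (rule pushout_lift[OF pv p'(4,3) p'(6,7,8) refl p'(9)])
  obtain b' where b': "b' \<in> Arr E" "Dom E b' = Cod E v" "Cod E b' = Cod E v'" "b' \<star> t = t'"
    "b' \<star> v = v'"
    by (rule pushout_lift[OF p pv'(4,3) pv'(6,7,8) refl pv'(9)])
  have b'b: "b' \<star> b = Ident E (Cod E v')"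
    by (rule pushout_eq[OF pv]) (use b b' pv' in auto)
  have bb': "b \<star> b' = Ident E (Cod E v)"
    by (rule pushout_eq[OF p]) (use b b' p' in auto)
  have isob: "iso_arr E b" by (rule iso_arrI[of b b']) (use b b' b'b bb' in auto)
  have wb: "w \<star> b \<in> Arr E" "Dom E (w \<star> b) = Cod E v'" "Cod E (w \<star> b) = Cod E q" using w b by auto
  have "(w \<star> b) \<star> v' = w \<star> v" using w(1-3) b pv' by simp
  also have "\<dots> = Zero E (Dom E v') (Cod E q)" unfolding w(4) using pv' by simp
  finally have z: "(w \<star> b) \<star> v' = Zero E (Dom E v') (Cod E q)" .
  obtain k where k: "k \<in> Arr E" "Dom E k = Cod E q'" "Cod E k = Cod E q" "w \<star> b = k \<star> q'"
    using z by (rule cokernel_lift[OF vq'(2) wb(1,2), unfolded wb(3)])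
  have qb: "q' \<star> b' \<in> Arr E" "Dom E (q' \<star> b') = Cod E v" "Cod E (q' \<star> b') = Cod E q'"
    using vq' b' by auto
  have z': "(q' \<star> b') \<star> v = Zero E (Dom E v) (Cod E q')" using vq' b' p' pv' by simp
  obtain k' where k': "k' \<in> Arr E" "Dom E k' = Cod E w" "Cod E k' = Cod E q'" "q' \<star> b' = k' \<star> w"
    using z' by (rule cokernel_lift[OF cok qb(1,2), unfolded qb(3)])
  have "(k \<star> k') \<star> w = k \<star> (q' \<star> b')" unfolding k'(4) using k(1-3) k'(1-3) vq' w(1-3) by simp
  also have "\<dots> = (k \<star> q') \<star> b'" using k(1-3) vq' b'(1-3) by (intro assoc[symmetric]) auto
  also have "\<dots> = Ident E (Cod E w) \<star> w"
    unfolding k(4)[symmetric] using w(1-3) b(1-3) b'(1-3) bb' by simp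
  finally have kk': "k \<star> k' = Ident E (Cod E w)"
    by (rule cokernel_epi[OF cok, rotated -1]) (use k(1-3) k'(1-3) w c' in auto)
  have "(k' \<star> k) \<star> q' = k' \<star> (w \<star> b)" unfolding k(4) using k(1-3) k'(1-3) vq' w(1-3) by simp
  also have "\<dots> = (k' \<star> w) \<star> b" using k'(1-3) w(1-3) b(1-3) by (intro assoc[symmetric]) auto
  also have "\<dots> = Ident E (Cod E q') \<star> q'"
    unfolding k'(4)[symmetric] using vq' b(1-3) b'(1-3) b'b by simp
  finally have k'k: "k' \<star> k = Ident E (Cod E q')"
    by (rule cokernel_epi[OF vq'(2), rotated -1]) (use k(1-3) k'(1-3) vq' w in auto)
  have isok: "iso_arr E k" by (rule iso_arrI[of k k']) (use k(1-3) k'(1-3) kk' k'k w in auto)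
  have ob: "Dom E v' \<in> Ob E" using pv' by simp
  show ?thesis
  proof (rule confl_iso[OF vq iso_arr_ident[OF ob] isob isok])
    show "w \<star> b = k \<star> q'" by (rule k(4))
  qed (use ob b k(1-3) pv' p' w in \<open>auto simp: Hom_def\<close>)
qed

lemma standard_triangleE:
  assumes "standard_triangle E \<iota> \<pi> f v w"
  obtains t where "f \<in> Arr E" "is_pushout E (\<iota> (Dom E f)) f v t" "(v, w) \<in> Confl E"
    "w \<star> t = \<pi> (Dom E f)"
    "Cod E w = Cod E (\<pi> (Dom E f))" "v \<in> Arr E" "t \<in> Arr E" "w \<in> Arr E" "Dom E v = Cod E f"
      "Dom E w = Cod E v"
    "Dom E t = Cod E (\<iota> (Dom E f))" "Cod E t = Cod E v" "t \<star> \<iota> (Dom E f) = v \<star> f"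
proof -
  obtain t where p: "is_pushout E (\<iota> (Dom E f)) f v t"
    and "w \<in> Hom E (Cod E v) (stable_shift E \<pi> (Dom E f))"
    and wv: "w \<star> v = Zero E (Cod E f) (stable_shift E \<pi> (Dom E f))"
    and wt: "w \<star> t = \<pi> (Dom E f)"
    using assms unfolding standard_triangle_def by blast
  then have w: "w \<in> Arr E" "Dom E w = Cod E v" "Cod E w = Cod E (\<pi> (Dom E f))"
    by (auto simp: Hom_def stable_shift_def)
  note p' = pushoutD[OF p]
  have A: "Dom E f \<in> Ob E" using p' by simp
  have c: "(v, w) \<in> Confl E"
    by (rule pushout_confl[OF hull(1)[OF A] p w wv[unfolded stable_shift_def] wt])
  show ?thesis
    by (rule that[OF p'(2) p c wt w(3) p'(3,4) w(1) p'(7) w(2) p'(6,8,9)])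
qed

lemma standard_triangle_ex:
  assumes f: "f \<in> Arr E"
  shows "\<exists>v w. standard_triangle E \<iota> \<pi> f v w"
proof -
  let ?A = "Dom E f" and ?B = "Cod E f"
  have A: "?A \<in> Ob E" "?B \<in> Ob E" using f by auto
  obtain v t where p: "is_pushout E (\<iota> ?A) f v t"
    using inflation_pushout[OF conflD(7)[OF hull(1)[OF A(1)]] f] A by auto
  have z: "\<pi> ?A \<star> \<iota> ?A = Zero E ?B (Cod E (\<pi> ?A)) \<star> f" using f A by simp
  obtain w where w: "w \<in> Arr E" "Dom E w = Cod E v" "Cod E w = Cod E (\<pi> ?A)" "w \<star> t = \<pi> ?A"
      "w \<star> v = Zero E ?B (Cod E (\<pi> ?A))"
    by (rule pushout_lift[OF p _ _ _ _ _ _ z]) (use A in simp_all)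
  have "w \<in> Hom E (Cod E v) (stable_shift E \<pi> ?A)" using w(1-3) by (simp add: Hom_def stable_shift_def)
  then show ?thesis using p w(4,5) unfolding standard_triangle_def stable_shift_def by blast
qed

text \<open>
  Let \<open>v \<star> y = b \<star> a\<close> factor through a projective object. The arrow \<open>w \<star> b\<close> lifts along
  \<open>\<pi> A\<close> to an arrow \<open>c\<close> into \<open>I(A)\<close>, so that \<open>b\<close> differs from \<open>t \<star> c\<close> by an arrow \<open>v \<star> e\<close>. As \<open>w \<star> v\<close> vanishes,
  \<open>c \<star> a\<close> comes from an arrow \<open>x\<close> to \<open>A\<close>, and \<open>y\<close> equals \<open>f \<star> x\<close> up to the null arrow \<open>e \<star> a\<close>.
\<close>

lemma standard_weak_kernel1:
  assumes st: "standard_triangle E \<iota> \<pi> f v w"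
  shows "weak_kernel T (cls f) (cls v)"
proof -
  let ?A = "Dom E f"
  obtain t where st: "f \<in> Arr E" "is_pushout E (\<iota> ?A) f v t" "(v, w) \<in> Confl E" "w \<star> t = \<pi> ?A"
    "Cod E w = Cod E (\<pi> ?A)" "v \<in> Arr E" "t \<in> Arr E" "w \<in> Arr E" "Dom E v = Cod E f" "Dom E w = Cod E v"
    "Dom E t = Cod E (\<iota> ?A)" "Cod E t = Cod E v" "t \<star> \<iota> ?A = v \<star> f"
    using st by (rule standard_triangleE)
  note vw = conflD[OF st(3)]
  have A: "?A \<in> Ob E" using st by simp
  note hA = conflD[OF hull(1)[OF A]]
  show ?thesis
  proof (rule stable_weak_kernelI)
    show "f \<in> Arr E" "v \<in> Arr E" "Cod E f = Dom E v" using st by auto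
    show "null (v \<star> f)"
      unfolding st(13)[symmetric] by (rule nullI[OF hull(3)[OF A]]) (use st A in auto)
    fix y assume y: "y \<in> Arr E" "Cod E y = Dom E v" "null (v \<star> y)"
    have d: "Dom E (v \<star> y) = Dom E y" "Cod E (v \<star> y) = Cod E v" using y(1,2) st by auto
    obtain a b where ab: "a \<in> Arr E" "b \<in> Arr E" "projective E (Cod E a)" "Dom E b = Cod E a"
      "Dom E a = Dom E y" "Cod E b = Cod E v" "b \<star> a = v \<star> y"
      using y(3) by (rule null_factor) (use d in auto)
    have wb: "w \<star> b \<in> Arr E" "Cod E (w \<star> b) = Cod E (\<pi> ?A)" "Dom E (w \<star> b) = Cod E a"
      using ab st by auto
    obtain c where c: "c \<in> Arr E" "Dom E c = Cod E a" "Cod E c = Dom E (\<pi> ?A)" "\<pi> ?A \<star> c = w \<star> b"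
      by (rule projective_lift[OF ab(3) hA(8) wb])
    note c = c(1,2) c(3)[unfolded hull_arr(4)[OF A]] c(4)
    have "w \<star> (t \<star> c) = (w \<star> t) \<star> c" using c(1-3) st by (intro assoc[symmetric]) auto
    also have "\<dots> = w \<star> b" unfolding st(4) c(4) ..
    finally have wbtc: "w \<star> b = w \<star> (t \<star> c)" by simp
    have tc: "t \<star> c \<in> Arr E" "Cod E b = Dom E w" "Cod E (t \<star> c) = Dom E w" "Dom E (t \<star> c) = Dom E b"
      using c(1-3) st ab by auto
    obtain e where e: "e \<in> Arr E" "Dom E e = Dom E b" "Cod E e = Dom E v" "b = Add E (v \<star> e) (t \<star> c)"
      by (rule kernel_diff[OF vw(1) ab(2) tc wbtc])
    note e = e(1) e(2)[unfolded ab(4)] e(3,4)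
    have ca: "c \<star> a \<in> Arr E" "Cod E (c \<star> a) = Dom E (\<pi> ?A)" "Dom E (c \<star> a) = Dom E y"
      using c(1-3) ab A by auto
    have "\<pi> ?A \<star> (c \<star> a) = (\<pi> ?A \<star> c) \<star> a" using c(1-3) ab A by (intro assoc[symmetric]) auto
    also have "\<dots> = w \<star> (v \<star> y)" unfolding c(4) ab(7)[symmetric] using ab(1-6) st by simp
    also have "\<dots> = (w \<star> v) \<star> y" using y(1,2) st by (intro assoc[symmetric]) auto
    also have "\<dots> = Zero E (Dom E y) (Cod E (\<pi> ?A))" unfolding vw(6) using y(1,2) st A by simp
    finally have z: "\<pi> ?A \<star> (c \<star> a) = Zero E (Dom E y) (Cod E (\<pi> ?A))" .
    obtain x where x: "x \<in> Arr E" "Dom E x = Dom E y" "Cod E x = Dom E (\<iota> ?A)" "c \<star> a = \<iota> ?A \<star> x"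
      using z by (rule kernel_lift[OF hA(1) ca(1,2), unfolded ca(3)])
    note x = x(1,2) x(3)[unfolded hull_arr(3)[OF A]] x(4)
    have "v \<star> y = Add E (v \<star> e \<star> a) (t \<star> (c \<star> a))"
      unfolding ab(7)[symmetric] e(4) using e(1-3) c(1-3) ab(1-6) st by simp
    also have "t \<star> (c \<star> a) = (t \<star> \<iota> ?A) \<star> x"
      unfolding x(4) using x(1-3) st A by (intro assoc[symmetric]) auto
    also have "\<dots> = v \<star> (f \<star> x)" unfolding st(13) using x(1-3) st by simp
    also have "Add E (v \<star> e \<star> a) (v \<star> (f \<star> x)) = v \<star> Add E (e \<star> a) (f \<star> x)"
      using e(1-3) x(1-3) ab(1-6) st by (intro comp_add(1)[symmetric]) auto
    finally have yeq: "y = Add E (e \<star> a) (f \<star> x)"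
      by (rule kernel_mono[OF vw(1), rotated -1]) (use y(1,2) e(1-3) x(1-3) ab(1-6) st in auto)
    have "stably_equal E y (f \<star> x)"
    proof (rule stably_equalI[OF _ _ _ _ yeq])
      show "null (e \<star> a)" by (rule nullI[OF ab(3)]) (use e(1-3) ab(1-6) in auto)
    qed (use y(1,2) e(1-3) x(1-3) ab(1-6) st in auto)
    then show "\<exists>x. x \<in> Arr E \<and> Dom E x = Dom E y \<and> Cod E x = Dom E f \<and> stably_equal E y (f \<star> x)"
      using x(1-3) by blast
  qed
qed

text \<open>
  The square formed by \<open>w\<close>, \<open>h\<close>, \<open>s : D \<rightarrow> I(B)\<close> and \<open>\<pi> B\<close>, where \<open>h\<close> represents \<open>f[1]\<close>, is cartesian,
  since \<open>w\<close> and \<open>\<pi> B\<close> have the same kernel \<open>B\<close>. An arrow \<open>x\<close> with \<open>h \<star> x\<close> null comes with a lift \<open>c\<close> of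
  \<open>h \<star> x\<close> to \<open>I(B)\<close>, and the pair \<open>x\<close>, \<open>c\<close> has a factorization through \<open>D\<close>. That factorization is
  constructed on a projective cover of the domain of \<open>x\<close> and then seen to descend.
\<close>

lemma standard_weak_kernel3:
  assumes st: "standard_triangle E \<iota> \<pi> f v w"
  shows "weak_kernel T (cls w) (stable_shift_arr E \<iota> \<pi> (cls f))"
proof -
  let ?A = "Dom E f" and ?B = "Cod E f"
  obtain t where st: "f \<in> Arr E" "is_pushout E (\<iota> ?A) f v t" "(v, w) \<in> Confl E" "w \<star> t = \<pi> ?A"
    "Cod E w = Cod E (\<pi> ?A)" "v \<in> Arr E" "t \<in> Arr E" "w \<in> Arr E" "Dom E v = Cod E f" "Dom E w = Cod E v"
    "Dom E t = Cod E (\<iota> ?A)" "Cod E t = Cod E v" "t \<star> \<iota> ?A = v \<star> f"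
    using st by (rule standard_triangleE)
  note vw = conflD[OF st(3)]
  obtain g h where fgh: "hull_map f g h" using st(1) by (rule hull_map_ex)
  note m = hull_mapD[OF fgh]
  have AB: "?A \<in> Ob E" "?B \<in> Ob E" using st by auto
  note hB = conflD[OF hull(1)[OF AB(2)]]
  obtain s where s: "s \<in> Arr E" "Dom E s = Cod E v" "Cod E s = Cod E (\<iota> ?B)" "s \<star> t = g" "s \<star> v = \<iota> ?B"
    by (rule pushout_lift[OF st(2) m(2) hB(3) m(3) _ m(4) refl m(8)]) (use AB in auto)
  have hw: "h \<star> w = \<pi> ?B \<star> s"
  proof (rule pushout_eq[OF st(2)])
    have "(h \<star> w) \<star> t = h \<star> \<pi> ?A" using m st by simp
    also have "\<dots> = (\<pi> ?B \<star> s) \<star> t" unfolding m(9) using s st AB by simp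
    finally show "(h \<star> w) \<star> t = (\<pi> ?B \<star> s) \<star> t" .
    have "(h \<star> w) \<star> v = Zero E ?B (Cod E (\<pi> ?B))" using m st vw by simp
    also have "\<dots> = (\<pi> ?B \<star> s) \<star> v" using s st AB by simp
    finally show "(h \<star> w) \<star> v = (\<pi> ?B \<star> s) \<star> v" .
  qed (use m st s AB in auto)
  have "weak_kernel T (cls w) (cls h)"
  proof (rule stable_weak_kernelI)
    show "w \<in> Arr E" "h \<in> Arr E" "Cod E w = Dom E h" using st m by auto
    show "null (h \<star> w)"
      unfolding hw by (rule nullI[OF hull(3)[OF AB(2)]]) (use s AB in auto)
    fix x assume x: "x \<in> Arr E" "Cod E x = Dom E h" "null (h \<star> x)"
    have d: "Dom E (h \<star> x) = Dom E x" "Cod E (\<pi> ?B) = Cod E (h \<star> x)" using x(1,2) m by auto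
    obtain c where c: "c \<in> Arr E" "Cod E c = Dom E (\<pi> ?B)" "Dom E c = Dom E (h \<star> x)" "\<pi> ?B \<star> c = h \<star> x"
      by (rule null_lift[OF x(3) hB(8,4) d(2)])
    note c = c(1) c(2)[unfolded hull_arr(4)[OF AB(2)]] c(3)[unfolded d(1)] c(4)
    have "Dom E x \<in> Ob E" using x by simp
    then obtain q where q: "deflation E q" "projective E (Dom E q)" "Cod E q = Dom E x"
      using enough_projectives by blast
    obtain n where nq: "(n, q) \<in> Confl E" using q(1) by (auto simp: deflation_def)
    note nq' = conflD[OF nq]
    have xq: "x \<star> q \<in> Arr E" "Cod E (x \<star> q) = Cod E w" "Dom E (x \<star> q) = Dom E q"
      using x(1,2) q(3) nq' st m by auto
    obtain d where d: "d \<in> Arr E" "Dom E d = Dom E q" "Cod E d = Dom E w" "w \<star> d = x \<star> q"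
      by (rule projective_lift[OF q(2) vw(8) xq])
    have "\<pi> ?B \<star> (c \<star> q) = (\<pi> ?B \<star> c) \<star> q" using c(1-3) nq' q(3) AB by (intro assoc[symmetric]) auto
    also have "\<dots> = h \<star> (x \<star> q)" unfolding c(4) using x(1,2) nq' q(3) m by simp
    also have "\<dots> = (h \<star> w) \<star> d" unfolding d(4)[symmetric]
      using d(1-3) st m by (intro assoc[symmetric]) auto
    also have "\<dots> = \<pi> ?B \<star> (s \<star> d)" unfolding hw using s(1-3) d(1-3) st AB by simp
    finally have eq: "\<pi> ?B \<star> (c \<star> q) = \<pi> ?B \<star> (s \<star> d)" .
    have cq: "c \<star> q \<in> Arr E" "s \<star> d \<in> Arr E" "Cod E (c \<star> q) = Dom E (\<pi> ?B)"
      "Cod E (s \<star> d) = Dom E (\<pi> ?B)"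
      "Dom E (s \<star> d) = Dom E (c \<star> q)" "Dom E (c \<star> q) = Dom E q"
      using c(1-3) nq' q(3) s(1-3) d(1-3) st AB by auto
    obtain e where e: "e \<in> Arr E" "Dom E e = Dom E (c \<star> q)" "Cod E e = Dom E (\<iota> ?B)"
        "c \<star> q = Add E (\<iota> ?B \<star> e) (s \<star> d)"
      by (rule kernel_diff[OF hB(1) cq(1-5) eq])
    note e = e(1) e(2)[unfolded cq(6)] e(3)[unfolded hull_arr(3)[OF AB(2)]] e(4)
    \<comment> \<open>\<open>d\<close> lifts \<open>x \<star> q\<close> to \<open>D\<close>; adding \<open>v \<star> e\<close> leaves \<open>w \<star> d\<close> unchanged and adjusts \<open>s \<star> d\<close> to \<open>c \<star> q\<close>.\<close>
    define d' where "d' = Add E (v \<star> e) d"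
    have d': "d' \<in> Arr E" "Dom E d' = Dom E q" "Cod E d' = Dom E w"
      using e(1-3) d(1-3) st by (auto simp: d'_def)
    have sd': "s \<star> d' = c \<star> q"
    proof -
      have "s \<star> d' = Add E ((s \<star> v) \<star> e) (s \<star> d)"
        unfolding d'_def using e(1-3) d(1-3) s(1-3) st by (simp flip: assoc)
      then show ?thesis unfolding s(5) e(4) .
    qed
    have wd': "w \<star> d' = x \<star> q"
    proof -
      have "w \<star> d' = Add E ((w \<star> v) \<star> e) (w \<star> d)"
        unfolding d'_def using e(1-3) d(1-3) st by (simp flip: assoc)
      also have "(w \<star> v) \<star> e = Zero E (Dom E q) (Cod E w)" unfolding vw(6) using e(1-3) st by simp
      finally show ?thesis unfolding d(4) using xq by simp
    qed
    \<comment> \<open>\<open>d'\<close> vanishes on the kernel \<open>n\<close> of \<open>q\<close>: its composites with \<open>w\<close> and \<open>s\<close> do, and \<open>s\<close> is \<open>\<iota> B\<close> on \<open>B\<close>.\<close>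
    have "w \<star> (d' \<star> n) = (w \<star> d') \<star> n" using d' nq' st by (intro assoc[symmetric]) auto
    also have "\<dots> = Zero E (Dom E n) (Cod E w)" unfolding wd' using x(1,2) nq' q(3) m st by simp
    finally have z: "w \<star> (d' \<star> n) = Zero E (Dom E n) (Cod E w)" .
    have dn: "d' \<star> n \<in> Arr E" "Cod E (d' \<star> n) = Dom E w" "Dom E (d' \<star> n) = Dom E n"
      using d' nq' by auto
    obtain e' where e': "e' \<in> Arr E" "Dom E e' = Dom E n" "Cod E e' = Dom E v" "d' \<star> n = v \<star> e'"
      using z by (rule kernel_lift[OF vw(1) dn(1,2), unfolded dn(3)])
    have "\<iota> ?B \<star> e' = s \<star> (v \<star> e')" unfolding s(5)[symmetric] using s(1-3) e'(1-3) st by simp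
    also have "\<dots> = (s \<star> d') \<star> n" unfolding e'(4)[symmetric]
      using s(1-3) d' nq' st by (intro assoc[symmetric]) auto
    also have "\<dots> = \<iota> ?B \<star> Zero E (Dom E n) ?B" unfolding sd' using c(1-3) nq' q(3) AB x(1) by simp
    finally have e'0: "e' = Zero E (Dom E n) ?B"
      by (rule kernel_mono[OF hB(1), rotated -1]) (use e'(1-3) nq' AB st in auto)
    have z2: "d' \<star> n = Zero E (Dom E n) (Cod E d')" unfolding e'(4) e'0 using nq' d' st AB by simp
    have dd: "Dom E d' = Cod E n" using d' nq' by simp
    obtain y where y: "y \<in> Arr E" "Dom E y = Cod E q" "Cod E y = Cod E d'" "d' = y \<star> q"
      by (rule cokernel_lift[OF nq'(2) d'(1) dd z2])
    note y = y(1) y(2)[unfolded q(3)] y(3)[unfolded d'(3)] y(4)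
    have "(w \<star> y) \<star> q = w \<star> d'" unfolding y(4) using y(1-3) nq' q(3) st by simp
    then have "(w \<star> y) \<star> q = x \<star> q" unfolding wd' .
    then have wy: "w \<star> y = x"
      by (rule cokernel_epi[OF nq'(2), rotated -1]) (use y(1-3) x(1,2) q(3) st m in auto)
    have "stably_equal E x (w \<star> y)" unfolding wy by (rule stably_equal_refl[OF x(1)])
    then show "\<exists>y. y \<in> Arr E \<and> Dom E y = Dom E x \<and> Cod E y = Dom E w \<and> stably_equal E x (w \<star> y)"
      using y(1-3) by blast
  qed
  then show ?thesis unfolding stable_shift_arr_cls[OF fgh] .
qed

text \<open>
  If \<open>y \<star> f\<close> is null, it extends to \<open>I(A)\<close>, and the extension and \<open>y\<close> are the data for an arrow out
  of the pushout.
\<close>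

lemma standard_weak_cokernel1:
  assumes st: "standard_triangle E \<iota> \<pi> f v w"
  shows "weak_cokernel T (cls v) (cls f)"
proof (rule stable_weak_cokernelI)
  let ?A = "Dom E f"
  obtain t where st': "f \<in> Arr E" "is_pushout E (\<iota> ?A) f v t" "(v, w) \<in> Confl E" "w \<star> t = \<pi> ?A"
    "Cod E w = Cod E (\<pi> ?A)" "v \<in> Arr E" "t \<in> Arr E" "w \<in> Arr E" "Dom E v = Cod E f" "Dom E w = Cod E v"
    "Dom E t = Cod E (\<iota> ?A)" "Cod E t = Cod E v" "t \<star> \<iota> ?A = v \<star> f"
    using st by (rule standard_triangleE)
  have A: "?A \<in> Ob E" using st' by simp
  show "f \<in> Arr E" "v \<in> Arr E" "Cod E f = Dom E v" using st' by auto
  show "null (v \<star> f)"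
    unfolding st'(13)[symmetric] by (rule nullI[OF hull(3)[OF A]]) (use st' A in auto)
  fix y assume y: "y \<in> Arr E" "Dom E y = Cod E f" "null (y \<star> f)"
  have d: "Dom E (y \<star> f) = ?A" "Cod E (y \<star> f) = Cod E y" using y(1,2) st' by auto
  obtain g where g: "g \<in> Arr E" "Dom E g = Cod E (\<iota> ?A)" "Cod E g = Cod E (y \<star> f)" "g \<star> \<iota> ?A = y \<star> f"
    by (rule null_hull[OF y(3) d(1)])
  obtain x where x: "x \<in> Arr E" "Dom E x = Cod E v" "Cod E x = Cod E y" "x \<star> t = g" "x \<star> v = y"
    by (rule pushout_lift[OF st'(2) g(1) y(1) g(2) y(2) g(3)[unfolded d(2)] refl g(4)])
  have "stably_equal E y (x \<star> v)" unfolding x(5) by (rule stably_equal_refl[OF y(1)])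
  then show "\<exists>x. x \<in> Arr E \<and> Cod E x = Cod E y \<and> Dom E x = Cod E v \<and> stably_equal E y (x \<star> v)"
    using x(1-3) by blast
qed

section \<open>The stable category has exact triangles\<close>

lemma hom_lift_shift:
  assumes "F \<in> Hom T A B"
  obtains f g h where "hull_map f g h" "Dom E f = A" "Cod E f = B" "F = cls f"
    "stable_shift_arr E \<iota> \<pi> F = cls h"
proof -
  obtain f where f: "f \<in> Arr E" "Dom E f = A" "Cod E f = B" "F = cls f"
    using assms by (rule T_homE)
  obtain g h where "hull_map f g h" using f(1) by (rule hull_map_ex)
  then show ?thesis using that f stable_shift_arr_cls by blast
qed

lemma stable_shift_hom:
  assumes "F \<in> Hom T A B"
  shows "stable_shift_arr E \<iota> \<pi> F \<in> Hom T (stable_shift E \<pi> A) (stable_shift E \<pi> B)"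
proof -
  obtain f g h where *: "hull_map f g h" "Dom E f = A" "Cod E f = B" "F = cls f"
    "stable_shift_arr E \<iota> \<pi> F = cls h" using assms by (rule hom_lift_shift)
  show ?thesis unfolding *(5) stable_shift_def
    using hull_mapD[OF *(1)] *(2,3) by (intro T_homI) auto
qed

lemma stable_shift_comp:
  assumes F: "F \<in> Hom T A B" and G: "G \<in> Hom T B D"
  shows "stable_shift_arr E \<iota> \<pi> (G \<star>\<^bsub>T\<^esub> F) = stable_shift_arr E \<iota> \<pi> G \<star>\<^bsub>T\<^esub> stable_shift_arr E \<iota> \<pi> F"
proof -
  obtain f g h where f: "hull_map f g h" "Dom E f = A" "Cod E f = B" "F = cls f"
    "stable_shift_arr E \<iota> \<pi> F = cls h" using F by (rule hom_lift_shift)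
  obtain f' g' h' where f': "hull_map f' g' h'" "Dom E f' = B" "Cod E f' = D" "G = cls f'"
    "stable_shift_arr E \<iota> \<pi> G = cls h'" using G by (rule hom_lift_shift)
  have "Dom E f' = Cod E f" using f f' by simp
  note c = hull_map_comp[OF f(1) f'(1) this]
  have GF: "G \<star>\<^bsub>T\<^esub> F = cls (f' \<star> f)"
    unfolding f(4) f'(4) using hull_mapD(1)[OF f(1)] hull_mapD(1)[OF f'(1)] f(3) f'(2) by simp
  show ?thesis
    unfolding GF f(5) f'(5) stable_shift_arr_cls[OF c]
    using hull_mapD(5-7)[OF f(1)] hull_mapD(5-7)[OF f'(1)] f(3) f'(2) by simp
qed

lemma stable_shift_ident:
  assumes "A \<in> Ob E"
  shows "stable_shift_arr E \<iota> \<pi> (Ident T A) = Ident T (stable_shift E \<pi> A)"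
  using stable_shift_arr_cls[OF hull_map_ident[OF assms]] by (simp add: stable_shift_def)

lemma stable_shift_zero_iff:
  assumes "F \<in> Hom T A B"
  shows "stable_shift_arr E \<iota> \<pi> F = Zero T (stable_shift E \<pi> A) (stable_shift E \<pi> B) \<longleftrightarrow> F = Zero T A B"
proof -
  obtain f g h where *: "hull_map f g h" "Dom E f = A" "Cod E f = B" "F = cls f"
    "stable_shift_arr E \<iota> \<pi> F = cls h" using assms by (rule hom_lift_shift)
  note m = hull_mapD[OF *(1)]
  have "cls h = cls (Zero E (Cod E (\<pi> A)) (Cod E (\<pi> B))) \<longleftrightarrow> null h"
    using m *(2,3) by (intro cls_zero_iff) auto
  moreover have "cls f = cls (Zero E A B) \<longleftrightarrow> null f"
    using m *(2,3) by (intro cls_zero_iff) auto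
  ultimately show ?thesis unfolding *(5) using hull_map_null_iff[OF *(1)]
    by (simp add: stable_shift_def *(4))
qed

lemma stable_shift_full:
  assumes AB: "A \<in> Ob E" "B \<in> Ob E" and G: "G \<in> Hom T (stable_shift E \<pi> A) (stable_shift E \<pi> B)"
  shows "\<exists>F \<in> Hom T A B. G = stable_shift_arr E \<iota> \<pi> F"
proof -
  obtain h where h: "h \<in> Arr E" "Dom E h = Cod E (\<pi> A)" "Cod E h = Cod E (\<pi> B)" "G = cls h"
    using G unfolding stable_shift_def by (rule T_homE)
  obtain f g where f: "hull_map f g h" "Dom E f = A" "Cod E f = B"
    using AB h(1-3) by (rule hull_map_full)
  have "cls f \<in> Hom T A B" using hull_mapD(1)[OF f(1)] f(2,3) by auto
  then show ?thesis using stable_shift_arr_cls[OF f(1)] h(4) by blast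
qed

lemma stable_shift_iso:
  assumes F: "F \<in> Hom T A B" "iso_arr T F"
  shows "iso_arr T (stable_shift_arr E \<iota> \<pi> F)"
proof -
  have d: "Dom T F = A" "Cod T F = B" using F(1) by (auto simp: Hom_def)
  obtain G where G: "G \<in> Hom T B A" "G \<star>\<^bsub>T\<^esub> F = Ident T A" "F \<star>\<^bsub>T\<^esub> G = Ident T B"
    using F(2) unfolding iso_arr_def d by blast
  have ob: "A \<in> Ob E" "B \<in> Ob E" using F(1) by (auto simp: Hom_def)
  let ?S = "stable_shift_arr E \<iota> \<pi>" and ?s = "stable_shift E \<pi>"
  have sF: "?S F \<in> Hom T (?s A) (?s B)" and sG: "?S G \<in> Hom T (?s B) (?s A)"
    using stable_shift_hom F(1) G(1) by auto
  have "?S G \<star>\<^bsub>T\<^esub> ?S F = Ident T (?s A)"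
    unfolding stable_shift_comp[OF F(1) G(1), symmetric] G(2) by (rule stable_shift_ident[OF ob(1)])
  moreover have "?S F \<star>\<^bsub>T\<^esub> ?S G = Ident T (?s B)"
    unfolding stable_shift_comp[OF G(1) F(1), symmetric] G(3) by (rule stable_shift_ident[OF ob(2)])
  moreover have "Dom T (?S F) = ?s A" "Cod T (?S F) = ?s B" "?S F \<in> Arr T"
    using sF by (auto simp: Hom_def)
  ultimately show ?thesis using sG unfolding iso_arr_def by metis
qed

lemma quotient_eq_T:
  "Hom (quotient_category E) = Hom T" "iso_arr (quotient_category E) = iso_arr T"
  "Comp (quotient_category E) = Comp T"
proof -
  have *: "Arr (quotient_category E) = Arr T" "Dom (quotient_category E) = Dom T"
    "Cod (quotient_category E) = Cod T" "Ident (quotient_category E) = Ident T"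
    "Comp (quotient_category E) = Comp T"
    by (simp_all add: stable_category_def quotient_category_def addcat.defs tricat.defs)
  show h: "Hom (quotient_category E) = Hom T" by (intro ext) (simp only: Hom_def *)
  show "iso_arr (quotient_category E) = iso_arr T" by (intro ext) (simp only: iso_arr_def h *)
  show "Comp (quotient_category E) = Comp T" by (rule *)
qed

lemma standard_distinguished:
  assumes st: "standard_triangle E \<iota> \<pi> f v w"
  shows "distinguished_triangle E \<iota> \<pi> (cls f) (cls v) (cls w)"
proof -
  obtain t where st': "f \<in> Arr E" "Cod E w = Cod E (\<pi> (Dom E f))" "v \<in> Arr E" "w \<in> Arr E"
    "Dom E v = Cod E f" "Dom E w = Cod E v"
    using st by (rule standard_triangleE)
  have ob: "Dom E f \<in> Ob E" "Cod E f \<in> Ob E" "Cod E v \<in> Ob E" using st' by auto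
  have id: "Ident T A \<in> Hom T A A" "iso_arr T (Ident T A)" if "A \<in> Ob E" for A
    using that stable.iso_arr_ident[of A] by (auto simp: Hom_def)
  have "cls f \<in> Hom T (Dom E f) (Cod E f)" "cls v \<in> Hom T (Cod E f) (Cod E v)"
    "cls w \<in> Hom T (Cod E v) (stable_shift E \<pi> (Dom E f))"
    using st' by (auto simp: stable_shift_def)
  moreover have "Ident T (Cod E f) \<star>\<^bsub>T\<^esub> cls f = cls f \<star>\<^bsub>T\<^esub> Ident T (Dom E f)"
    "Ident T (Cod E v) \<star>\<^bsub>T\<^esub> cls v = cls v \<star>\<^bsub>T\<^esub> Ident T (Cod E f)"
    "stable_shift_arr E \<iota> \<pi> (Ident T (Dom E f)) \<star>\<^bsub>T\<^esub> cls w = cls w \<star>\<^bsub>T\<^esub> Ident T (Cod E v)"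
    unfolding stable_shift_ident[OF ob(1)] using st' ob by (simp_all add: stable_shift_def)
  ultimately show ?thesis
    unfolding distinguished_triangle_def Let_def quotient_eq_T
    using st id[OF ob(1)] id[OF ob(2)] id[OF ob(3)] by blast
qed

text \<open>
  All five properties are invariant under isomorphism of composable pairs, and the shift of an
  isomorphism is an isomorphism, so they pass from the standard triangle.
\<close>

lemma distinguished_weak_kernels:
  assumes dt: "distinguished_triangle E \<iota> \<pi> U V W"
  shows "weak_kernel T U V" "weak_kernel T V W" "weak_kernel T W (stable_shift_arr E \<iota> \<pi> U)"
    "weak_cokernel T V U" "weak_cokernel T W V" "Cod T W = stable_shift E \<pi> (Dom T U)"
proof -
  let ?S = "stable_shift_arr E \<iota> \<pi>" and ?s = "stable_shift E \<pi>"
  from dt obtain A B D f v w a b c where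
    UVW: "U \<in> Hom T A B" "V \<in> Hom T B D" "W \<in> Hom T D (?s A)" and
    st: "standard_triangle E \<iota> \<pi> f v w" and
    abc: "a \<in> Hom T (Dom E f) A" "b \<in> Hom T (Cod E f) B" "c \<in> Hom T (Cod E v) D" and
    iso: "iso_arr T a" "iso_arr T b" "iso_arr T c" and
    sq: "b \<star>\<^bsub>T\<^esub> cls f = U \<star>\<^bsub>T\<^esub> a" "c \<star>\<^bsub>T\<^esub> cls v = V \<star>\<^bsub>T\<^esub> b"
      "?S a \<star>\<^bsub>T\<^esub> cls w = W \<star>\<^bsub>T\<^esub> c"
    unfolding distinguished_triangle_def Let_def quotient_eq_T by blast
  obtain t where st': "f \<in> Arr E" "(v, w) \<in> Confl E" "Cod E w = Cod E (\<pi> (Dom E f))" "v \<in> Arr E"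
    "w \<in> Arr E"
    "Dom E v = Cod E f" "Dom E w = Cod E v"
    using st by (rule standard_triangleE)
  have arr: "U \<in> Arr T" "V \<in> Arr T" "W \<in> Arr T" "Dom T U = A" "Cod T U = B" "Dom T V = B" "Cod T V = D"
    "Dom T W = D" "Cod T W = ?s A"
    using UVW by (auto simp: Hom_def)
  have sf: "cls f \<in> Hom T (Dom E f) (Cod E f)" using st' by auto
  have SU: "?S U \<in> Hom T (?s A) (?s B)" and Sf: "?S (cls f) \<in> Hom T (?s (Dom E f)) (?s (Cod E f))"
    and Sa: "?S a \<in> Hom T (?s (Dom E f)) (?s A)" and Sb: "?S b \<in> Hom T (?s (Cod E f)) (?s B)"
    by (intro stable_shift_hom UVW sf abc)+
  have sq': "?S b \<star>\<^bsub>T\<^esub> ?S (cls f) = ?S U \<star>\<^bsub>T\<^esub> ?S a"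
    using stable_shift_comp[OF sf abc(2)] stable_shift_comp[OF abc(1) UVW(1)] sq(1) by simp
  have Sd: "?S U \<in> Arr T" "Dom T (?S U) = ?s A" "Cod T (?S U) = ?s B"
    "Dom T (?S (cls f)) = ?s (Dom E f)" "Cod T (?S (cls f)) = ?s (Cod E f)"
    using SU Sf by (auto simp: Hom_def)
  have w: "Cod E w = ?s (Dom E f)" using st'(3) by (simp add: stable_shift_def)
  show "weak_kernel T U V"
    by (rule stable.weak_kernel_iso[OF standard_weak_kernel1[OF st] _ iso(1) _ iso(2) _ iso(3) _ _ _ sq(1,2)])
      (use abc arr st' in simp_all)
  show "weak_cokernel T V U"
    by (rule stable.weak_cokernel_iso[OF standard_weak_cokernel1[OF st] _ iso(1) _ iso(2) _ iso(3) _ _ _ sq(1,2)])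
      (use abc arr st' in simp_all)
  show "weak_kernel T V W"
    by (rule stable.weak_kernel_iso[OF confl_weak_kernel[OF st'(2)] _ iso(2) _ iso(3) _ stable_shift_iso[OF abc(1) iso(1)] _ _ _ sq(2,3)])
      (use abc arr st' Sa w in simp_all)
  show "weak_cokernel T W V"
    by (rule stable.weak_cokernel_iso[OF confl_weak_cokernel[OF st'(2)] _ iso(2) _ iso(3) _ stable_shift_iso[OF abc(1) iso(1)] _ _ _ sq(2,3)])
      (use abc arr st' Sa w in simp_all)
  show "weak_kernel T W (?S U)"
    by (rule stable.weak_kernel_iso[OF standard_weak_kernel3[OF st] _ iso(3) _ stable_shift_iso[OF abc(1) iso(1)] _ stable_shift_iso[OF abc(2) iso(2)] _ _ _ sq(3) sq'])
      (use abc arr st' Sa Sb Sd w in simp_all)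
  show "Cod T W = ?s (Dom T U)" using arr by simp
qed

sublocale stable: exact_triangles T
proof
  show "A \<in> Ob T \<Longrightarrow> Shift T A \<in> Ob T" for A by (simp add: stable_shift_def)
  show "F \<in> Hom T A B \<Longrightarrow> ShiftArr T F \<in> Hom T (Shift T A) (Shift T B)" for F A B
    by (simp add: stable_shift_hom)
  show "F \<in> Hom T A B \<Longrightarrow> G \<in> Hom T B D \<Longrightarrow> ShiftArr T (G \<star>\<^bsub>T\<^esub> F) = ShiftArr T G \<star>\<^bsub>T\<^esub> ShiftArr T F"
    for F G A B D
    by (simp add: stable_shift_comp)
  show "F \<in> Hom T A B \<Longrightarrow> ShiftArr T F = Zero T (Shift T A) (Shift T B) \<longleftrightarrow> F = Zero T A B" for F A B
    using stable_shift_zero_iff by simp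
  show "A \<in> Ob T \<Longrightarrow> B \<in> Ob T \<Longrightarrow> G \<in> Hom T (Shift T A) (Shift T B) \<Longrightarrow> \<exists>F \<in> Hom T A B. G = ShiftArr T F"
    for A B G
    using stable_shift_full by simp
  show "Y \<in> Ob T \<Longrightarrow> \<exists>B\<in>Ob T. isomorphic T (Shift T B) Y" for Y
    using shift_essentially_surjective by simp
  show "\<exists>V W. (U, V, W) \<in> Tri T" if U: "U \<in> Arr T" for U
  proof -
    obtain f where f: "f \<in> Arr E" "U = cls f" using U by auto
    then show ?thesis using standard_triangle_ex[OF f(1)] standard_distinguished by fastforce
  qed
qed (use distinguished_weak_kernels in simp_all)

section \<open>Precovers and the homotopy approximation\<close>

lemma precover_lift:
  assumes "precover E R X p" "x \<in> Arr E" "Dom E x \<in> R" "Cod E x = X"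
  obtains y where "y \<in> Arr E" "Dom E y = Dom E x" "Cod E y = Dom E p" "x = p \<star> y"
proof -
  obtain y where "y \<in> Hom E (Dom E x) (Dom E p)" "x = p \<star> y"
    using assms unfolding precover_def by blast
  then show ?thesis using that unfolding Hom_def by blast
qed

text \<open>
  The object \<open>A[1]\<close> is only stably isomorphic to some \<open>B\<close> in \<open>R\<close>. In \<open>E\<close> this means that the identity
  of \<open>A[1]\<close> is a sum of an arrow through \<open>B\<close> and a null arrow, and the null one factors through the
  deflation \<open>I(A) \<rightarrow> A[1]\<close>. Both \<open>B\<close> and \<open>I(A)\<close> are in \<open>R\<close>, so each summand lifts.
\<close>

lemma precover_lift_from_shift:
  assumes R: "closed_under_shifts T R" "R \<subseteq> Ob E" "\<And>A. A \<in> R \<Longrightarrow> Cod E (\<iota> A) \<in> R"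
    and p: "precover E R X p" and A: "A \<in> R"
    and x: "x \<in> Arr E" "Dom E x = Cod E (\<pi> A)" "Cod E x = X"
  obtains y where "y \<in> Arr E" "Dom E y = Dom E x" "Cod E y = Dom E p" "p \<star> y = x"
proof -
  have pa: "p \<in> Arr E" "Cod E p = X" using p by (auto simp: precover_def)
  have ob: "A \<in> Ob E" using A R by auto
  note hA = conflD[OF hull(1)[OF ob]]
  obtain B where B: "B \<in> R" "isomorphic T B (stable_shift E \<pi> A)"
    using R(1) A unfolding closed_under_shifts_def by auto
  obtain F G where FG: "F \<in> Hom T B (stable_shift E \<pi> A)" "G \<in> Hom T (stable_shift E \<pi> A) B"
    "F \<star>\<^bsub>T\<^esub> G = Ident T (stable_shift E \<pi> A)"
    using B(2) by (rule stable.isomorphicE)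
  obtain b where b: "b \<in> Arr E" "Dom E b = B" "Cod E b = Cod E (\<pi> A)" "F = cls b"
    using FG(1) unfolding stable_shift_def by (rule T_homE)
  obtain a where a: "a \<in> Arr E" "Dom E a = Cod E (\<pi> A)" "Cod E a = B" "G = cls a"
    using FG(2) unfolding stable_shift_def by (rule T_homE)
  let ?I = "Ident E (Cod E (\<pi> A))"
  have I: "?I \<in> Arr E" "Dom E ?I = Cod E (\<pi> A)" "Cod E ?I = Cod E (\<pi> A)" using ob by auto
  have "cls ?I = cls (b \<star> a)" using FG(3) a b by (simp add: stable_shift_def)
  then have "stably_equal E ?I (b \<star> a)" unfolding stable_class_eq_iff[OF I(1)] .
  then obtain n where n: "null n" "n \<in> Arr E" "Dom E n = Cod E (\<pi> A)" "Cod E n = Cod E (\<pi> A)"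
      "?I = Add E n (b \<star> a)"
    by (rule stably_equalE) (use a(1-3) b(1-3) in simp)
  obtain c where c: "c \<in> Arr E" "Cod E c = Dom E (\<pi> A)" "Dom E c = Dom E n" "\<pi> A \<star> c = n"
    by (rule null_lift[OF n(1) hA(8,4) n(4)[symmetric]])
  note c = c(1) c(2)[unfolded hull_arr(4)[OF ob]] c(3)[unfolded n(3)] c(4)
  have x\<pi>: "x \<star> \<pi> A \<in> Arr E" "Dom E (x \<star> \<pi> A) = Cod E (\<iota> A)" "Cod E (x \<star> \<pi> A) = X" using x ob by auto
  obtain u where u: "u \<in> Arr E" "Dom E u = Dom E (x \<star> \<pi> A)" "Cod E u = Dom E p" "x \<star> \<pi> A = p \<star> u"
    by (rule precover_lift[OF p x\<pi>(1) _ x\<pi>(3)]) (use R(3)[OF A] x\<pi>(2) in simp)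
  note u = u(1) u(2)[unfolded x\<pi>(2)] u(3,4)
  have xb: "x \<star> b \<in> Arr E" "Dom E (x \<star> b) = B" "Cod E (x \<star> b) = X" using x b by auto
  obtain u' where u': "u' \<in> Arr E" "Dom E u' = Dom E (x \<star> b)" "Cod E u' = Dom E p" "x \<star> b = p \<star> u'"
    by (rule precover_lift[OF p xb(1) _ xb(3)]) (use B xb(2) in simp)
  note u' = u'(1) u'(2)[unfolded xb(2)] u'(3,4)
  have "x = x \<star> ?I" using x by simp
  also have "\<dots> = Add E ((x \<star> \<pi> A) \<star> c) ((x \<star> b) \<star> a)"
    unfolding n(5) c(4)[symmetric] using x c(1-3) a(1-3) b(1-3) ob by simp
  also have "\<dots> = p \<star> Add E (u \<star> c) (u' \<star> a)"
    unfolding u(4) u'(4) using u(1-3) u'(1-3) c(1-3) a(1-3) pa by simp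
  finally have eq: "p \<star> Add E (u \<star> c) (u' \<star> a) = x" by simp
  show ?thesis
    by (rule that[OF _ _ _ eq]) (use u(1-3) u'(1-3) c(1-3) a(1-3) x(2) in auto)
qed

lemma precover_hom_surjective:
  assumes p: "precover E R X p" and A: "A \<in> R"
  shows "hom_surjective T A (cls p)"
  unfolding hom_surjective_def
proof
  have pa: "p \<in> Arr E" "Cod E p = X" using p by (auto simp: precover_def)
  fix Y assume "Y \<in> Hom T A (Cod T (cls p))"
  then have "Y \<in> Hom T A X" using pa by simp
  then obtain y where y: "y \<in> Arr E" "Dom E y = A" "Cod E y = X" "Y = cls y" by (rule T_homE)
  obtain x where x: "x \<in> Arr E" "Dom E x = Dom E y" "Cod E x = Dom E p" "y = p \<star> x"
    by (rule precover_lift[OF p y(1) _ y(3)]) (use A y(2) in simp)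
  note x = x(1) x(2)[unfolded y(2)] x(3,4)
  have "Y = cls p \<star>\<^bsub>T\<^esub> cls x" unfolding y(4) x(4) using x(1-3) pa by simp
  moreover have "cls x \<in> Hom T A (Dom T (cls p))" using x(1-3) pa by auto
  ultimately show "\<exists>x \<in> Hom T A (Dom T (cls p)). Y = cls p \<star>\<^bsub>T\<^esub> x" by blast
qed

text \<open>
  If \<open>p \<star> y\<close> is null, it factors through \<open>I(A)\<close>, which is in \<open>R\<close>; so it has a lift along \<open>p\<close> that still
  factors through \<open>I(A)\<close>, and \<open>y\<close> differs from this null lift by an arrow through the kernel.
\<close>

lemma precover_kernel_exact:
  assumes R: "R \<subseteq> Ob E" "\<And>A. A \<in> R \<Longrightarrow> Cod E (\<iota> A) \<in> R"
    and p: "precover E R X p" and k: "is_kernel E k p" and A: "A \<in> R"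
    and Y: "Y \<in> Hom T A (Dom E p)" "cls p \<star>\<^bsub>T\<^esub> Y = Zero T A X"
  shows "\<exists>Z \<in> Hom T A (Dom E k). Y = cls k \<star>\<^bsub>T\<^esub> Z"
proof -
  have pa: "p \<in> Arr E" "Cod E p = X" using p by (auto simp: precover_def)
  note ka = kernelD[OF k]
  have ob: "A \<in> Ob E" using A R by auto
  obtain y where y: "y \<in> Arr E" "Dom E y = A" "Cod E y = Dom E p" "Y = cls y" using Y(1)
    by (rule T_homE)
  have py: "p \<star> y \<in> Arr E" "Dom E (p \<star> y) = A" "Cod E (p \<star> y) = X" using y pa by auto
  have "cls (p \<star> y) = cls (Zero E A X)" using Y(2) y pa by simp
  then have "null (p \<star> y)" using cls_zero_iff[OF py] by simp
  then obtain g where g: "g \<in> Arr E" "Dom E g = Cod E (\<iota> A)" "Cod E g = Cod E (p \<star> y)" "g \<star> \<iota> A = p \<star> y"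
    using null_hull py(2) by blast
  note g = g(1,2) g(3)[unfolded py(3)] g(4)
  obtain g' where g': "g' \<in> Arr E" "Dom E g' = Dom E g" "Cod E g' = Dom E p" "g = p \<star> g'"
    by (rule precover_lift[OF p g(1) _ g(3)]) (use R(2)[OF A] g(2) in simp)
  note g' = g'(1) g'(2)[unfolded g(2)] g'(3,4)
  have "p \<star> y = p \<star> (g' \<star> \<iota> A)" unfolding g(4)[symmetric] g'(4) using g'(1-3) pa ob by simp
  moreover have "g' \<star> \<iota> A \<in> Arr E" "Cod E (g' \<star> \<iota> A) = Dom E p" "Dom E (g' \<star> \<iota> A) = Dom E y"
    using g'(1-3) y ob by auto
  ultimately obtain z where z: "z \<in> Arr E" "Dom E z = Dom E y" "Cod E z = Dom E k"
    "y = Add E (k \<star> z) (g' \<star> \<iota> A)"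
    using kernel_diff[OF k y(1) _ y(3)] by blast
  note z = z(1) z(2)[unfolded y(2)] z(3,4)
  have "stably_equal E y (k \<star> z)"
  proof (rule stably_equalI2[OF _ _ _ _ z(4)])
    show "null (g' \<star> \<iota> A)" by (rule nullI[OF hull(3)[OF ob]]) (use g'(1-3) ob in auto)
  qed (use g'(1-3) z(1-3) ka ob in auto)
  then have "Y = cls (k \<star> z)" unfolding y(4) stable_class_eq_iff[OF y(1)] .
  also have "\<dots> = cls k \<star>\<^bsub>T\<^esub> cls z" using z(1-3) ka by simp
  finally show ?thesis using z(1-3) by blast
qed

text \<open>
  Let \<open>k \<star> z = g \<star> \<iota> A\<close>. Then \<open>p \<star> g\<close> vanishes on \<open>A\<close>, hence is induced by an arrow \<open>A[1] \<rightarrow> X\<close>, which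
  lifts along \<open>p\<close>. Subtracting the lift, whose restriction to \<open>A\<close> is zero, from \<open>g\<close> makes \<open>g\<close>
  factor through \<open>k\<close>; since \<open>k\<close> is a monomorphism, \<open>z\<close> itself factors through \<open>I(A)\<close>.
\<close>

lemma precover_kernel_hom_injective:
  assumes R: "closed_under_shifts T R" "R \<subseteq> Ob E" "\<And>A. A \<in> R \<Longrightarrow> Cod E (\<iota> A) \<in> R"
    and p: "precover E R X p" and k: "is_kernel E k p" and A: "A \<in> R"
  shows "hom_injective T A (cls k)"
  unfolding hom_injective_def
proof (intro ballI impI)
  have pa: "p \<in> Arr E" "Cod E p = X" using p by (auto simp: precover_def)
  note ka = kernelD[OF k]
  have ob: "A \<in> Ob E" using A R by auto
  note hA = conflD[OF hull(1)[OF ob]]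
  fix Z assume Z: "Z \<in> Hom T A (Dom T (cls k))" "cls k \<star>\<^bsub>T\<^esub> Z = Zero T A (Cod T (cls k))"
  have "Z \<in> Hom T A (Dom E k)" using Z(1) ka by simp
  then obtain z where z: "z \<in> Arr E" "Dom E z = A" "Cod E z = Dom E k" "Z = cls z" by (rule T_homE)
  have kz: "k \<star> z \<in> Arr E" "Dom E (k \<star> z) = A" "Cod E (k \<star> z) = Cod E k" using z ka by auto
  have "cls (k \<star> z) = cls (Zero E A (Cod E k))" using Z(2) z ka by simp
  then have "null (k \<star> z)" using cls_zero_iff[OF kz] by simp
  then obtain g where g: "g \<in> Arr E" "Dom E g = Cod E (\<iota> A)" "Cod E g = Cod E (k \<star> z)" "g \<star> \<iota> A = k \<star> z"
    using null_hull kz(2) by blast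
  note g = g(1,2) g(3)[unfolded kz(3) ka(3)] g(4)
  have "(p \<star> g) \<star> \<iota> A = p \<star> (k \<star> z)" unfolding g(4)[symmetric] using g(1-3) pa ob by simp
  also have "\<dots> = (p \<star> k) \<star> z" using z(1-3) ka by (intro assoc[symmetric]) auto
  also have "\<dots> = Zero E A X" unfolding ka(4) using z(1-3) ka pa arr_ob(2)[OF pa(1)] by simp
  finally have zz: "(p \<star> g) \<star> \<iota> A = Zero E (Dom E (\<iota> A)) X" using ob by simp
  have pg: "p \<star> g \<in> Arr E" "Dom E (p \<star> g) = Cod E (\<iota> A)" "Cod E (p \<star> g) = X" using g pa by auto
  obtain h where h: "h \<in> Arr E" "Dom E h = Cod E (\<pi> A)" "Cod E h = X" "p \<star> g = h \<star> \<pi> A"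
    using zz by (rule cokernel_lift[OF hA(2) pg(1,2), unfolded pg(3)])
  obtain h' where h': "h' \<in> Arr E" "Dom E h' = Dom E h" "Cod E h' = Dom E p" "p \<star> h' = h"
    by (rule precover_lift_from_shift[OF R p A h(1-3)])
  note h' = h'(1) h'(2)[unfolded h(2)] h'(3,4)
  have "p \<star> g = p \<star> (h' \<star> \<pi> A)" unfolding h(4) h'(4)[symmetric] using h'(1-3) pa ob by simp
  moreover have "h' \<star> \<pi> A \<in> Arr E" "Cod E (h' \<star> \<pi> A) = Dom E p" "Dom E (h' \<star> \<pi> A) = Dom E g"
    using h'(1-3) g ob by auto
  ultimately obtain g' where g': "g' \<in> Arr E" "Dom E g' = Dom E g" "Cod E g' = Dom E k"
    "g = Add E (k \<star> g') (h' \<star> \<pi> A)"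
    using kernel_diff[OF k g(1) _ g(3)] by blast
  note g' = g'(1) g'(2)[unfolded g(2)] g'(3,4)
  have "k \<star> z = k \<star> (g' \<star> \<iota> A)"
    unfolding g(4)[symmetric] g'(4) using g'(1-3) h'(1-3) ka ob by simp
  then have zeq: "z = g' \<star> \<iota> A"
    by (rule kernel_mono[OF k, rotated -1]) (use z(1-3) g'(1-3) ob in auto)
  have "null z" unfolding zeq by (rule nullI[OF hull(3)[OF ob]]) (use g'(1-3) ob in auto)
  then show "Z = Zero T A (Dom T (cls k))" using z(1-3) ka cls_zero_iff[OF z(1-3)] by (simp add: z(4))
qed

text \<open>
  By induction on the length, applied to the resolution of \<open>K\<^sub>1\<close>. The remaining stage exists because
  \<open>p\<^sub>0 \<star> k\<^sub>0\<close> is zero, so that \<open>p\<^sub>0\<close> factors through the weak cokernel of \<open>k\<^sub>0 \<star> l\<^sub>1\<close>.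
\<close>

lemma approximation_stages_exist:
  assumes "K d \<in> Ob E"
    and "\<forall>i<d. is_kernel E (k i) (p i) \<and> Dom E (k i) = K (Suc i) \<and> Cod E (p i) = K i"
  shows "\<exists>L l. L d = K d \<and> l d = Ident T (K d) \<and> l 0 \<in> Hom T (L 0) (K 0) \<and>
    (\<forall>i<d. \<exists>v w. (cls (k i) \<star>\<^bsub>T\<^esub> l (Suc i), v, w) \<in> Tri T \<and> Cod T v = L i \<and>
       l i \<in> Hom T (L i) (K i) \<and> l i \<star>\<^bsub>T\<^esub> v = cls (p i))"
  using assms
proof (induction d arbitrary: K k p)
  case 0
  then show ?case by (intro exI[of _ K] exI[of _ "\<lambda>i. Ident T (K i)"]) auto
next
  case (Suc d)
  let ?K = "\<lambda>i. K (Suc i)" and ?k = "\<lambda>i. k (Suc i)" and ?p = "\<lambda>i. p (Suc i)"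
  have "\<exists>L l. L d = ?K d \<and> l d = Ident T (?K d) \<and> l 0 \<in> Hom T (L 0) (?K 0) \<and>
    (\<forall>i<d. \<exists>v w. (cls (?k i) \<star>\<^bsub>T\<^esub> l (Suc i), v, w) \<in> Tri T \<and> Cod T v = L i \<and>
       l i \<in> Hom T (L i) (?K i) \<and> l i \<star>\<^bsub>T\<^esub> v = cls (?p i))"
    by (rule Suc.IH) (use Suc.prems in auto)
  then obtain L l where L: "L d = ?K d" "l d = Ident T (?K d)" "l 0 \<in> Hom T (L 0) (?K 0)"
    and step: "\<forall>i<d. \<exists>v w. (cls (?k i) \<star>\<^bsub>T\<^esub> l (Suc i), v, w) \<in> Tri T \<and> Cod T v = L i \<and>
       l i \<in> Hom T (L i) (?K i) \<and> l i \<star>\<^bsub>T\<^esub> v = cls (?p i)" by blast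
  have k0: "is_kernel E (k 0) (p 0)" "Dom E (k 0) = K (Suc 0)" "Cod E (p 0) = K 0"
    using Suc.prems(2) by auto
  note ka = kernelD[OF k0(1)]
  obtain m where m: "m \<in> Arr E" "Dom E m = L 0" "Cod E m = K (Suc 0)" "l 0 = cls m"
    using L(3) by (rule T_homE)
  let ?e = "cls (k 0) \<star>\<^bsub>T\<^esub> l 0"
  have e: "?e = cls (k 0 \<star> m)" using m ka k0 by simp
  have km: "k 0 \<star> m \<in> Arr E" "Dom E (k 0 \<star> m) = L 0" "Cod E (k 0 \<star> m) = Dom E (p 0)"
    using m ka k0 by auto
  have "?e \<in> Arr T" unfolding e using km by auto
  then obtain v w where vw: "(?e, v, w) \<in> Tri T" using stable.tri_ex by blast
  have p0: "cls (p 0) \<in> Hom T (Cod T ?e) (K 0)" unfolding e using km ka k0 by auto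
  have "p 0 \<star> (k 0 \<star> m) = (p 0 \<star> k 0) \<star> m" using m ka k0 by (intro assoc[symmetric]) auto
  also have "\<dots> = Zero E (L 0) (K 0)" unfolding ka(4)
    using m ka k0 arr_ob(1)[OF ka(1)] arr_ob(2)[OF ka(2)] by simp
  finally have "cls (p 0) \<star>\<^bsub>T\<^esub> ?e = Zero T (Dom T ?e) (K 0)" unfolding e using km ka by simp
  then obtain l0 where l0: "l0 \<in> Hom T (Cod T v) (K 0)" "cls (p 0) = l0 \<star>\<^bsub>T\<^esub> v"
    using stable.weak_cokernel_lift[OF stable.tri_weak_cokernel(1)[OF vw] p0] by blast
  let ?L = "case_nat (Cod T v) L" and ?l = "case_nat l0 l"
  have "\<exists>v w. (cls (k i) \<star>\<^bsub>T\<^esub> ?l (Suc i), v, w) \<in> Tri T \<and> Cod T v = ?L i \<and>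
       ?l i \<in> Hom T (?L i) (K i) \<and> ?l i \<star>\<^bsub>T\<^esub> v = cls (p i)" if i: "i < Suc d" for i
  proof (cases i)
    case 0
    show ?thesis unfolding 0 using vw l0 by (intro exI[of _ v] exI[of _ w]) simp
  next
    case (Suc j)
    then show ?thesis using i step by simp
  qed
  then show ?case using L l0(1) by (intro exI[of _ ?L] exI[of _ ?l]) simp
qed

lemma homotopy_approximation_exists:
  assumes fin: "finite_dimension E R X" and R: "R \<subseteq> Ob E"
  shows "\<exists>L l. homotopy_approximation E \<iota> \<pi> R X L l"
proof -
  obtain d K p k where res: "finite_resolution E R X d K p k"
    using fin unfolding finite_dimension_def by blast
  have "K d \<in> Ob E" using res R unfolding finite_resolution_def by blast
  moreover have "\<forall>i<d. is_kernel E (k i) (p i) \<and> Dom E (k i) = K (Suc i) \<and> Cod E (p i) = K i"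
    using res unfolding finite_resolution_def precover_def by blast
  ultimately have "\<exists>L l. L d = K d \<and> l d = Ident T (K d) \<and> l 0 \<in> Hom T (L 0) (K 0) \<and>
    (\<forall>i<d. \<exists>v w. (cls (k i) \<star>\<^bsub>T\<^esub> l (Suc i), v, w) \<in> Tri T \<and> Cod T v = L i \<and>
       l i \<in> Hom T (L i) (K i) \<and> l i \<star>\<^bsub>T\<^esub> v = cls (p i))"
    by (rule approximation_stages_exist)
  then show ?thesis unfolding homotopy_approximation_def Let_def using res by blast
qed

text \<open>
  Downward induction along the resolution, from the identity of \<open>K\<^sub>d\<close> to \<open>l\<^sub>0\<close>.
\<close>

lemma homotopy_approximation_hom_bijective:
  assumes R: "closed_under_shifts T R" "R \<subseteq> Ob E" "\<And>A. A \<in> R \<Longrightarrow> Cod E (\<iota> A) \<in> R"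
    and approx: "homotopy_approximation E \<iota> \<pi> R X L0 l0"
  shows "l0 \<in> Hom T L0 X" "L0 \<in> localizing_closure T R"
    "\<And>A. A \<in> R \<Longrightarrow> hom_injective T A l0" "\<And>A. A \<in> R \<Longrightarrow> hom_surjective T A l0"
proof -
  obtain d K p k L l where res: "finite_resolution E R X d K p k"
    and Ld: "L d = K d" "l d = Ident T (K d)"
    and stage: "\<forall>i<d. \<exists>v w. (cls (k i) \<star>\<^bsub>T\<^esub> l (Suc i), v, w) \<in> Tri T \<and> Cod T v = L i \<and>
           l i \<in> Hom T (L i) (K i) \<and> l i \<star>\<^bsub>T\<^esub> v = cls (p i)"
    and L0: "L0 = L 0" "l0 = l 0"
    using approx unfolding homotopy_approximation_def Let_def by blast
  have K: "K 0 = X" "K d \<in> R" and pre: "\<And>i. i < d \<Longrightarrow> precover E R (K i) (p i)"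
    "\<And>i. i < d \<Longrightarrow> is_kernel E (k i) (p i)" "\<And>i. i < d \<Longrightarrow> Dom E (k i) = K (Suc i)"
    using res unfolding finite_resolution_def by blast+
  let ?S = "localizing_closure T R"
  have R_S: "R \<subseteq> ?S" unfolding localizing_closure_def by blast
  have R_T: "R \<subseteq> Ob T" using R(2) by simp
  have "l i \<in> Hom T (L i) (K i) \<and> L i \<in> ?S \<and> (\<forall>A\<in>R. hom_injective T A (l i) \<and> hom_surjective T A (l i))"
    if "i \<le> d" for i
    using that
  proof (induction rule: inc_induct)
    case base
    have Kd: "K d \<in> Ob T" using K(2) R_T by blast
    have id: "Ident T (K d) \<in> Hom T (K d) (K d)" "Dom T (Ident T (K d)) = K d"
      "Cod T (Ident T (K d)) = K d"
      using stable.ident_arr[OF Kd] unfolding Hom_def by auto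
    have unit: "Ident T (K d) \<star>\<^bsub>T\<^esub> x = x" if "x \<in> Hom T A (K d)" for x A
      using that stable.comp_ident_left by blast
    have "hom_injective T A (Ident T (K d))" "hom_surjective T A (Ident T (K d))" for A
      unfolding hom_injective_def hom_surjective_def id using unit by metis+
    then show ?case unfolding Ld using id K(2) R_S by blast
  next
    case (step i)
    have l': "l (Suc i) \<in> Hom T (L (Suc i)) (K (Suc i))" "L (Suc i) \<in> ?S"
      and bij: "\<And>A. A \<in> R \<Longrightarrow> hom_injective T A (l (Suc i))" "\<And>A. A \<in> R \<Longrightarrow> hom_surjective T A (l (Suc i))"
      using step.IH by blast+
    obtain v w where vw: "(cls (k i) \<star>\<^bsub>T\<^esub> l (Suc i), v, w) \<in> Tri T" "Cod T v = L i"
      "l i \<in> Hom T (L i) (K i)" "l i \<star>\<^bsub>T\<^esub> v = cls (p i)"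
      using stage step.hyps by blast
    note pi = pre(1)[OF step.hyps(2)] and ki = pre(2)[OF step.hyps(2)] and dk = pre(3)[OF step.hyps(2)]
    have pa: "p i \<in> Arr E" "Cod E (p i) = K i" "Dom E (p i) \<in> R" using pi by (auto simp: precover_def)
    note ka = kernelD[OF ki]
    have la: "l (Suc i) \<in> Arr T" "Dom T (l (Suc i)) = L (Suc i)" "Cod T (l (Suc i)) = K (Suc i)"
      using l'(1) by (auto simp: Hom_def)
    have kT: "cls (k i) \<in> Arr T" "Dom T (cls (k i)) = Cod T (l (Suc i))"
      "Cod T (cls (k i)) = Dom E (p i)"
      using ka dk la by auto
    have pT: "cls (p i) \<in> Hom T (Cod T (cls (k i))) (K i)" using pa kT by auto
    have vl: "l i \<in> Hom T (Cod T v) (K i)" unfolding vw(2) by (rule vw(3))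
    have ex: "\<exists>z \<in> Hom T A (Dom T (cls (k i))). y = cls (k i) \<star>\<^bsub>T\<^esub> z"
      if "A \<in> R" "y \<in> Hom T A (Cod T (cls (k i)))" "cls (p i) \<star>\<^bsub>T\<^esub> y = Zero T A (K i)" for A y
      using precover_kernel_exact[OF R(2,3) pi ki that(1) that(2)[unfolded kT(3)] that(3)] T_dom_cod(1)[OF ka(1)]
      by simp
    have "hom_injective T A (l i)" "hom_surjective T A (l i)" if A: "A \<in> R" for A
      by (rule stable.approximation_step[OF R(1) R_T vw(1) la(1) kT(1,2) vl pT vw(4) bij
            precover_kernel_hom_injective[OF R pi ki] precover_hom_surjective[OF pi] ex A]; assumption)+
    moreover have "L i \<in> ?S"
      unfolding vw(2)[symmetric]
      by (rule stable.localizing_closure_cone[OF vw(1)]) (use kT la l'(2) pa(3) R_S in auto)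
    ultimately show ?case using vw(3) by blast
  qed
  from this[of 0] show "l0 \<in> Hom T L0 X" "L0 \<in> localizing_closure T R"
    "\<And>A. A \<in> R \<Longrightarrow> hom_injective T A l0" "\<And>A. A \<in> R \<Longrightarrow> hom_surjective T A l0"
    unfolding L0 K(1)[symmetric] by blast+
qed

end

theorem theorem3p3:
  fixes E :: "('o, 'm) exactcat"
    and \<iota> \<pi> :: "'o \<Rightarrow> 'm"
    and T :: "('o, 'm set) tricat"
    and R S :: "'o set"
    and i_shriek :: "'o \<Rightarrow> 'o"
    and i_shriek_arr :: "'m set \<Rightarrow> 'm set"
    and X :: 'o
  assumes frobenius: "frobenius_category E"
    and hulls: "injective_hulls E \<iota> \<pi>"
    and T_eq: "T = stable_category E \<iota> \<pi>"
    and precovering: "precovering E R"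
    and precover_kernel: "\<And>Y p. precover E R Y p \<Longrightarrow> \<exists>k. is_kernel E k p"
    and shifts: "closed_under_shifts T R"
    and hulls_in_R: "\<And>A. A \<in> R \<Longrightarrow> Cod E (\<iota> A) \<in> R"
    and S_eq: "S = localizing_closure T R"
    and right_adjoint: "is_right_adjoint (full_subcategory T S) T (\<lambda>A. A) (\<lambda>f. f) i_shriek i_shriek_arr"
    and X: "X \<in> Ob E"
    and finite_dim: "finite_dimension E R X"
  shows "(\<exists>L\<^sub>0 l\<^sub>0. homotopy_approximation E \<iota> \<pi> R X L\<^sub>0 l\<^sub>0) \<and>
         (\<forall>L\<^sub>0 l\<^sub>0. homotopy_approximation E \<iota> \<pi> R X L\<^sub>0 l\<^sub>0 \<longrightarrow> isomorphic T (i_shriek X) L\<^sub>0)"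
proof -
  interpret frobenius_hulls E \<iota> \<pi>
    by (intro frobenius_hulls.intro frobenius_hulls_axioms.intro frobenius hulls)
  have R: "R \<subseteq> Ob E" using precovering by (simp add: precovering_def)
  then have R_T: "R \<subseteq> Ob (stable_category E \<iota> \<pi>)" by simp
  note sh = shifts[unfolded T_eq] and adj = right_adjoint[unfolded T_eq]
  note S = S_eq[unfolded T_eq]
  have "isomorphic T (i_shriek X) L0" if "homotopy_approximation E \<iota> \<pi> R X L0 l0" for L0 l0
  proof -
    note l0 = homotopy_approximation_hom_bijective[OF sh R hulls_in_R that]
    have arr: "l0 \<in> Arr (stable_category E \<iota> \<pi>)" using l0(1) unfolding Hom_def by blast
    note bij = stable.hom_bijective_localizing_closure[OF sh R_T arr l0(3,4)]
    have X_T: "X \<in> Ob (stable_category E \<iota> \<pi>)" using X by simp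
    show ?thesis
      unfolding T_eq
      by (rule stable.right_adjoint_isomorphic[OF adj X_T _ l0(1)]) (use l0(2) bij S in simp_all)
  qed
  then show ?thesis using homotopy_approximation_exists[OF finite_dim R] by blast
qed

end
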